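(* Let $n,p$ be real numbers with $0<p<n/2$, let $W=W_{p,n}$, and let $\mathcal Z(W)$ be the center of $\mathcal D(W)$. The algebra $\mathcal D(W)$ is a finitely generated torsion-free module over the ring $\mathcal Z(W)$. It is not flat over $\mathcal Z(W)$, and hence it is not projective over $\mathcal Z(W)$.
   Context: Weight: for real $0<p<n/2$, $$W_{p,n}(x)=(1-x^2)^{\frac n2-1}\begin{pmatrix} p\,x^2+n-p & -nx\\ -nx & (n-p)x^2+p\end{pmatrix},\quad x\in[-1,1].$$ $M_2$ denotes complex $2\times2$ matrices, $T^*$ the conjugate transpose. On $M_2[x]$ use the matrix-valued form $(P,Q)=\int_{-1}^1 P(x)W(x)Q(x)^*\,dx$; $\{Q_w\}_{w\ge0}$ is the unique sequence of monic orthogonal polynomials ($Q_w\in M_2[x]$ monic of degree $w$, $(Q_w,Q_{w'})=0$ for $w\neq w'$). Differential operators $D=\sum_{i=0}^s\partial^iF_i$, $\partial=\frac{d}{dx}$, $F_i\in M_2[x]$, act on the right: $PD=\sum_i \partial^i(P)\,F_i$; the product satisfies $P(DE)=(PD)E$. $$\mathcal D(W)=\{D:\ Q_wD=\Lambda_w(D)Q_w \text{ for some }\Lambda_w(D)\in M_2,\ \text{for all } w\ge0\},$$ an associative unital algebra over $\mathbb C$. (The coefficients of any such $D$ are automatically polynomials with $\deg F_i\le i$.) *)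

theory Defs
  imports
    "HOL-Analysis.Analysis"
    "HOL-Computational_Algebra.Polynomial"
    "HOL-Algebra.Module"
    "HOL-Algebra.Generated_Groups"
    "HOL-Algebra.Free_Abelian_Groups"
begin

section \<open>Matrix polynomials and the orthogonal sequence of a weight\<close>

text \<open>The algebra of matrix polynomials is rendered as the algebra of matrices of polynomials
  (the library's type of polynomials needs commutative coefficients to be multiplied).
  The product of matrices is \<open>**\<close>.\<close>

type_synonym mat2 = "complex ^ 2 ^ 2"
type_synonym mpoly2 = "complex poly ^ 2 ^ 2"

definition conj_transpose :: "mat2 \<Rightarrow> mat2" where
  "conj_transpose A = (\<chi> i j. cnj (A $ j $ i))"

definition mpoly_const :: "mat2 \<Rightarrow> mpoly2" where
  "mpoly_const A = (\<chi> i j. [:A $ i $ j:])"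

definition mpoly_coeff :: "mpoly2 \<Rightarrow> nat \<Rightarrow> mat2" where
  "mpoly_coeff P k = (\<chi> i j. coeff (P $ i $ j) k)"

definition mpoly_eval :: "mpoly2 \<Rightarrow> real \<Rightarrow> mat2" where
  "mpoly_eval P x = (\<chi> i j. poly (P $ i $ j) (complex_of_real x))"

definition mpoly_deriv :: "mpoly2 \<Rightarrow> mpoly2" where
  "mpoly_deriv P = (\<chi> i j. pderiv (P $ i $ j))"

definition monic_of_degree :: "nat \<Rightarrow> mpoly2 \<Rightarrow> bool" where
  "monic_of_degree w P \<longleftrightarrow> mpoly_coeff P w = mat 1 \<and> (\<forall>k>w. mpoly_coeff P k = 0)"

definition matrix_form :: "(real \<Rightarrow> mat2) \<Rightarrow> mpoly2 \<Rightarrow> mpoly2 \<Rightarrow> mat2" where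
  "matrix_form W P Q =
     integral {-1..1} (\<lambda>x. mpoly_eval P x ** W x ** conj_transpose (mpoly_eval Q x))"

definition monic_orthogonal :: "(real \<Rightarrow> mat2) \<Rightarrow> (nat \<Rightarrow> mpoly2) \<Rightarrow> bool" where
  "monic_orthogonal W Q \<longleftrightarrow>
     (\<forall>w. monic_of_degree w (Q w)) \<and>
     (\<forall>w w'. w \<noteq> w' \<longrightarrow> matrix_form W (Q w) (Q w') = 0)"

definition monic_orthogonal_seq :: "(real \<Rightarrow> mat2) \<Rightarrow> nat \<Rightarrow> mpoly2" where
  "monic_orthogonal_seq W = (THE Q. monic_orthogonal W Q)"

definition weight :: "real \<Rightarrow> real \<Rightarrow> real \<Rightarrow> mat2" where
  "weight p n x = ((1 - x\<^sup>2) powr (n / 2 - 1)) *\<^sub>R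
     vector [vector [complex_of_real (p * x\<^sup>2 + n - p), complex_of_real (- n * x)],
             vector [complex_of_real (- n * x), complex_of_real ((n - p) * x\<^sup>2 + p)]]"


section \<open>Differential operators\<close>

text \<open>A differential operator is identified with the map \<open>P \<mapsto> P D\<close> that it induces on matrix
  polynomials; the coefficients are determined by this map. Operators act on the right, so the
  product \<open>D E\<close> is \<open>D\<close> followed by \<open>E\<close>, that is, \<open>E \<circ> D\<close>.\<close>

type_synonym mat_op = "mpoly2 \<Rightarrow> mpoly2"

definition diff_op :: "nat \<Rightarrow> (nat \<Rightarrow> mpoly2) \<Rightarrow> mat_op" where
  "diff_op s F = (\<lambda>P. \<Sum>i\<le>s. (mpoly_deriv ^^ i) P ** F i)"

definition weight_ops :: "(real \<Rightarrow> mat2) \<Rightarrow> mat_op set" where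
  "weight_ops W = {D. (\<exists>s F. D = diff_op s F) \<and>
     (\<forall>w. \<exists>\<Lambda>. D (monic_orthogonal_seq W w) = mpoly_const \<Lambda> ** monic_orthogonal_seq W w)}"

definition op_algebra :: "(real \<Rightarrow> mat2) \<Rightarrow> mat_op ring" where
  "op_algebra W =
     \<lparr>carrier = weight_ops W, mult = (\<lambda>D E. E \<circ> D), one = id,
      ring.zero = (\<lambda>P. 0), ring.add = (\<lambda>D E P. D P + E P)\<rparr>"


section \<open>The center of a ring, and a ring as a module over its center\<close>

definition center :: "'a ring \<Rightarrow> 'a ring" where
  "center R = R\<lparr>carrier := {z \<in> carrier R. \<forall>x\<in>carrier R. z \<otimes>\<^bsub>R\<^esub> x = x \<otimes>\<^bsub>R\<^esub> z}\<rparr>"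

definition center_module :: "'a ring \<Rightarrow> ('a, 'a) module" where
  "center_module R =
     \<lparr>carrier = carrier R, mult = mult R, one = one R, ring.zero = \<zero>\<^bsub>R\<^esub>, ring.add = ring.add R,
      smult = mult R\<rparr>"


section \<open>Properties of modules over a commutative ring\<close>

definition finitely_generated_module :: "'r ring \<Rightarrow> ('r, 'm) module \<Rightarrow> bool" where
  "finitely_generated_module R M \<longleftrightarrow>
     (\<exists>S. finite S \<and> S \<subseteq> carrier M \<and>
       (\<forall>m\<in>carrier M. \<exists>c\<in>S \<rightarrow> carrier R. m = (\<Oplus>\<^bsub>M\<^esub>s\<in>S. c s \<odot>\<^bsub>M\<^esub> s)))"

text \<open>This is the notion for integral domains. If the ring acts faithfully on the module, it forces
  the ring to have no zero divisors.\<close>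

definition torsion_free_module :: "'r ring \<Rightarrow> ('r, 'm) module \<Rightarrow> bool" where
  "torsion_free_module R M \<longleftrightarrow>
     (\<forall>r\<in>carrier R. \<forall>m\<in>carrier M. r \<odot>\<^bsub>M\<^esub> m = \<zero>\<^bsub>M\<^esub> \<longrightarrow> r = \<zero>\<^bsub>R\<^esub> \<or> m = \<zero>\<^bsub>M\<^esub>)"

definition linear_maps :: "'r ring \<Rightarrow> ('r, 'a) module \<Rightarrow> ('r, 'b) module \<Rightarrow> ('a \<Rightarrow> 'b) set" where
  "linear_maps R A B =
     {f \<in> carrier A \<rightarrow> carrier B.
        (\<forall>x\<in>carrier A. \<forall>y\<in>carrier A. f (x \<oplus>\<^bsub>A\<^esub> y) = f x \<oplus>\<^bsub>B\<^esub> f y) \<and>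
        (\<forall>r\<in>carrier R. \<forall>x\<in>carrier A. f (r \<odot>\<^bsub>A\<^esub> x) = r \<odot>\<^bsub>B\<^esub> f x)}"

text \<open>The tensor product, as an abelian group: the free abelian group on
  \<open>carrier A \<times> carrier M\<close> modulo the subgroup generated by the bilinearity relations.
  The library writes the free abelian group multiplicatively.\<close>

definition tensor_relations ::
    "'r ring \<Rightarrow> ('r, 'a) module \<Rightarrow> ('r, 'm) module \<Rightarrow> ('a \<times> 'm \<Rightarrow>\<^sub>0 int) set" where
  "tensor_relations R A M =
     {frag_of (a \<oplus>\<^bsub>A\<^esub> a', m) - frag_of (a, m) - frag_of (a', m) | a a' m.
        a \<in> carrier A \<and> a' \<in> carrier A \<and> m \<in> carrier M} \<union>
     {frag_of (a, m \<oplus>\<^bsub>M\<^esub> m') - frag_of (a, m) - frag_of (a, m') | a m m'.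
        a \<in> carrier A \<and> m \<in> carrier M \<and> m' \<in> carrier M} \<union>
     {frag_of (r \<odot>\<^bsub>A\<^esub> a, m) - frag_of (a, r \<odot>\<^bsub>M\<^esub> m) | r a m.
        r \<in> carrier R \<and> a \<in> carrier A \<and> m \<in> carrier M}"

definition tensor_free :: "('r, 'a) module \<Rightarrow> ('r, 'm) module \<Rightarrow> ('a \<times> 'm \<Rightarrow>\<^sub>0 int) monoid" where
  "tensor_free A M = free_Abelian_group (carrier A \<times> carrier M)"

definition tensor_subgroup ::
    "'r ring \<Rightarrow> ('r, 'a) module \<Rightarrow> ('r, 'm) module \<Rightarrow> ('a \<times> 'm \<Rightarrow>\<^sub>0 int) set" where
  "tensor_subgroup R A M = generate (tensor_free A M) (tensor_relations R A M)"

definition tensor_product ::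
    "'r ring \<Rightarrow> ('r, 'a) module \<Rightarrow> ('r, 'm) module \<Rightarrow> ('a \<times> 'm \<Rightarrow>\<^sub>0 int) set monoid" where
  "tensor_product R A M = tensor_free A M Mod tensor_subgroup R A M"

text \<open>For linear \<open>f : A \<rightarrow> B\<close>, the map \<open>f \<otimes> id : A \<otimes> M \<rightarrow> B \<otimes> M\<close> on cosets, induced by
  \<open>(a, m) \<mapsto> (f a, m)\<close>; the set below is a singleton when \<open>X\<close> is a coset in
  \<open>tensor_product R A M\<close>.\<close>

definition tensor_map ::
    "'r ring \<Rightarrow> ('r, 'b) module \<Rightarrow> ('r, 'm) module \<Rightarrow> ('a \<Rightarrow> 'b) \<Rightarrow>
      ('a \<times> 'm \<Rightarrow>\<^sub>0 int) set \<Rightarrow> ('b \<times> 'm \<Rightarrow>\<^sub>0 int) set" where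
  "tensor_map R B M f X =
     the_elem ((\<lambda>c. tensor_subgroup R B M #>\<^bsub>tensor_free B M\<^esub>
                      frag_extend (\<lambda>(a, m). frag_of (f a, m)) c) ` X)"

text \<open>\<open>M\<close> is flat if tensoring with \<open>M\<close> preserves injections. HOL cannot quantify over types inside
  a formula, so the type in which the test modules live is a parameter. Failure of flatness (or of
  projectivity, below) with test modules in one particular type is failure in general. For flatness
  the type of the ring elements already gives the usual notion, because injections of ideals into
  the ring suffice as tests.\<close>

definition flat_module :: "'c itself \<Rightarrow> 'r ring \<Rightarrow> ('r, 'm) module \<Rightarrow> bool" where
  "flat_module (_ :: 'c itself) R M \<longleftrightarrow>
     (\<forall>(A :: ('r, 'c) module) (B :: ('r, 'c) module) f.
        Module.module R A \<and> Module.module R B \<and> f \<in> linear_maps R A B \<and> inj_on f (carrier A) \<longrightarrow>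
        inj_on (tensor_map R B M f) (carrier (tensor_product R A M)))"

text \<open>\<open>M\<close> is projective if linear maps from \<open>M\<close> lift along linear surjections \<open>g : A \<rightarrow> B\<close>. The
  types of \<open>A\<close> and \<open>B\<close> are parameters. With \<open>'m \<Rightarrow> 'r\<close> and \<open>'m\<close> this is the usual notion:
  the test with \<open>B = M\<close> and \<open>A\<close> the free module on the set \<open>carrier M\<close> suffices.\<close>

definition projective_module ::
    "'c itself \<Rightarrow> 'd itself \<Rightarrow> 'r ring \<Rightarrow> ('r, 'm) module \<Rightarrow> bool" where
  "projective_module (_ :: 'c itself) (_ :: 'd itself) R M \<longleftrightarrow>
     (\<forall>(A :: ('r, 'c) module) (B :: ('r, 'd) module) g h.
        Module.module R A \<and> Module.module R B \<and>
        g \<in> linear_maps R A B \<and> g ` carrier A = carrier B \<and> h \<in> linear_maps R M B \<longrightarrow>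
        (\<exists>k\<in>linear_maps R M A. \<forall>m\<in>carrier M. g (k m) = h m))"

end

(*
The eigenvalue map D |-> (Lambda_w(D)) is an injective ring homomorphism on D(W). Four operators of
order two in D(W), with eigenvalues f1 E11, f2 E22, f3 E21 and f4 E12, are found by integration by
parts; here t = w(w+n+1), f1 = t + alpha1 and f2 = t + alpha2 with alpha1 /= alpha2, and
f3 f4 = f1 f2. The sum D0 of the first two has a scalar leading coefficient x^2 - 1, and the
commutator with D0 splits any operator of D(W) into a diagonal part and two off-diagonal parts. If T
is such a part of order s, the coefficient of order s + 1 of its commutator with D0 yields a first
order linear differential equation for the leading coefficient F of T. Its polynomial solutions
vanish for odd s and are determined by their coefficient of x^s, so that the order of T can be
lowered by subtracting products of the four operators. By induction D(W) is generated by them.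

Conjugating by diag(f3, 1), D(W) becomes the ring of all 2x2 matrices over C[t] that are lower
triangular at t1 = -alpha1 and t2 = -alpha2 and whose (1,1) entry at t1 equals the (2,2) entry at
t2. Its center consists of the scalar matrices f I with f(t1) = f(t2), the coordinate ring of a nodal
curve, and the (2,1) entry splits off a copy of the normalization C[t]. The normalization is finite
and torsion-free over the nodal ring, but it is neither flat nor projective.
*)
theory Submission
  imports Defs
begin

section \<open>Rings as modules over their center\<close>

text \<open>The hypothesis p < n/2 acts through \<alpha>1 - \<alpha>2 = 2 p - n: it keeps the two
  glued points of the line apart and lets the commutator with \<open>D0\<close> distinguish the
  diagonal from each off-diagonal position. The four operators reflect a splitting of the weight: up
  to the scalar Gegenbauer factor it is (n - p) a a^T + p b b^T with a = (1, -x) and b = (x, -1),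
  and their leading coefficients times the weight are multiples of b b^T, a a^T, a b^T and b a^T.
  Lowering the order works because the coefficient of x^s in the leading coefficient F of an
  operator of order s is also the coefficient of w^s in its eigenvalue, a polynomial in w; so only
  eigenvalues of products have to be known. The conjugation is needed because f3 and f4 are not
  polynomials in t, only their product is. The orthogonal polynomials are never written down: an
  operator that does not raise degrees and has an adjoint of the same kind lies in the algebra. The
  analytic obstacle is that for n < 2 the weight is unbounded at the endpoints, so even
  integrability needs an argument.\<close>

lemma carrier_center:
  "carrier (center R) = {z \<in> carrier R. \<forall>x\<in>carrier R. z \<otimes>\<^bsub>R\<^esub> x = x \<otimes>\<^bsub>R\<^esub> z}"
  and center_ops [simp]: "\<zero>\<^bsub>center R\<^esub> = \<zero>\<^bsub>R\<^esub>" "\<one>\<^bsub>center R\<^esub> = \<one>\<^bsub>R\<^esub>" "add (center R) = add R"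
    "mult (center R) = mult R"
  by (simp_all add: center_def)

lemma center_closed: "z \<in> carrier (center R) \<Longrightarrow> z \<in> carrier R"
  by (simp add: carrier_center)

lemma center_module_ops [simp]:
  "carrier (center_module R) = carrier R" "\<zero>\<^bsub>center_module R\<^esub> = \<zero>\<^bsub>R\<^esub>"
  "add (center_module R) = add R" "smult (center_module R) = mult R"
  by (simp_all add: center_module_def)

context
  fixes R :: "'a ring" (structure)
  assumes R: "Ring.ring R"
begin

interpretation ring R by (rule R)

lemma cring_center: "cring (center R)"
proof (rule cringI)
  show "abelian_group (center R)"
  proof (rule abelian_groupI)
    fix z assume z: "z \<in> carrier (center R)"
    then have "\<ominus> z \<in> carrier (center R)"
      by (auto simp: carrier_center l_minus r_minus)
    with z show "\<exists>y\<in>carrier (center R). y \<oplus>\<^bsub>center R\<^esub> z = \<zero>\<^bsub>center R\<^esub>"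
      by (intro bexI[of _ "\<ominus> z"]) (auto simp: l_neg dest: center_closed)
  qed (auto simp: carrier_center l_distr r_distr a_ac)
  show "Group.comm_monoid (center R)"
  proof (rule comm_monoidI)
    fix x y assume "x \<in> carrier (center R)" "y \<in> carrier (center R)"
    then show "x \<otimes>\<^bsub>center R\<^esub> y \<in> carrier (center R)"
      unfolding carrier_center mem_Collect_eq center_ops
    proof (elim conjE, intro conjI ballI)
      fix t assume t: "t \<in> carrier R" and x: "x \<in> carrier R" "\<forall>t\<in>carrier R. x \<otimes> t = t \<otimes> x"
        and y: "y \<in> carrier R" "\<forall>t\<in>carrier R. y \<otimes> t = t \<otimes> y"
      have "x \<otimes> y \<otimes> t = x \<otimes> (y \<otimes> t)" using t x(1) y(1) by (simp add: m_assoc)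
      also have "\<dots> = x \<otimes> (t \<otimes> y)" using y(2) t by metis
      also have "\<dots> = (x \<otimes> t) \<otimes> y" using t x(1) y(1) by (simp add: m_assoc)
      also have "\<dots> = (t \<otimes> x) \<otimes> y" using x(2) t by metis
      finally show "x \<otimes> y \<otimes> t = t \<otimes> (x \<otimes> y)" using t x(1) y(1) by (simp add: m_assoc)
    qed (rule m_closed)
  next
    fix x y assume "x \<in> carrier (center R)" "y \<in> carrier (center R)"
    then show "x \<otimes>\<^bsub>center R\<^esub> y = y \<otimes>\<^bsub>center R\<^esub> x"
      unfolding carrier_center center_ops mem_Collect_eq by metis
  next
    show "\<one>\<^bsub>center R\<^esub> \<in> carrier (center R)" by (simp add: carrier_center)
  qed (auto simp: m_assoc dest!: center_closed)
qed (simp add: l_distr center_closed)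

text \<open>The modules below that sit inside the ring are instances: the ring itself, its center,
  the ideal of the node and the (2,1) entries. Closure under negatives comes from multiplying by -1,
  which is central.\<close>

lemma submodule_center_module:
  assumes "I \<subseteq> carrier R" "\<zero> \<in> I"
    and add: "\<And>x y. x \<in> I \<Longrightarrow> y \<in> I \<Longrightarrow> x \<oplus> y \<in> I"
    and smult: "\<And>z x. z \<in> carrier (center R) \<Longrightarrow> x \<in> I \<Longrightarrow> z \<otimes> x \<in> I"
  shows "Module.module (center R) ((center_module R)\<lparr>carrier := I\<rparr>)"
proof (rule moduleI)
  show "abelian_group ((center_module R)\<lparr>carrier := I\<rparr>)"
  proof (rule abelian_groupI)
    fix x assume "x \<in> carrier ((center_module R)\<lparr>carrier := I\<rparr>)"
    then have x: "x \<in> I" "x \<in> carrier R" using assms(1) by auto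
    have "\<ominus> \<one> \<in> carrier (center R)" by (auto simp: carrier_center l_minus r_minus)
    from smult[OF this x(1)] x(2) show
      "\<exists>y\<in>carrier ((center_module R)\<lparr>carrier := I\<rparr>). y \<oplus>\<^bsub>(center_module R)\<lparr>carrier := I\<rparr>\<^esub> x
        = \<zero>\<^bsub>(center_module R)\<lparr>carrier := I\<rparr>\<^esub>"
      by (intro bexI[of _ "\<ominus> \<one> \<otimes> x"]) (auto simp: l_minus l_neg)
  qed (use assms(1,2) add in \<open>auto simp: a_ac subset_iff\<close>)
next
  fix z x assume "z \<in> carrier (center R)" "x \<in> carrier ((center_module R)\<lparr>carrier := I\<rparr>)"
  then show "z \<odot>\<^bsub>(center_module R)\<lparr>carrier := I\<rparr>\<^esub> x \<in> carrier ((center_module R)\<lparr>carrier := I\<rparr>)"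
    using smult by simp
qed (use assms(1) cring_center in \<open>auto simp: l_distr r_distr m_assoc subset_iff center_closed\<close>)

lemma module_center_module: "Module.module (center R) (center_module R)"
  using submodule_center_module[of "carrier R"] by (simp add: center_module_def center_closed)

end

text \<open>The product of copies of the ring indexed by a type. It is the source of the surjection
  that defeats projectivity, where the coordinates at \<open>\<zero>\<close> and
  \<open>\<one>\<close> play the part of a free module of rank two.\<close>

definition function_module :: "'a ring \<Rightarrow> ('a, 'i \<Rightarrow> 'a) module" where
  "function_module R = \<lparr>carrier = {F. \<forall>i. F i \<in> carrier R}, mult = (\<lambda>F G i. F i \<otimes>\<^bsub>R\<^esub> G i),
     one = (\<lambda>i. \<one>\<^bsub>R\<^esub>), ring.zero = (\<lambda>i. \<zero>\<^bsub>R\<^esub>), ring.add = (\<lambda>F G i. F i \<oplus>\<^bsub>R\<^esub> G i),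
     smult = (\<lambda>r F i. r \<otimes>\<^bsub>R\<^esub> F i)\<rparr>"

lemma module_function_module:
  fixes R :: "'a ring" (structure)
  assumes "Ring.cring R"
  shows "Module.module R (function_module R :: ('a, 'i \<Rightarrow> 'a) module)"
proof -
  interpret cring R by fact
  show ?thesis
  proof (rule moduleI)
    show "cring R" by fact
    show "abelian_group (function_module R :: ('a, 'i \<Rightarrow> 'a) module)"
    proof (rule abelian_groupI)
      fix F :: "'i \<Rightarrow> 'a" assume "F \<in> carrier (function_module R)"
      then show "\<exists>G\<in>carrier (function_module R). G \<oplus>\<^bsub>function_module R\<^esub> F = \<zero>\<^bsub>function_module R\<^esub>"
        by (intro bexI[of _ "\<lambda>i. \<ominus> F i"]) (auto simp: function_module_def l_neg)
    qed (auto simp: function_module_def a_ac)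
  qed (auto simp: function_module_def l_distr r_distr m_assoc)
qed

text \<open>Changing the coefficient at \<open>s\<close> instead of enlarging the index set lets a
  combination be built term by term even if some of the listed generators coincide.\<close>

lemma (in Module.module) finsum_fun_upd_add:
  assumes "finite S" "S \<subseteq> carrier M" "s \<in> S" "c \<in> S \<rightarrow> carrier R" "r \<in> carrier R"
  shows "(\<Oplus>\<^bsub>M\<^esub>x\<in>S. (c(s := c s \<oplus> r)) x \<odot>\<^bsub>M\<^esub> x) = (\<Oplus>\<^bsub>M\<^esub>x\<in>S. c x \<odot>\<^bsub>M\<^esub> x) \<oplus>\<^bsub>M\<^esub> r \<odot>\<^bsub>M\<^esub> s"
proof -
  have cl: "c x \<odot>\<^bsub>M\<^esub> x \<in> carrier M" if "x \<in> S" for x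
    using assms that by auto
  have s: "s \<in> carrier M" "c s \<in> carrier R" using assms by auto
  have S: "insert s (S - {s}) = S" using assms(3) by auto
  have *: "(\<Oplus>\<^bsub>M\<^esub>x\<in>S - {s}. (c(s := c s \<oplus> r)) x \<odot>\<^bsub>M\<^esub> x) = (\<Oplus>\<^bsub>M\<^esub>x\<in>S - {s}. c x \<odot>\<^bsub>M\<^esub> x)"
    by (rule M.finsum_cong') (auto simp: cl)
  have "(\<Oplus>\<^bsub>M\<^esub>x\<in>S. (c(s := c s \<oplus> r)) x \<odot>\<^bsub>M\<^esub> x)
      = (c s \<oplus> r) \<odot>\<^bsub>M\<^esub> s \<oplus>\<^bsub>M\<^esub> (\<Oplus>\<^bsub>M\<^esub>x\<in>S - {s}. c x \<odot>\<^bsub>M\<^esub> x)"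
    by (subst S[symmetric], subst M.finsum_insert)
      (use assms s cl * in \<open>auto simp del: insert_Diff_single\<close>)
  moreover have "(\<Oplus>\<^bsub>M\<^esub>x\<in>S. c x \<odot>\<^bsub>M\<^esub> x) = c s \<odot>\<^bsub>M\<^esub> s \<oplus>\<^bsub>M\<^esub> (\<Oplus>\<^bsub>M\<^esub>x\<in>S - {s}. c x \<odot>\<^bsub>M\<^esub> x)"
    by (subst S[symmetric], subst M.finsum_insert)
      (use assms s cl in \<open>auto simp del: insert_Diff_single\<close>)
  moreover have "(\<Oplus>\<^bsub>M\<^esub>x\<in>S - {s}. c x \<odot>\<^bsub>M\<^esub> x) \<in> carrier M"
    by (rule M.finsum_closed) (auto simp: cl)
  ultimately show ?thesis
    using s assms(5) by (simp add: smult_l_distr M.a_ac)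
qed

lemma (in Module.module) span_add:
  assumes "finite S" "S \<subseteq> carrier M" "s \<in> S" "r \<in> carrier R"
    and "\<exists>c\<in>S \<rightarrow> carrier R. m = (\<Oplus>\<^bsub>M\<^esub>x\<in>S. c x \<odot>\<^bsub>M\<^esub> x)"
  shows "\<exists>c\<in>S \<rightarrow> carrier R. m \<oplus>\<^bsub>M\<^esub> r \<odot>\<^bsub>M\<^esub> s = (\<Oplus>\<^bsub>M\<^esub>x\<in>S. c x \<odot>\<^bsub>M\<^esub> x)"
proof -
  from assms(5) obtain c where "c \<in> S \<rightarrow> carrier R" "m = (\<Oplus>\<^bsub>M\<^esub>x\<in>S. c x \<odot>\<^bsub>M\<^esub> x)" by blast
  moreover from this assms(3,4) have "c(s := c s \<oplus> r) \<in> S \<rightarrow> carrier R" by (auto simp: Pi_iff)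
  ultimately show ?thesis
    using finsum_fun_upd_add[OF assms(1-3) _ assms(4), of c] by metis
qed

lemma (in Module.module) span_zero:
  assumes "S \<subseteq> carrier M"
  shows "\<exists>c\<in>S \<rightarrow> carrier R. \<zero>\<^bsub>M\<^esub> = (\<Oplus>\<^bsub>M\<^esub>x\<in>S. c x \<odot>\<^bsub>M\<^esub> x)"
proof (rule bexI[of _ "\<lambda>_. \<zero>"])
  have "(\<Oplus>\<^bsub>M\<^esub>x\<in>S. \<zero> \<odot>\<^bsub>M\<^esub> x) = (\<Oplus>\<^bsub>M\<^esub>x\<in>S. \<zero>\<^bsub>M\<^esub>)"
  proof (rule M.finsum_cong')
    fix x assume "x \<in> S"
    then have x: "x \<in> carrier M" using assms by auto
    have "\<zero> \<odot>\<^bsub>M\<^esub> x \<oplus>\<^bsub>M\<^esub> \<zero> \<odot>\<^bsub>M\<^esub> x = \<zero> \<odot>\<^bsub>M\<^esub> x"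
      using smult_l_distr[of \<zero> \<zero> x] x by simp
    then show "\<zero> \<odot>\<^bsub>M\<^esub> x = \<zero>\<^bsub>M\<^esub>"
      using x by (simp add: M.add.l_cancel_one)
  qed auto
  then show "\<zero>\<^bsub>M\<^esub> = (\<Oplus>\<^bsub>M\<^esub>x\<in>S. \<zero> \<odot>\<^bsub>M\<^esub> x)" by simp
qed auto

section \<open>Detecting nonzero tensors\<close>

text \<open>The homomorphism from the free abelian group to the complex numbers that takes the
  values \<open>b\<close> on the basis. Its purpose is to separate formal sums from the subgroup of
  tensor relations.\<close>

definition frag_eval :: "('k \<Rightarrow> complex) \<Rightarrow> ('k \<Rightarrow>\<^sub>0 int) \<Rightarrow> complex" where
  "frag_eval b c = (\<Sum>k\<in>Poly_Mapping.keys c. of_int (Poly_Mapping.lookup c k) * b k)"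

lemma frag_eval_superset:
  assumes "finite K" "Poly_Mapping.keys c \<subseteq> K"
  shows "frag_eval b c = (\<Sum>k\<in>K. of_int (Poly_Mapping.lookup c k) * b k)"
  unfolding frag_eval_def
  by (rule sum.mono_neutral_left) (use assms in \<open>auto simp: in_keys_iff\<close>)

lemma frag_eval_add: "frag_eval b (c + d) = frag_eval b c + frag_eval b d"
proof -
  let ?K = "Poly_Mapping.keys c \<union> Poly_Mapping.keys d"
  have "Poly_Mapping.keys (c + d) \<subseteq> ?K" by (rule Poly_Mapping.keys_add)
  then show ?thesis
    by (simp add: frag_eval_superset[of ?K] Poly_Mapping.lookup_add sum.distrib distrib_right)
qed

lemma frag_eval_minus: "frag_eval b (- c) = - frag_eval b c"
  by (simp add: frag_eval_def sum_negf)

lemma frag_eval_diff: "frag_eval b (c - d) = frag_eval b c - frag_eval b d"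
  using frag_eval_add[of b c "- d"] by (simp add: frag_eval_minus)

lemma frag_eval_of [simp]: "frag_eval b (frag_of k) = b k"
  by (simp add: frag_eval_def)

lemma tensor_relations_subset:
  assumes "Module.module R A" "Module.module R M"
  shows "tensor_relations R A M \<subseteq> carrier (tensor_free A M)"
proof -
  interpret A: Module.module R A by fact
  interpret M: Module.module R M by fact
  have d: "Poly_Mapping.keys (x - y) \<subseteq> S"
    if "Poly_Mapping.keys x \<subseteq> S" "Poly_Mapping.keys y \<subseteq> S" for x y :: "'k \<Rightarrow>\<^sub>0 int" and S
    using Poly_Mapping.keys_diff[of x y] that by blast
  show ?thesis
    unfolding tensor_relations_def tensor_free_def Un_subset_iff
    by (intro conjI subsetI; elim CollectE exE conjE; hypsubst;
      unfold carrier_free_Abelian_group_iff; intro d; simp add: keys_frag_of)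
qed

text \<open>A balanced biadditive \<open>b\<close> kills the three kinds of generators, so it
  induces a functional on the tensor product. A nonzero value then certifies a nonzero
  tensor.\<close>

lemma frag_eval_tensor_subgroup:
  assumes "Module.module R A" "Module.module R M" "c \<in> tensor_subgroup R A M"
    and l: "\<And>a a' m. a \<in> carrier A \<Longrightarrow> a' \<in> carrier A \<Longrightarrow> m \<in> carrier M \<Longrightarrow>
      b (a \<oplus>\<^bsub>A\<^esub> a', m) = b (a, m) + b (a', m)"
    and r: "\<And>a m m'. a \<in> carrier A \<Longrightarrow> m \<in> carrier M \<Longrightarrow> m' \<in> carrier M \<Longrightarrow>
      b (a, m \<oplus>\<^bsub>M\<^esub> m') = b (a, m) + b (a, m')"
    and s: "\<And>r a m. r \<in> carrier R \<Longrightarrow> a \<in> carrier A \<Longrightarrow> m \<in> carrier M \<Longrightarrow>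
      b (r \<odot>\<^bsub>A\<^esub> a, m) = b (a, r \<odot>\<^bsub>M\<^esub> m)"
  shows "frag_eval b c = 0"
proof -
  have rel: "frag_eval b h = 0" if "h \<in> tensor_relations R A M" for h
    using that unfolding tensor_relations_def by (auto simp: frag_eval_diff l r s)
  from assms(3) show ?thesis
    unfolding tensor_subgroup_def
  proof (induction rule: generate.induct)
    case (inv h)
    moreover have "h \<in> carrier (tensor_free A M)"
      using tensor_relations_subset[OF assms(1,2)] inv by blast
    ultimately show ?case
      by (simp add: tensor_free_def frag_eval_minus rel)
  qed (auto simp: tensor_free_def frag_eval_add rel, simp add: frag_eval_def)
qed

text \<open>The tensor u \<otimes> x - v \<otimes> y is nonzero over the submodule \<open>A\<close>
  and becomes zero over \<open>B\<close>, so tensoring destroys the injectivity of the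
  inclusion.\<close>

lemma not_flat_moduleI:
  fixes R :: "'r ring" and A B :: "('r, 'c) module" and M :: "('r, 'm) module"
  assumes mods: "Module.module R A" "Module.module R B" "Module.module R M"
    and sub: "carrier A \<subseteq> carrier B" "add A = add B" "smult A = smult B"
    and mem: "u \<in> carrier A" "v \<in> carrier A" "x \<in> carrier M" "y \<in> carrier M"
    and eq: "frag_of (u, x) - frag_of (v, y) \<in> tensor_subgroup R B M"
    and ne: "frag_of (u, x) - frag_of (v, y) \<notin> tensor_subgroup R A M"
  shows "\<not> flat_module TYPE('c) R M"
proof
  assume flat: "flat_module TYPE('c) R M"
  have "id \<in> linear_maps R A B" using sub by (auto simp: linear_maps_def)
  then have inj: "inj_on (tensor_map R B M id) (carrier (tensor_product R A M))"
    using flat mods unfolding flat_module_def by auto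
  interpret FA: comm_group "tensor_free A M"
    unfolding tensor_free_def by (rule abelian_free_Abelian_group)
  interpret FB: comm_group "tensor_free B M"
    unfolding tensor_free_def by (rule abelian_free_Abelian_group)
  have HA: "subgroup (tensor_subgroup R A M) (tensor_free A M)"
    unfolding tensor_subgroup_def
    by (rule FA.generate_is_subgroup) (rule tensor_relations_subset[OF mods(1,3)])
  have HB: "subgroup (tensor_subgroup R B M) (tensor_free B M)"
    unfolding tensor_subgroup_def
    by (rule FB.generate_is_subgroup) (rule tensor_relations_subset[OF mods(2,3)])
  have relsub: "tensor_relations R A M \<subseteq> tensor_relations R B M"
    unfolding tensor_relations_def sub(2,3)
    by (intro Un_mono Collect_mono) (use sub(1) in \<open>blast dest: subsetD\<close>)+
  have carr: "carrier (tensor_free A M) \<subseteq> carrier (tensor_free B M)"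
    unfolding tensor_free_def
    by (intro subsetI, unfold carrier_free_Abelian_group_iff) (use sub(1) in blast)
  have HAB: "c \<in> tensor_subgroup R B M" if "c \<in> tensor_subgroup R A M" for c
    using that unfolding tensor_subgroup_def
  proof (induction rule: generate.induct)
    case one
    then show ?case using generate.one[of "tensor_free B M"] by (simp add: tensor_free_def)
  next
    case (incl h)
    then show ?case using relsub by (auto intro: generate.incl)
  next
    case (inv h)
    then have "h \<in> tensor_relations R B M" "h \<in> carrier (tensor_free A M)"
      using relsub tensor_relations_subset[OF mods(1,3)] by auto
    then show ?case
      using generate.inv[of h "tensor_relations R B M" "tensor_free B M"] carr
      by (auto simp: tensor_free_def subset_iff)
  next
    case (eng g h)
    then show ?case
      using generate.eng[of g "tensor_free B M" "tensor_relations R B M" h] by (simp add: tensor_free_def)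
  qed
  have fragid: "frag_extend (\<lambda>(a, m). frag_of (id a, m)) c = c" for c :: "'c \<times> 'm \<Rightarrow>\<^sub>0 int"
    using frag_expansion[of c] by (simp add: case_prod_unfold)
  have memA: "frag_of (a, m) \<in> carrier (tensor_free A M)" if "a \<in> carrier A" "m \<in> carrier M" for a m
    using that by (simp add: tensor_free_def)
  \<comment> \<open>\<open>tensor_map\<close> extracts its value with \<open>the_elem\<close>, so a
    coset has to be sent to a single coset; this holds because the relations for \<open>A\<close>
    are among those for \<open>B\<close>.\<close>
  have img: "tensor_map R B M id (tensor_subgroup R A M #>\<^bsub>tensor_free A M\<^esub> c)
      = tensor_subgroup R B M #>\<^bsub>tensor_free B M\<^esub> c" if c: "c \<in> carrier (tensor_free A M)" for c
  proof -
    have "(\<lambda>d. tensor_subgroup R B M #>\<^bsub>tensor_free B M\<^esub> d) ` (tensor_subgroup R A M #>\<^bsub>tensor_free A M\<^esub> c)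
        = {tensor_subgroup R B M #>\<^bsub>tensor_free B M\<^esub> c}"
    proof (rule Set.set_eqI, rule iffI)
      fix X assume "X \<in> (\<lambda>d. tensor_subgroup R B M #>\<^bsub>tensor_free B M\<^esub> d) ` (tensor_subgroup R A M #>\<^bsub>tensor_free A M\<^esub> c)"
      then obtain h where h: "h \<in> tensor_subgroup R A M"
        and X: "X = tensor_subgroup R B M #>\<^bsub>tensor_free B M\<^esub> (h + c)"
        by (auto simp: r_coset_def tensor_free_def)
      have "h + c \<in> tensor_subgroup R B M #>\<^bsub>tensor_free B M\<^esub> c"
        using HAB[OF h] by (auto simp: r_coset_def tensor_free_def)
      then have "tensor_subgroup R B M #>\<^bsub>tensor_free B M\<^esub> c
          = tensor_subgroup R B M #>\<^bsub>tensor_free B M\<^esub> (h + c)"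
        by (rule FB.repr_independence[OF _ subsetD[OF carr c] HB])
      with X show "X \<in> {tensor_subgroup R B M #>\<^bsub>tensor_free B M\<^esub> c}" by simp
    next
      fix X assume "X \<in> {tensor_subgroup R B M #>\<^bsub>tensor_free B M\<^esub> c}"
      moreover have "c \<in> tensor_subgroup R A M #>\<^bsub>tensor_free A M\<^esub> c"
        using FA.rcos_self[OF c HA] .
      ultimately show "X \<in> (\<lambda>d. tensor_subgroup R B M #>\<^bsub>tensor_free B M\<^esub> d) ` (tensor_subgroup R A M #>\<^bsub>tensor_free A M\<^esub> c)"
        by auto
    qed
    then show ?thesis
      unfolding tensor_map_def fragid by simp
  qed
  let ?X = "tensor_subgroup R A M #>\<^bsub>tensor_free A M\<^esub> frag_of (u, x)"
  let ?Y = "tensor_subgroup R A M #>\<^bsub>tensor_free A M\<^esub> frag_of (v, y)"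
  have "frag_of (u, x) \<in> tensor_subgroup R B M #>\<^bsub>tensor_free B M\<^esub> frag_of (v, y)"
    using eq by (force simp: r_coset_def tensor_free_def)
  then have "tensor_subgroup R B M #>\<^bsub>tensor_free B M\<^esub> frag_of (v, y)
      = tensor_subgroup R B M #>\<^bsub>tensor_free B M\<^esub> frag_of (u, x)"
    by (rule FB.repr_independence[OF _ subsetD[OF carr memA[OF mem(2,4)]] HB])
  then have "tensor_map R B M id ?X = tensor_map R B M id ?Y"
    using img memA mem by simp
  moreover have "?X \<in> carrier (tensor_product R A M)" "?Y \<in> carrier (tensor_product R A M)"
    using memA mem by (auto simp: tensor_product_def FactGroup_def RCOSETS_def)
  ultimately have "?X = ?Y" using inj by (auto dest: inj_onD)
  then have "frag_of (u, x) \<in> ?Y"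
    using FA.rcos_self[OF _ HA] memA[OF mem(1,3)] by auto
  then have "frag_of (u, x) - frag_of (v, y) \<in> tensor_subgroup R A M"
    by (auto simp: r_coset_def tensor_free_def)
  with ne show False by contradiction
qed


section \<open>Orders over a nodal curve\<close>

text \<open>The ring of matrix polynomials with entries \<open>e11, e12, e21, e22\<close> in one variable that are
  lower triangular at \<open>t1\<close> and \<open>t2\<close>, with the first diagonal entry at \<open>t1\<close> glued to the second
  one at \<open>t2\<close>. Its center is the coordinate ring of the line with \<open>t1\<close> and \<open>t2\<close> identified.\<close>

locale nodal_order =
  fixes R :: "'a ring" (structure)
    and e11 e12 e21 e22 :: "'a \<Rightarrow> complex poly" and t1 t2 :: complex
  assumes ring_R: "Ring.ring R"
    and nodes: "t1 \<noteq> t2"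
    and entries: "x \<in> carrier R \<Longrightarrow> poly (e12 x) t1 = 0 \<and> poly (e12 x) t2 = 0 \<and> poly (e11 x) t1 = poly (e22 x) t2"
    and surj: "\<lbrakk>poly b t1 = 0; poly b t2 = 0; poly a t1 = poly d t2\<rbrakk> \<Longrightarrow>
      \<exists>x\<in>carrier R. e11 x = a \<and> e12 x = b \<and> e21 x = c \<and> e22 x = d"
    and inj: "\<lbrakk>x \<in> carrier R; y \<in> carrier R; e11 x = e11 y; e12 x = e12 y; e21 x = e21 y; e22 x = e22 y\<rbrakk>
      \<Longrightarrow> x = y"
    and entries_add: "\<lbrakk>x \<in> carrier R; y \<in> carrier R\<rbrakk> \<Longrightarrow>
      e11 (x \<oplus> y) = e11 x + e11 y \<and> e12 (x \<oplus> y) = e12 x + e12 y \<and>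
      e21 (x \<oplus> y) = e21 x + e21 y \<and> e22 (x \<oplus> y) = e22 x + e22 y"
    and entries_mult: "\<lbrakk>x \<in> carrier R; y \<in> carrier R\<rbrakk> \<Longrightarrow>
      e11 (x \<otimes> y) = e11 x * e11 y + e12 x * e21 y \<and> e12 (x \<otimes> y) = e11 x * e12 y + e12 x * e22 y \<and>
      e21 (x \<otimes> y) = e21 x * e11 y + e22 x * e21 y \<and> e22 (x \<otimes> y) = e21 x * e12 y + e22 x * e22 y"
begin

sublocale ring R by (rule ring_R)

abbreviation Z where "Z \<equiv> center R"
abbreviation M where "M \<equiv> center_module R"

lemmas e_add [simp] = entries_add[THEN conjunct1] entries_add[THEN conjunct2, THEN conjunct1]
  entries_add[THEN conjunct2, THEN conjunct2, THEN conjunct1]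
  entries_add[THEN conjunct2, THEN conjunct2, THEN conjunct2]
lemmas e_mult = entries_mult[THEN conjunct1] entries_mult[THEN conjunct2, THEN conjunct1]
  entries_mult[THEN conjunct2, THEN conjunct2, THEN conjunct1]
  entries_mult[THEN conjunct2, THEN conjunct2, THEN conjunct2]

lemma e_zero [simp]: "e11 \<zero> = 0" "e12 \<zero> = 0" "e21 \<zero> = 0" "e22 \<zero> = 0"
  using e_add[of \<zero> \<zero>] by simp_all

section \<open>Center, torsion and generators of a nodal order\<close>

definition elt :: "complex poly \<Rightarrow> complex poly \<Rightarrow> complex poly \<Rightarrow> complex poly \<Rightarrow> 'a" where
  "elt a b c d = (SOME x. x \<in> carrier R \<and> e11 x = a \<and> e12 x = b \<and> e21 x = c \<and> e22 x = d)"

lemma elt: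
  assumes "poly b t1 = 0" "poly b t2 = 0" "poly a t1 = poly d t2"
  shows "elt a b c d \<in> carrier R" "e11 (elt a b c d) = a" "e12 (elt a b c d) = b"
    "e21 (elt a b c d) = c" "e22 (elt a b c d) = d"
  using someI_ex[OF surj[OF assms, of c, unfolded Bex_def]] unfolding elt_def by blast+

lemma e_one: "e11 \<one> = 1" "e12 \<one> = 0" "e21 \<one> = 0" "e22 \<one> = 1"
proof -
  have E: "elt 1 0 0 1 \<in> carrier R" by (rule elt) simp_all
  then show "e11 \<one> = 1" "e12 \<one> = 0" "e21 \<one> = 0" "e22 \<one> = 1"
    using e_mult[OF E one_closed] elt[of 0 1 1 0] by simp_all
qed

text \<open>Commuting with E21 forces e12 = 0 and e11 = e22. The matrix E12 is not in the ring, but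
  u E12 with u = (t - t1) (t - t2) is, and commuting with it forces e21 = 0.\<close>

lemma center_iff:
  "z \<in> carrier Z \<longleftrightarrow> z \<in> carrier R \<and> e12 z = 0 \<and> e21 z = 0 \<and> e22 z = e11 z"
proof
  assume z: "z \<in> carrier Z"
  then have zR: "z \<in> carrier R" by (rule center_closed)
  have comm: "z \<otimes> x = x \<otimes> z" if "x \<in> carrier R" for x
    using z that unfolding carrier_center by blast
  define u where "u = [:- t1, 1:] * [:- t2, 1:]"
  have u: "poly u t1 = 0" "poly u t2 = 0" "u \<noteq> 0" by (auto simp: u_def)
  have x21: "elt 0 0 1 0 \<in> carrier R" and x12: "elt 0 u 0 0 \<in> carrier R"
    using u by (auto intro: elt)
  have "e11 (z \<otimes> elt 0 0 1 0) = e11 (elt 0 0 1 0 \<otimes> z)" "e21 (z \<otimes> elt 0 0 1 0) = e21 (elt 0 0 1 0 \<otimes> z)"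
    "e11 (z \<otimes> elt 0 u 0 0) = e11 (elt 0 u 0 0 \<otimes> z)"
    using comm x21 x12 by auto
  then show "z \<in> carrier R \<and> e12 z = 0 \<and> e21 z = 0 \<and> e22 z = e11 z"
    using zR x21 x12 u by (auto simp: e_mult elt)
next
  assume z: "z \<in> carrier R \<and> e12 z = 0 \<and> e21 z = 0 \<and> e22 z = e11 z"
  then have "z \<otimes> x = x \<otimes> z" if "x \<in> carrier R" for x
    using that by (intro inj) (auto simp: e_mult)
  with z show "z \<in> carrier Z" unfolding carrier_center by blast
qed

lemma center_values: "z \<in> carrier Z \<Longrightarrow> poly (e11 z) t1 = poly (e11 z) t2"
  using entries[of z] by (auto simp: center_iff)

lemma e_smult:
  assumes "z \<in> carrier Z" "x \<in> carrier R"
  shows "e11 (z \<otimes> x) = e11 z * e11 x" "e12 (z \<otimes> x) = e11 z * e12 x"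
    "e21 (z \<otimes> x) = e11 z * e21 x" "e22 (z \<otimes> x) = e11 z * e22 x"
  using assms by (auto simp: center_iff e_mult)

definition scal :: "complex poly \<Rightarrow> 'a" where "scal f = elt f 0 0 f"

lemma scal:
  assumes "poly f t1 = poly f t2"
  shows "scal f \<in> carrier Z" "scal f \<in> carrier R" "e11 (scal f) = f"
  using elt[of 0 f f 0] assms by (auto simp: scal_def center_iff)

lemma torsion_free: "torsion_free_module Z M"
  unfolding torsion_free_module_def
proof (intro ballI impI)
  fix z x assume z: "z \<in> carrier Z" and "x \<in> carrier M" and eq: "z \<odot>\<^bsub>M\<^esub> x = \<zero>\<^bsub>M\<^esub>"
  then have x: "x \<in> carrier R" and eq': "z \<otimes> x = \<zero>" by simp_all
  have e: "e11 z * e11 x = 0" "e11 z * e12 x = 0" "e11 z * e21 x = 0" "e11 z * e22 x = 0"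
    using e_smult[OF z x] eq' by auto
  show "z = \<zero>\<^bsub>Z\<^esub> \<or> x = \<zero>\<^bsub>M\<^esub>"
  proof (cases "e11 z = 0")
    case True
    then have "z = \<zero>" using z by (intro inj) (auto simp: center_iff)
    then show ?thesis by simp
  next
    case False
    then have "x = \<zero>" using x e by (intro inj) auto
    then show ?thesis by simp
  qed
qed

text \<open>Division by u = (t - t1) (t - t2) leaves a remainder a + b t, and a multiple of u plus a
  constant takes equal values at the nodes. So the normalization is generated by 1 and t over the
  center.\<close>

lemma center_spans_poly: "\<exists>z1 z2. z1 \<in> carrier Z \<and> z2 \<in> carrier Z \<and> q = e11 z1 + e11 z2 * [:0, 1:]"
proof -
  define u :: "complex poly" where "u = [:- t1, 1:] * [:- t2, 1:]"
  have "degree u = 2" unfolding u_def by (simp add: degree_mult_eq)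
  then have "degree (q mod u) < 2"
    using degree_mod_less[of u q] by fastforce
  then have r: "q mod u = [:coeff (q mod u) 0:] + [:coeff (q mod u) 1:] * [:0, 1:]"
    by (intro poly_eqI) (auto simp: coeff_pCons coeff_eq_0 split: nat.splits)
  define f where "f = u * (q div u) + [:coeff (q mod u) 0:]"
  have "q = f + [:coeff (q mod u) 1:] * [:0, 1:]"
    using r mult_div_mod_eq[of u q] unfolding f_def by (metis add.assoc)
  moreover have "poly f t1 = poly f t2"
    unfolding f_def u_def poly_add poly_mult by simp
  ultimately show ?thesis
    using scal[of f] scal[of "[:coeff (q mod u) 1:]"] by (metis poly_pCons mult_zero_right poly_0)
qed

lemma finitely_generated: "finitely_generated_module Z M"
proof -
  interpret M: Module.module Z M by (rule module_center_module[OF ring_R])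
  define l1 l2 u where "l1 = [:- t1, 1:]" and "l2 = [:- t2, 1:]" and "u = l1 * l2"
  define X :: "complex poly" where "X = [:0, 1:]"
  note P = l1_def l2_def u_def X_def
  \<comment> \<open>The identity carries the value shared by e11 at t1 and e22 at t2. What remains
    ranges over (t - t1) C[t], u C[t], C[t] and (t - t2) C[t] in the entries 11, 12, 21 and 22, and
    each of these is a copy of C[t] with two generators.\<close>
  define S where "S = {elt 1 0 0 1, elt l1 0 0 0, elt (l1 * X) 0 0 0, elt 0 u 0 0, elt 0 (u * X) 0 0,
    elt 0 0 1 0, elt 0 0 X 0, elt 0 0 0 l2, elt 0 0 0 (l2 * X)}"
  have S: "finite S" "S \<subseteq> carrier M" unfolding S_def by (auto intro!: elt(1) simp: P)
  have quot: "\<exists>z1 z2. z1 \<in> carrier Z \<and> z2 \<in> carrier Z \<and> q = e11 z1 + e11 z2 * X" for q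
    unfolding X_def by (rule center_spans_poly)
  have "\<exists>c\<in>S \<rightarrow> carrier Z. m = (\<Oplus>\<^bsub>M\<^esub>x\<in>S. c x \<odot>\<^bsub>M\<^esub> x)" if "m \<in> carrier M" for m
  proof -
    have m: "m \<in> carrier R" using that by simp
    define c0 where "c0 = poly (e11 m) t1"
    have c0: "poly (e22 m) t2 = c0" and b: "poly (e12 m) t1 = 0" "poly (e12 m) t2 = 0"
      using entries[OF m] by (auto simp: c0_def)
    have "l1 dvd e11 m - [:c0:]" "l2 dvd e22 m - [:c0:]"
      unfolding P using c0 by (simp_all add: dvd_iff_poly_eq_0 c0_def)
    then obtain q1 q2 where q1: "e11 m = [:c0:] + l1 * q1" and q2: "e22 m = [:c0:] + l2 * q2"
      by (metis add.commute diff_add_cancel dvdE)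
    obtain b1 where b1: "e12 m = l1 * b1" using b(1) by (auto simp: P poly_eq_0_iff_dvd)
    then have "poly b1 t2 = 0" using b(2) nodes by (simp add: P)
    then obtain q12 where "b1 = l2 * q12" unfolding P by (auto simp only: poly_eq_0_iff_dvd elim: dvdE)
    with b1 have q12: "e12 m = u * q12" by (simp add: u_def mult.assoc)
    obtain v1 w1 where v1: "v1 \<in> carrier Z" "w1 \<in> carrier Z" "q1 = e11 v1 + e11 w1 * X" using quot by blast
    obtain v2 w2 where v2: "v2 \<in> carrier Z" "w2 \<in> carrier Z" "q2 = e11 v2 + e11 w2 * X" using quot by blast
    obtain v3 w3 where v3: "v3 \<in> carrier Z" "w3 \<in> carrier Z" "q12 = e11 v3 + e11 w3 * X" using quot by blast
    obtain v4 w4 where v4: "v4 \<in> carrier Z" "w4 \<in> carrier Z" "e21 m = e11 v4 + e11 w4 * X" using quot by blast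
    have k: "scal [:c0:] \<in> carrier Z" by (rule scal) simp
    define m' where "m' = \<zero>\<^bsub>M\<^esub> \<oplus>\<^bsub>M\<^esub> scal [:c0:] \<odot>\<^bsub>M\<^esub> elt 1 0 0 1
      \<oplus>\<^bsub>M\<^esub> v1 \<odot>\<^bsub>M\<^esub> elt l1 0 0 0 \<oplus>\<^bsub>M\<^esub> w1 \<odot>\<^bsub>M\<^esub> elt (l1 * X) 0 0 0
      \<oplus>\<^bsub>M\<^esub> v3 \<odot>\<^bsub>M\<^esub> elt 0 u 0 0 \<oplus>\<^bsub>M\<^esub> w3 \<odot>\<^bsub>M\<^esub> elt 0 (u * X) 0 0
      \<oplus>\<^bsub>M\<^esub> v4 \<odot>\<^bsub>M\<^esub> elt 0 0 1 0 \<oplus>\<^bsub>M\<^esub> w4 \<odot>\<^bsub>M\<^esub> elt 0 0 X 0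
      \<oplus>\<^bsub>M\<^esub> v2 \<odot>\<^bsub>M\<^esub> elt 0 0 0 l2 \<oplus>\<^bsub>M\<^esub> w2 \<odot>\<^bsub>M\<^esub> elt 0 0 0 (l2 * X)"
    have "\<exists>c\<in>S \<rightarrow> carrier Z. m' = (\<Oplus>\<^bsub>M\<^esub>x\<in>S. c x \<odot>\<^bsub>M\<^esub> x)"
      unfolding m'_def
      by (intro M.span_add M.span_zero S k v1 v2 v3 v4) (simp_all add: S_def)
    moreover have "m' = m"
    proof -
      have poly0: "poly l1 t1 = 0" "poly l2 t2 = 0" "poly u t1 = 0" "poly u t2 = 0" by (simp_all add: P)
      have *: "x \<in> carrier R \<Longrightarrow> z \<in> carrier Z \<Longrightarrow> z \<otimes> x \<in> carrier R" for x z
        by (auto simp: center_iff)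
      show ?thesis
        unfolding m'_def
        by (rule inj) (simp_all add: * m k v1(1,2) v2(1,2) v3(1,2) v4(1,2) elt poly0 e_smult scal
          q1 q2 q12 v1(3) v2(3) v3(3) v4(3) algebra_simps)
    qed
    ultimately show ?thesis by simp
  qed
  with S show ?thesis unfolding finitely_generated_module_def by blast
qed

text \<open>The kernel element is \<open>u \<otimes> t E21 - t u \<otimes> E21\<close> with \<open>u = (t - t1) (t - t2)\<close>: the bilinear form
  \<open>(z, x) \<mapsto> z'(t1) e21(x)(t2)\<close> on the ideal of the node does not vanish on it.\<close>

lemma not_flat: "\<not> flat_module TYPE('a) Z M"
proof -
  define I where "I = {z \<in> carrier Z. poly (e11 z) t1 = 0}"
  define A where "A = M\<lparr>carrier := I\<rparr>"
  define B where "B = M\<lparr>carrier := carrier Z\<rparr>"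
  have ZR: "z \<in> carrier R" if "z \<in> carrier Z" for z using that by (rule center_closed)
  have cl: "x \<oplus> y \<in> carrier Z" "x \<otimes> y \<in> carrier Z" if "x \<in> carrier Z" "y \<in> carrier Z" for x y
    using that by (auto simp: center_iff e_mult)
  have A: "Module.module Z A" unfolding A_def
    by (rule submodule_center_module[OF ring_R])
      (auto simp: I_def cl ZR e_smult, auto simp: center_iff)
  have B: "Module.module Z B" unfolding B_def
    by (rule submodule_center_module[OF ring_R]) (auto simp: cl ZR, auto simp: center_iff)
  have M: "Module.module Z M" by (rule module_center_module[OF ring_R])
  define u :: "complex poly" where "u = [:- t1, 1:] * [:- t2, 1:]"
  define X :: "complex poly" where "X = [:0, 1:]"
  have u0: "poly u t1 = 0" "poly u t2 = 0" by (simp_all add: u_def)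
  have du: "poly (pderiv u) t1 = t1 - t2" by (simp add: u_def pderiv_mult pderiv_pCons)
  have su: "scal u \<in> I" "scal (u * X) \<in> I" using u0 scal[of u] scal[of "u * X"] by (auto simp: I_def)
  define x where "x = elt 0 0 1 0"
  define y where "y = elt 0 0 X 0"
  have xy: "x \<in> carrier R" "y \<in> carrier R" "e21 x = 1" "e21 y = X" "e11 x = 0" "e11 y = 0" "e12 x = 0"
    "e12 y = 0" "e22 x = 0" "e22 y = 0"
    unfolding x_def y_def by (simp_all add: elt)
  define b where "b = (\<lambda>(z, x). poly (pderiv (e11 z)) t1 * poly (e21 x) t2)"
  have "frag_of (scal u, y) - frag_of (scal (u * X), x) \<notin> tensor_subgroup Z A M"
  proof
    assume "frag_of (scal u, y) - frag_of (scal (u * X), x) \<in> tensor_subgroup Z A M"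
    then have "frag_eval b (frag_of (scal u, y) - frag_of (scal (u * X), x)) = 0"
    proof (rule frag_eval_tensor_subgroup[OF A M])
      fix r a m assume r: "r \<in> carrier Z" and a: "a \<in> carrier A" and m: "m \<in> carrier M"
      from a have a': "a \<in> carrier Z" "poly (e11 a) t1 = 0" by (auto simp: A_def I_def)
      \<comment> \<open>Since a(t1) = 0, the derivative of r a at t1 is r(t1) a'(t1), and r(t1) =
        r(t2) moves the factor to the evaluation at t2. On the whole center the same formula would
        not be balanced.\<close>
      show "b (r \<odot>\<^bsub>A\<^esub> a, m) = b (a, r \<odot>\<^bsub>M\<^esub> m)"
        using r a' m center_values[OF r] by (simp add: b_def A_def e_smult ZR pderiv_mult)
    qed (auto simp: b_def A_def I_def ZR pderiv_add distrib_left distrib_right)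
    moreover have "poly (pderiv (u * X)) t1 = (t1 - t2) * t1"
      unfolding pderiv_mult poly_add poly_mult du u0 by (simp add: X_def)
    ultimately have "(t1 - t2) * t2 - (t1 - t2) * t1 = 0"
      using u0 du scal[of u] scal[of "u * X"] xy
      by (simp add: frag_eval_diff b_def) (simp add: X_def)
    then show False using nodes by (simp flip: right_diff_distrib)
  qed
  moreover have "frag_of (scal u, y) - frag_of (scal (u * X), x) \<in> tensor_subgroup Z B M"
  proof -
    have suZ: "scal u \<in> carrier Z" "scal (u * X) \<in> carrier Z" "\<one> \<in> carrier Z"
      "e11 (scal u) = u" "e11 (scal (u * X)) = u * X"
      using su u0 scal[of u] scal[of "u * X"] by (auto simp: I_def center_iff e_one)
    have rel: "frag_of (r, m) - frag_of (\<one>, r \<otimes> m) \<in> tensor_relations Z B M"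
      if "r \<in> carrier Z" "m \<in> carrier R" for r m
    proof -
      have "frag_of (r \<odot>\<^bsub>B\<^esub> \<one>, m) - frag_of (\<one>, r \<odot>\<^bsub>M\<^esub> m) \<in> tensor_relations Z B M"
        unfolding tensor_relations_def using that suZ(3) 
        by (intro UnI2 CollectI exI[of _ r] exI[of _ "\<one>"] exI[of _ m]) (simp add: B_def)
      then show ?thesis using that ZR by (simp add: B_def)
    qed
    \<comment> \<open>Over the whole center both tensors equal 1 \<otimes> (u t E21), since u and u
      t are central scalars that can be moved across; their difference is a difference of two
      relations.\<close>
    have eq: "scal u \<otimes> y = scal (u * X) \<otimes> x"
      using suZ xy by (intro inj) (auto simp: e_smult ZR)
    let ?g = "frag_of (scal u, y) - frag_of (\<one>, scal u \<otimes> y)"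
    let ?h = "frag_of (scal (u * X), x) - frag_of (\<one>, scal (u * X) \<otimes> x)"
    have g: "?g \<in> tensor_relations Z B M" and h: "?h \<in> tensor_relations Z B M"
      using rel suZ xy by auto
    have "?h \<in> carrier (tensor_free B M)" using h tensor_relations_subset[OF B M] by blast
    then have "inv\<^bsub>tensor_free B M\<^esub> ?h = - ?h"
      unfolding tensor_free_def by (intro inv_free_Abelian_group) (simp only: carrier_free_Abelian_group_iff)
    then have "?g - ?h = ?g \<otimes>\<^bsub>tensor_free B M\<^esub> inv\<^bsub>tensor_free B M\<^esub> ?h"
      by (simp add: tensor_free_def)
    then have "?g - ?h \<in> tensor_subgroup Z B M"
      using generate.eng[OF generate.incl[OF g, of "tensor_free B M"] generate.inv[OF h]]
      by (simp only: tensor_subgroup_def)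
    then show ?thesis by (simp add: eq)
  qed
  ultimately show ?thesis
    using not_flat_moduleI[OF A B M, of "scal u" "scal (u * X)" y x] su xy
    by (auto simp: A_def B_def I_def)
qed

text \<open>The entry \<open>e21\<close> makes \<open>\<complex>[t]\<close> a direct summand of the module. A splitting of
  \<open>(z1, z2) \<mapsto> z1 + t z2\<close> over it would be multiplication by \<open>k(1)\<close>, whose components then satisfy
  \<open>z\<^sub>i \<in> Z\<close> and \<open>t z\<^sub>i \<in> Z\<close>, so they vanish at the node.\<close>

lemma not_projective: "\<not> projective_module TYPE('a \<Rightarrow> 'a) TYPE('a) Z M"
proof
  assume proj: "projective_module TYPE('a \<Rightarrow> 'a) TYPE('a) Z M"
  define X :: "complex poly" where "X = [:0, 1:]"
  define N where "N = {x \<in> carrier R. e11 x = 0 \<and> e12 x = 0 \<and> e22 x = 0}"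
  define B where "B = M\<lparr>carrier := N\<rparr>"
  define A :: "('a, 'a \<Rightarrow> 'a) module" where "A = function_module Z"
  define g where "g = (\<lambda>F :: 'a \<Rightarrow> 'a. elt 0 0 (e11 (F \<zero>) + X * e11 (F \<one>)) 0)"
  define h where "h = (\<lambda>x. elt 0 0 (e21 x) 0)"
  have ZR: "z \<in> carrier R" if "z \<in> carrier Z" for z using that by (rule center_closed)
  \<comment> \<open>The two coordinates read by \<open>g\<close> must be different indices.\<close>
  have "\<one> \<noteq> \<zero>" using e_one by (metis e_zero(1) zero_neq_one)
  have elN: "elt 0 0 c 0 \<in> N" "elt 0 0 c 0 \<in> carrier R" "e21 (elt 0 0 c 0) = c"
    "e11 (elt 0 0 c 0) = 0" "e12 (elt 0 0 c 0) = 0" "e22 (elt 0 0 c 0) = 0" for c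
    by (auto simp: N_def elt)
  have A: "Module.module Z A" unfolding A_def
    by (rule module_function_module[OF cring_center[OF ring_R]])
  have B: "Module.module Z B" unfolding B_def
    by (rule submodule_center_module[OF ring_R]) (auto simp: N_def ZR e_smult)
  have g: "g \<in> linear_maps Z A B"
    unfolding linear_maps_def
  proof (intro CollectI conjI ballI Pi_I)
    fix F G assume "F \<in> carrier A" "G \<in> carrier A"
    then have FG: "F i \<in> carrier R" "G i \<in> carrier R" for i
      by (auto simp: A_def function_module_def ZR)
    have "g (F \<oplus>\<^bsub>A\<^esub> G) = elt 0 0 (e11 (F \<zero> \<oplus> G \<zero>) + X * e11 (F \<one> \<oplus> G \<one>)) 0"
      by (simp add: g_def A_def function_module_def)
    also have "\<dots> = g F \<oplus> g G"
      using FG by (intro inj) (simp_all add: elN g_def algebra_simps)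
    finally show "g (F \<oplus>\<^bsub>A\<^esub> G) = g F \<oplus>\<^bsub>B\<^esub> g G" by (simp add: B_def)
  next
    fix r F assume r: "r \<in> carrier Z" and "F \<in> carrier A"
    then have F: "F i \<in> carrier R" for i
      by (auto simp: A_def function_module_def ZR)
    have "g (r \<odot>\<^bsub>A\<^esub> F) = elt 0 0 (e11 (r \<otimes> F \<zero>) + X * e11 (r \<otimes> F \<one>)) 0"
      by (simp add: g_def A_def function_module_def)
    also have "\<dots> = r \<otimes> g F"
      using F r by (intro inj) (simp_all add: elN g_def e_smult ZR algebra_simps)
    finally show "g (r \<odot>\<^bsub>A\<^esub> F) = r \<odot>\<^bsub>B\<^esub> g F" by (simp add: B_def)
  qed (simp add: B_def g_def elN)
  have h: "h \<in> linear_maps Z M B"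
    unfolding linear_maps_def
    by (auto simp: B_def h_def elN) (auto intro!: inj simp: elN e_smult ZR)
  have "carrier B \<subseteq> g ` carrier A"
  proof
    fix y assume y: "y \<in> carrier B"
    obtain z1 z2 where z: "z1 \<in> carrier Z" "z2 \<in> carrier Z" "e21 y = e11 z1 + e11 z2 * X"
      using center_spans_poly[of "e21 y"] unfolding X_def by blast
    define F where "F = (\<lambda>i. if i = \<zero> then z1 else z2)"
    have "F \<in> carrier A" using z by (auto simp: F_def A_def function_module_def)
    moreover have "y = g F"
      using y z(3) \<open>\<one> \<noteq> \<zero>\<close> by (intro inj) (auto simp: g_def F_def B_def N_def elN mult.commute)
    ultimately show "y \<in> g ` carrier A" by blast
  qed
  with g have gB: "g ` carrier A = carrier B" by (auto simp: linear_maps_def)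
  have "\<exists>k\<in>linear_maps Z M A. \<forall>m\<in>carrier M. g (k m) = h m"
    by (rule proj[unfolded projective_module_def, rule_format, of A B g h]) (intro conjI A B g gB h)
  then obtain k where k: "k \<in> linear_maps Z M A" and gk: "\<And>m. m \<in> carrier M \<Longrightarrow> g (k m) = h m"
    by blast
  have kZ: "k x i \<in> carrier Z" if "x \<in> carrier R" for x i
    using k that by (auto simp: linear_maps_def A_def function_module_def)
  have k_smult: "k (z \<otimes> x) i = z \<otimes> k x i" if "z \<in> carrier Z" "x \<in> carrier R" for z x i
    using k that by (auto simp: linear_maps_def A_def function_module_def)
  define x where "x = elt 0 0 1 0"
  define y where "y = elt 0 0 X 0"
  have xy: "x \<in> carrier R" "y \<in> carrier R" "e21 x = 1" "e21 y = X" "e11 x = 0" "e11 y = 0" "e12 x = 0"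
    "e12 y = 0" "e22 x = 0" "e22 y = 0"
    unfolding x_def y_def by (simp_all add: elt)
  define u :: "complex poly" where "u = [:- t1, 1:] * [:- t2, 1:]"
  have u: "poly u t1 = 0" "poly u t2 = 0" "u \<noteq> 0" by (auto simp: u_def)
  have su: "scal u \<in> carrier Z" "scal (u * X) \<in> carrier Z" "e11 (scal u) = u" "e11 (scal (u * X)) = u * X"
    using scal u by auto
  \<comment> \<open>The scalar t is not central, but u and u t are; linearity over both and
    cancellation of u give k(t E21) = t k(E21) in each coordinate. Both k(E21) and k(t E21) take
    equal values at the nodes, so z = k(E21) satisfies t1 z(t1) = t2 z(t1).\<close>
  have "poly (e11 (k x i)) t1 = 0" for i
  proof -
    have "scal u \<otimes> y = scal (u * X) \<otimes> x"
      using su xy by (intro inj) (auto simp: e_smult ZR)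
    then have "scal u \<otimes> k y i = scal (u * X) \<otimes> k x i"
      using k_smult su xy by metis
    then have "e11 (scal u \<otimes> k y i) = e11 (scal (u * X) \<otimes> k x i)" by simp
    then have "u * e11 (k y i) = u * (X * e11 (k x i))"
      using su kZ[OF xy(1)] kZ[OF xy(2)] by (simp add: e_smult ZR mult.assoc)
    then have "e11 (k y i) = X * e11 (k x i)" using u(3) by simp
    then have "t1 * poly (e11 (k x i)) t1 = t2 * poly (e11 (k x i)) t1"
      using center_values[OF kZ[OF xy(1)], of i] center_values[OF kZ[OF xy(2)], of i] by (simp add: X_def)
    then show ?thesis using nodes by simp
  qed
  moreover have "e21 (g (k x)) = e21 (h x)" using gk[of x] xy by simp
  then have "e11 (k x \<zero>) + X * e11 (k x \<one>) = 1" by (simp add: g_def h_def elN xy)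
  then have "poly (e11 (k x \<zero>) + X * e11 (k x \<one>)) t1 = 1" by simp
  ultimately show False by simp
qed

end


section \<open>The Gegenbauer functional\<close>

definition gegenbauer_functional :: "real \<Rightarrow> complex poly \<Rightarrow> complex" where
  "gegenbauer_functional n q =
     integral {-1..1} (\<lambda>x. ((1 - x\<^sup>2) powr (n / 2 - 1)) *\<^sub>R poly q (complex_of_real x))"

text \<open>The derivative of (1 - x^2)^(n/2) q is the Gegenbauer weight times (1 - x^2) q' - n x q,
  and the boundary values vanish for n > 0. All integration by parts below reduces to this. For n <
  2 the derivative may be unbounded at the endpoints, hence the interior form of the fundamental
  theorem.\<close>

lemma has_integral_gegenbauer_deriv:
  fixes q :: "complex poly"
  assumes "n > 0"
  shows "((\<lambda>x. ((1 - x\<^sup>2) powr (n / 2 - 1)) *\<^sub>R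
    poly ([:1, 0, -1:] * pderiv q - [:0, of_real n:] * q) (complex_of_real x)) has_integral 0) {-1..1}"
proof -
  let ?f = "\<lambda>x. ((1 - x\<^sup>2) powr (n / 2)) *\<^sub>R poly q (complex_of_real x)"
  have "((\<lambda>x. ((1 - x\<^sup>2) powr (n / 2 - 1)) *\<^sub>R
    poly ([:1, 0, -1:] * pderiv q - [:0, of_real n:] * q) (complex_of_real x))
      has_integral ?f 1 - ?f (-1)) {-1..1}"
  proof (rule fundamental_theorem_of_calculus_interior)
    have "continuous_on {-1..1} (\<lambda>x::real. (1 - x\<^sup>2) powr (n / 2))"
      using assms by (intro continuous_on_powr') (auto intro!: continuous_intros simp: abs_square_le_1)
    then show "continuous_on {-1..1} ?f"
      by (rule continuous_on_scaleR) (intro continuous_intros)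
  next
    fix x :: real assume x: "x \<in> {-1<..<1}"
    then have pos: "1 - x\<^sup>2 > 0" by (simp add: abs_square_less_1 abs_less_iff)
    have 1: "((\<lambda>x. (1 - x\<^sup>2) powr (n / 2)) has_real_derivative - n * x * (1 - x\<^sup>2) powr (n / 2 - 1)) (at x)"
      using pos by (auto intro!: derivative_eq_intros simp: field_simps powr_diff)
    have 2: "((\<lambda>x. poly q (complex_of_real x)) has_vector_derivative poly (pderiv q) (complex_of_real x)) (at x)"
      using field_vector_diff_chain_at[OF has_vector_derivative_of_real[OF DERIV_ident] poly_DERIV]
      by (simp add: o_def)
    have pw: "(1 - x\<^sup>2) powr (n / 2) = (1 - x\<^sup>2) powr (n / 2 - 1) * (1 - x\<^sup>2)"
      using pos by (simp add: powr_diff)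
    show "(?f has_vector_derivative ((1 - x\<^sup>2) powr (n / 2 - 1)) *\<^sub>R
      poly ([:1, 0, -1:] * pderiv q - [:0, of_real n:] * q) (complex_of_real x)) (at x)"
      by (intro has_vector_derivative_eq_rhs[OF has_vector_derivative_scaleR[OF 1 2]])
        (simp add: pw, simp add: algebra_simps scaleR_conv_of_real power2_eq_square)
  qed simp
  then show ?thesis using assms by simp
qed

text \<open>The substitution t = (x + 1)/2 turns the weight into 4^(n/2 - 1) times the Beta
  integrand with both parameters n/2, which covers the singular case n < 2.\<close>

lemma integrable_gegenbauer_weight:
  assumes "n > 0"
  shows "(\<lambda>x::real. (1 - x\<^sup>2) powr (n / 2 - 1)) integrable_on {-1..1}"
proof -
  have "((\<lambda>t::real. t powr (n / 2 - 1) * (1 - t) powr (n / 2 - 1)) has_integral Beta (n/2) (n/2)) (cbox 0 1)"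
    using has_integral_Beta_real[of "n/2" "n/2"] assms by simp
  from has_integral_affinity'[OF this, of "1/2" "1/2"]
  have "(\<lambda>x::real. (x / 2 + 1 / 2) powr (n / 2 - 1) * (1 / 2 - x / 2) powr (n / 2 - 1)) integrable_on {-1..1}"
    by (auto simp: algebra_simps integrable_on_def)
  then have "(\<lambda>x::real. 4 powr (n / 2 - 1) * ((x / 2 + 1 / 2) powr (n / 2 - 1) * (1 / 2 - x / 2) powr (n / 2 - 1)))
    integrable_on {-1..1}"
    by (rule integrable_on_mult_right)
  then show ?thesis
  proof (rule integrable_eq)
    fix x :: real assume x: "x \<in> {-1..1}"
    have "1 - x\<^sup>2 = 4 * ((x / 2 + 1 / 2) * (1 / 2 - x / 2))"
      by (simp add: field_simps power2_eq_square)
    then show "4 powr (n / 2 - 1) * ((x / 2 + 1 / 2) powr (n / 2 - 1) * (1 / 2 - x / 2) powr (n / 2 - 1))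
      = (1 - x\<^sup>2) powr (n / 2 - 1)"
      using x by (simp only:, subst powr_mult, simp, simp, subst powr_mult, auto)
  qed
qed

text \<open>Induction on the exponent of a monomial: the integrable derivative for q = x^j is the
  weight times j x^(j-1) - (j + n) x^(j+1), so x^(j+1) is reached from x^(j-1) by dividing by j +
  n.\<close>

lemma integrable_gegenbauer:
  fixes q :: "complex poly"
  assumes "n > 0"
  shows "(\<lambda>x. ((1 - x\<^sup>2) powr (n / 2 - 1)) *\<^sub>R poly q (complex_of_real x)) integrable_on {-1..1}"
proof -
  have mono: "(\<lambda>x. ((1 - x\<^sup>2) powr (n / 2 - 1)) *\<^sub>R (complex_of_real x) ^ k) integrable_on {-1..1}" for k
  proof (induction k rule: less_induct)
    case (less k)
    have step: "(\<lambda>x. ((1 - x\<^sup>2) powr (n / 2 - 1)) *\<^sub>R (complex_of_real x) ^ Suc j) integrable_on {-1..1}"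
      if prev: "(\<lambda>x. ((1 - x\<^sup>2) powr (n / 2 - 1)) *\<^sub>R (of_nat j * (complex_of_real x) ^ (j - 1))) integrable_on {-1..1}" for j
    proof -
      have "(\<lambda>x. ((1 - x\<^sup>2) powr (n / 2 - 1)) *\<^sub>R
         poly ([:1, 0, -1:] * pderiv (monom 1 j) - [:0, of_real n:] * monom 1 j) (complex_of_real x)) integrable_on {-1..1}"
        using has_integral_gegenbauer_deriv[OF assms] by (auto simp: integrable_on_def)
      from integrable_diff[OF prev this]
      have "(\<lambda>x. (of_nat j + of_real n) * (((1 - x\<^sup>2) powr (n / 2 - 1)) *\<^sub>R (complex_of_real x) ^ Suc j)) integrable_on {-1..1}"
        by (rule integrable_eq) (cases j, auto simp: poly_monom pderiv_monom algebra_simps scaleR_conv_of_real)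
      then have "(\<lambda>x. inverse (of_nat j + of_real n) * ((of_nat j + of_real n) * (((1 - x\<^sup>2) powr (n / 2 - 1)) *\<^sub>R (complex_of_real x) ^ Suc j))) integrable_on {-1..1}"
        by (rule integrable_on_mult_right)
      moreover have "complex_of_nat j + of_real n \<noteq> 0"
        using assms by (metis add_nonneg_pos less_irrefl of_nat_0_le_iff of_real_add of_real_eq_0_iff of_real_of_nat_eq)
      ultimately show ?thesis by (simp flip: mult.assoc)
    qed
    show ?case
    proof (cases k)
      case 0
      then show ?thesis
        using integrable_linear[OF integrable_gegenbauer_weight[OF assms] bounded_linear_of_real[where 'a=complex]]
        by (simp add: o_def scaleR_conv_of_real)
    next
      case (Suc j)
      show ?thesis
      proof (cases "j = 0")
        case False
        then have "(\<lambda>x. ((1 - x\<^sup>2) powr (n / 2 - 1)) *\<^sub>R (complex_of_real x) ^ (j - 1)) integrable_on {-1..1}"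
          using Suc less by simp
        from integrable_on_mult_right[OF this, of "of_nat j"] show ?thesis
          unfolding Suc by (intro step) (simp add: mult.left_commute scaleR_conv_of_real)
      qed (use step[of 0] Suc in \<open>simp add: integrable_0\<close>)
    qed
  qed
  have "(\<lambda>x. \<Sum>k\<le>degree q. coeff q k * (((1 - x\<^sup>2) powr (n / 2 - 1)) *\<^sub>R (complex_of_real x) ^ k)) integrable_on {-1..1}"
    by (intro integrable_sum integrable_on_mult_right mono) simp
  then show ?thesis
    by (rule integrable_eq) (simp add: poly_altdef scaleR_sum_right)
qed

context
  fixes n :: real
  assumes n_pos: "n > 0"
begin

abbreviation (input) L where "L \<equiv> gegenbauer_functional n"

lemma functional_add: "L (p + q) = L p + L q"
  unfolding gegenbauer_functional_def
  by (subst integral_add[symmetric]) (use integrable_gegenbauer[OF n_pos] in \<open>auto simp: scaleR_add_right\<close>)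

lemma functional_smult: "L (Polynomial.smult c p) = c * L p"
  unfolding gegenbauer_functional_def
  by (subst integral_mult_right[symmetric]) simp

lemma functional_0 [simp]: "L 0 = 0"
  by (simp add: gegenbauer_functional_def)

lemma functional_minus: "L (- p) = - L p"
  using functional_smult[of "-1" p] by simp

lemma functional_diff: "L (p - q) = L p - L q"
  using functional_add[of p "- q"] by (simp add: functional_minus)

lemma functional_deriv: "L ([:1, 0, -1:] * pderiv q - [:0, of_real n:] * q) = 0"
  unfolding gegenbauer_functional_def
  by (rule integral_unique) (rule has_integral_gegenbauer_deriv[OF n_pos])

lemma functional_cnj: "L (map_poly cnj q) = cnj (L q)"
  unfolding gegenbauer_functional_def integral_cnj by simp

lemma functional_norm_nonneg: "\<exists>s\<ge>0. L (q * map_poly cnj q) = complex_of_real s"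
proof -
  let ?g = "\<lambda>x. (1 - x\<^sup>2) powr (n / 2 - 1) * (norm (poly q (complex_of_real x)))\<^sup>2"
  have eq: "((1 - x\<^sup>2) powr (n / 2 - 1)) *\<^sub>R poly (q * map_poly cnj q) (complex_of_real x) = complex_of_real (?g x)" for x
    by (simp add: scaleR_conv_of_real complex_norm_square[symmetric])
  have int: "(\<lambda>x. complex_of_real (?g x)) integrable_on {-1..1}"
    using integrable_gegenbauer[OF n_pos, of "q * map_poly cnj q"] unfolding eq .
  have intr: "?g integrable_on {-1..1}"
    using integrable_linear[OF int bounded_linear_Re] by (simp add: o_def)
  have "L (q * map_poly cnj q) = complex_of_real (integral {-1..1} ?g)"
    unfolding gegenbauer_functional_def eq
    using integral_linear[OF intr bounded_linear_of_real[where 'a=complex]] by (simp add: o_def)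
  moreover have "integral {-1..1} ?g \<ge> 0" by (rule integral_nonneg[OF intr]) simp
  ultimately show ?thesis by blast
qed

text \<open>A continuous nonnegative integrand with zero integral vanishes. Restricting to
  [-1/2, 1/2] avoids the endpoints and keeps the weight positive, so q has infinitely many
  zeros.\<close>

lemma functional_norm:
  assumes "L (q * map_poly cnj q) = 0"
  shows "q = 0"
proof -
  let ?g = "\<lambda>x. (1 - x\<^sup>2) powr (n / 2 - 1) * (norm (poly q (complex_of_real x)))\<^sup>2"
  have eq: "((1 - x\<^sup>2) powr (n / 2 - 1)) *\<^sub>R poly (q * map_poly cnj q) (complex_of_real x) = complex_of_real (?g x)" for x
    by (simp add: scaleR_conv_of_real complex_norm_square[symmetric])
  have int: "(\<lambda>x. complex_of_real (?g x)) integrable_on {-1..1}"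
    using integrable_gegenbauer[OF n_pos, of "q * map_poly cnj q"] unfolding eq .
  have intr: "?g integrable_on {-1..1}"
    using integrable_linear[OF int bounded_linear_Re] by (simp add: o_def)
  have "complex_of_real (integral {-1..1} ?g) = 0"
    using assms unfolding gegenbauer_functional_def eq
    using integral_linear[OF intr bounded_linear_of_real[where 'a=complex]] by (simp add: o_def)
  then have 0: "integral {-1..1} ?g = 0" by simp
  have sub: "?g integrable_on {-1/2..1/2}"
    by (rule integrable_on_subinterval[OF intr]) auto
  have "integral {-1/2..1/2} ?g \<le> integral {-1..1} ?g"
    by (rule integral_subset_le[OF _ sub intr]) auto
  moreover have "integral {-1/2..1/2} ?g \<ge> 0"
    by (rule integral_nonneg[OF sub]) auto
  ultimately have "(?g has_integral 0) (cbox (-1/2) (1/2))"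
    using 0 sub by (simp add: has_integral_iff)
  moreover have "1 - x\<^sup>2 > 0" if "x \<in> cbox (-1/2) (1/2)" for x :: real
  proof -
    have "\<bar>x\<bar> < 1" using that by auto
    then show ?thesis by (simp add: abs_square_less_1)
  qed
  ultimately have zero: "?g x = 0" if "x \<in> cbox (-1/2) (1/2)" for x
    using that by (intro has_integral_0_cbox_imp_0[of "-1/2" "1/2" ?g])
      (force intro!: continuous_intros simp: box_real)+
  have "poly q (complex_of_real x) = 0" if "x \<in> {-1/2..1/2}" for x
    using zero[of x] \<open>\<And>x. x \<in> cbox (-1/2) (1/2) \<Longrightarrow> 1 - x\<^sup>2 > 0\<close>[of x] that by force
  then have "complex_of_real ` {-1/2..1/2} \<subseteq> {z. poly q z = 0}" by auto
  moreover have "infinite (complex_of_real ` {-1/2..1/2})"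
    by (subst finite_image_iff) (auto simp: inj_on_def infinite_Icc_iff)
  ultimately have "infinite {z. poly q z = 0}" using finite_subset by blast
  then show ?thesis using poly_roots_finite by blast
qed

end


section \<open>Matrix polynomials\<close>

lemmas mat2_simps = vec_eq_iff forall_2 sum_2 matrix_matrix_mult_def

lemma mpoly_eqI: "(\<And>k. mpoly_coeff P k = mpoly_coeff Q k) \<Longrightarrow> P = Q"
  by (simp add: mpoly_coeff_def vec_eq_iff poly_eq_iff)

lemma mpoly_coeff_simps [simp]:
  "mpoly_coeff 0 k = 0" "mpoly_coeff (P + Q) k = mpoly_coeff P k + mpoly_coeff Q k"
  "mpoly_coeff (P - Q) k = mpoly_coeff P k - mpoly_coeff Q k" "mpoly_coeff (- P) k = - mpoly_coeff P k"
  "mpoly_coeff (mpoly_const A ** P) k = A ** mpoly_coeff P k"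
  "mpoly_coeff (P ** mpoly_const A) k = mpoly_coeff P k ** A"
  by (simp_all add: mpoly_coeff_def mpoly_const_def mat2_simps mult.commute)

lemma mpoly_coeff_sum [simp]: "mpoly_coeff (\<Sum>i\<in>I. f i) k = (\<Sum>i\<in>I. mpoly_coeff (f i) k)"
  by (induction I rule: infinite_finite_induct) auto

lemma mpoly_const_simps [simp]:
  "mpoly_const 0 = 0" "mpoly_const (mat 1) = mat 1" "mpoly_const (A + B) = mpoly_const A + mpoly_const B"
  "mpoly_const (A ** B) = mpoly_const A ** mpoly_const B"
  by (simp_all add: mpoly_const_def mat2_simps mat_def one_pCons)

lemma mat_mult_entry [simp]: "(mat c ** (A :: 'a::comm_ring_1 ^ 'n ^ 'm)) $ i $ j = c * A $ i $ j"
  by (simp add: matrix_matrix_mult_def mat_def if_distrib[of "\<lambda>x. x * _"] cong: if_cong)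

lemma matrix_diff_ldistrib: "A ** (B - C) = A ** B - A ** (C :: 'a::ring_1 ^ 'p ^ 'n)"
  by (simp add: matrix_matrix_mult_def vec_eq_iff right_diff_distrib sum_subtractf)

lemma matrix_diff_rdistrib: "(A - B) ** C = A ** C - B ** (C :: 'a::ring_1 ^ 'p ^ 'n)"
  by (simp add: matrix_matrix_mult_def vec_eq_iff left_diff_distrib sum_subtractf)

lemma matrix_add_rdistrib: "(A + B) ** C = A ** C + B ** (C :: 'a::semiring_1 ^ 'p ^ 'n)"
  by (simp add: matrix_matrix_mult_def vec_eq_iff distrib_right sum.distrib)

lemma matrix_mult_sum_right: "A ** (\<Sum>i\<in>I. f i) = (\<Sum>i\<in>I. A ** (f i :: 'a::ring_1 ^ 'p ^ 'n))"
  by (induction I rule: infinite_finite_induct) (simp_all add: matrix_add_ldistrib)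

lemma matrix_mult_sum_left: "(\<Sum>i\<in>I. f i) ** A = (\<Sum>i\<in>I. f i ** (A :: 'a::ring_1 ^ 'p ^ 'n))"
  by (induction I rule: infinite_finite_induct) (simp_all add: matrix_add_rdistrib)

text \<open>The bound is strict, so that degree below 0 means zero and inductions on the degree
  start without a convention for the zero polynomial.\<close>

definition deg_less :: "nat \<Rightarrow> mpoly2 \<Rightarrow> bool" where
  "deg_less w P \<longleftrightarrow> (\<forall>k\<ge>w. mpoly_coeff P k = 0)"

lemma deg_less_0 [simp]: "deg_less 0 P \<longleftrightarrow> P = 0"
  by (auto simp: deg_less_def intro: mpoly_eqI)

lemma deg_less_zero [simp]: "deg_less w 0"
  by (simp add: deg_less_def)

lemma deg_less_add: "deg_less w P \<Longrightarrow> deg_less w Q \<Longrightarrow> deg_less w (P + Q)"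
  and deg_less_diff: "deg_less w P \<Longrightarrow> deg_less w Q \<Longrightarrow> deg_less w (P - Q)"
  and deg_less_const_mult: "deg_less w P \<Longrightarrow> deg_less w (mpoly_const A ** P)"
  and deg_less_mono: "deg_less w P \<Longrightarrow> w \<le> w' \<Longrightarrow> deg_less w' P"
  by (auto simp: deg_less_def)

lemma deg_less_sum: "(\<And>i. i \<in> I \<Longrightarrow> deg_less w (f i)) \<Longrightarrow> deg_less w (\<Sum>i\<in>I. f i)"
  by (induction I rule: infinite_finite_induct) (auto intro: deg_less_add)

lemma deg_less_exists: "\<exists>w. deg_less w P"
proof -
  define w where "w = Suc (degree (P$1$1) + degree (P$1$2) + degree (P$2$1) + degree (P$2$2))"
  have "deg_less w P"
    unfolding deg_less_def mpoly_coeff_def by (auto simp: mat2_simps w_def intro!: coeff_eq_0)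
  then show ?thesis ..
qed

lemma monic_deg_less: "monic_of_degree w P \<Longrightarrow> deg_less (Suc w) P"
  by (auto simp: deg_less_def monic_of_degree_def)

lemma monic_xpow: "monic_of_degree w (mat (monom 1 w))"
  by (auto simp: monic_of_degree_def mpoly_coeff_def mat_def vec_eq_iff)

lemma deg_less_minus_leading:
  assumes "deg_less (Suc w) P" "monic_of_degree w Q"
  shows "deg_less w (P - mpoly_const (mpoly_coeff P w) ** Q)"
  unfolding deg_less_def
proof (intro allI impI)
  fix k assume "w \<le> k"
  then show "mpoly_coeff (P - mpoly_const (mpoly_coeff P w) ** Q) k = 0"
    using assms by (cases "k = w") (auto simp: deg_less_def monic_of_degree_def)
qed

text \<open>Leading coefficients are removed one after the other; a monic sequence spans the
  polynomials as a left module over the constant matrices.\<close>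

lemma deg_less_expand:
  assumes Q: "\<And>j. j < w \<Longrightarrow> monic_of_degree j (Q j)" and "deg_less w P"
  shows "\<exists>A. P = (\<Sum>j<w. mpoly_const (A j) ** Q j)"
  using assms
proof (induction w arbitrary: P)
  case (Suc w)
  define R where "R = P - mpoly_const (mpoly_coeff P w) ** Q w"
  have "deg_less w R"
    unfolding R_def using Suc.prems by (intro deg_less_minus_leading) auto
  then obtain A where "R = (\<Sum>j<w. mpoly_const (A j) ** Q j)" using Suc by auto
  then have "P = (\<Sum>j<Suc w. mpoly_const ((A(w := mpoly_coeff P w)) j) ** Q j)"
    by (simp add: R_def algebra_simps)
  then show ?case by blast
qed simp

section \<open>The orthogonal sequence\<close>

locale gegenbauer_weight =
  fixes n p :: real
  assumes p_pos: "0 < p" and p_less: "p < n / 2"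
begin

lemma n_pos: "n > 0" using p_pos p_less by simp

abbreviation (input) L where "L \<equiv> gegenbauer_functional n"

definition weight_poly :: mpoly2 where
  "weight_poly = vector [vector [[:of_real (n - p), 0, of_real p:], [:0, - of_real n:]],
             vector [[:0, - of_real n:], [:of_real p, 0, of_real (n - p):]]]"

lemma weight_poly_entries:
  "weight_poly $ 1 $ 1 = [:of_real (n - p), 0, of_real p:]" "weight_poly $ 1 $ 2 = [:0, - of_real n:]"
  "weight_poly $ 2 $ 1 = [:0, - of_real n:]" "weight_poly $ 2 $ 2 = [:of_real p, 0, of_real (n - p):]"
  by (simp_all add: weight_poly_def)

definition adj :: "mpoly2 \<Rightarrow> mpoly2" where
  "adj P = (\<chi> i j. map_poly cnj (P $ j $ i))"

definition form :: "mpoly2 \<Rightarrow> mpoly2 \<Rightarrow> mat2" where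
  "form P Q = (\<chi> i j. L ((P ** weight_poly ** adj Q) $ i $ j))"

lemma weight_eval: "weight p n x = ((1 - x\<^sup>2) powr (n / 2 - 1)) *\<^sub>R mpoly_eval weight_poly x"
  by (simp add: weight_def mpoly_eval_def weight_poly_entries mat2_simps power2_eq_square algebra_simps)

lemma integrand_entry:
  "(mpoly_eval P x ** weight p n x ** conj_transpose (mpoly_eval Q x)) $ i $ j =
    ((1 - x\<^sup>2) powr (n / 2 - 1)) *\<^sub>R poly ((P ** weight_poly ** adj Q) $ i $ j) (complex_of_real x)"
  by (simp add: weight_eval mpoly_eval_def conj_transpose_def adj_def matrix_matrix_mult_def sum_2
    algebra_simps)

lemma matrix_form_weight: "matrix_form (weight p n) P Q = form P Q"
proof -
  let ?f = "\<lambda>x. mpoly_eval P x ** weight p n x ** conj_transpose (mpoly_eval Q x)"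
  \<comment> \<open>The matrix-valued integral is assembled from the integrals of the entries, for
    which integrability is known.\<close>
  let ?E = "\<lambda>(i :: 2) (j :: 2) (c :: complex). (\<chi> k l. if k = i \<and> l = j then c else 0) :: mat2"
  have E: "bounded_linear (?E i j)" for i j
    by (intro linear_conv_bounded_linear[THEN iffD1] linearI) (auto simp: vec_eq_iff)
  have eq: "A = ?E 1 1 (A$1$1) + ?E 1 2 (A$1$2) + ?E 2 1 (A$2$1) + ?E 2 2 (A$2$2)" for A :: mat2
    by (simp add: mat2_simps)
  have i: "((\<lambda>x. ?f x $ i $ j) has_integral form P Q $ i $ j) {-1..1}" for i j
    unfolding integrand_entry form_def gegenbauer_functional_def
    using integrable_integral[OF integrable_gegenbauer[OF n_pos]] by simp
  have "((\<lambda>x. ?E i j (?f x $ i $ j)) has_integral ?E i j (form P Q $ i $ j)) {-1..1}" for i j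
    using has_integral_linear[OF i E] by (simp add: o_def)
  then have "((\<lambda>x. ?E 1 1 (?f x$1$1) + ?E 1 2 (?f x$1$2) + ?E 2 1 (?f x$2$1) + ?E 2 2 (?f x$2$2))
    has_integral ?E 1 1 (form P Q$1$1) + ?E 1 2 (form P Q$1$2) + ?E 2 1 (form P Q$2$1) + ?E 2 2 (form P Q$2$2)) {-1..1}"
    by (intro has_integral_add)
  then show ?thesis
    unfolding eq[symmetric] matrix_form_def by (rule integral_unique)
qed

lemmas functional_linear = functional_add[OF n_pos] functional_diff[OF n_pos] functional_minus[OF n_pos]
  functional_smult[OF n_pos] functional_0[OF n_pos]

lemma map_poly_cnj_add: "map_poly cnj (f + g) = map_poly cnj f + map_poly cnj g"
  and map_poly_cnj_mult: "map_poly cnj (f * g) = map_poly cnj f * map_poly cnj g"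
  and map_poly_cnj_cnj: "map_poly cnj (map_poly cnj f) = f"
  by (auto intro!: poly_eqI simp: coeff_map_poly coeff_mult)

lemma map_poly_cnj_diff: "map_poly cnj (f - g) = map_poly cnj f - map_poly cnj g"
  by (auto intro!: poly_eqI simp: coeff_map_poly)

lemma form_add_left: "form (P + P') Q = form P Q + form P' Q"
  by (simp add: form_def vec_eq_iff matrix_add_rdistrib functional_linear)

lemma form_diff_left: "form (P - P') Q = form P Q - form P' Q"
  by (simp add: form_def vec_eq_iff matrix_diff_rdistrib functional_linear)

lemma form_const_left: "form (mpoly_const A ** P) Q = A ** form P Q"
  by (simp add: form_def matrix_matrix_mult_def vec_eq_iff sum_2 mpoly_const_def functional_linear
    distrib_left distrib_right mult.assoc)

lemma form_hermitian: "form Q P = conj_transpose (form P Q)"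
proof -
  have W: "map_poly cnj (weight_poly $ 1 $ 1) = weight_poly $ 1 $ 1"
    "map_poly cnj (weight_poly $ 1 $ 2) = weight_poly $ 2 $ 1"
    "map_poly cnj (weight_poly $ 2 $ 1) = weight_poly $ 1 $ 2"
    "map_poly cnj (weight_poly $ 2 $ 2) = weight_poly $ 2 $ 2"
    by (simp_all add: weight_poly_entries map_poly_pCons)
  have "(Q ** weight_poly ** adj P) $ i $ j = map_poly cnj ((P ** weight_poly ** adj Q) $ j $ i)" for i j
    by (simp add: matrix_matrix_mult_def sum_2 adj_def map_poly_cnj_add map_poly_cnj_mult map_poly_cnj_cnj
      W distrib_right distrib_left mult_ac)
  then show ?thesis
    by (simp add: form_def conj_transpose_def vec_eq_iff functional_cnj[OF n_pos])
qed

lemma conj_transpose_simps [simp]: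
  "conj_transpose 0 = 0" "conj_transpose (A + B) = conj_transpose A + conj_transpose B"
  "conj_transpose (A - B) = conj_transpose A - conj_transpose B"
  "conj_transpose (A ** B) = conj_transpose B ** conj_transpose A"
  "conj_transpose (conj_transpose A) = A"
  by (simp_all add: conj_transpose_def mat2_simps mult.commute)

lemma form_add_right: "form P (Q + Q') = form P Q + form P Q'"
  by (metis form_hermitian form_add_left conj_transpose_simps(2))

lemma form_const_right: "form P (mpoly_const A ** Q) = form P Q ** conj_transpose A"
  by (metis form_hermitian form_const_left conj_transpose_simps(4))

lemma form_zero [simp]: "form 0 P = 0" "form P 0 = 0"
  using form_const_left[of 0 0 P] form_const_right[of P 0 0] by simp_all

lemma form_sum_right: "form P (\<Sum>j\<in>I. f j) = (\<Sum>j\<in>I. form P (f j))"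
  by (induction I rule: infinite_finite_induct) (auto simp: form_add_right)

lemma form_sum_left: "form (\<Sum>j\<in>I. f j) P = (\<Sum>j\<in>I. form (f j) P)"
  by (induction I rule: infinite_finite_induct) (auto simp: form_add_left)

text \<open>The weight is \<open>(n - p) a a\<^sup>T + p b b\<^sup>T\<close> up to the Gegenbauer factor, with \<open>a = (1, -x)\<close> and
  \<open>b = (x, -1)\<close>.\<close>

lemma form_definite:
  assumes "form P P = 0"
  shows "P = 0"
proof -
  have "P $ i $ 1 = 0 \<and> P $ i $ 2 = 0" for i
  proof -
    define f g where "f = P $ i $ 1" and "g = P $ i $ 2"
    define X :: "complex poly" where "X = [:0, 1:]"
    define a b where "a = f - X * g" and "b = X * f - g"
    have rX: "map_poly cnj X = X" by (simp add: X_def map_poly_pCons)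
    have ca: "map_poly cnj a = map_poly cnj f - X * map_poly cnj g"
      "map_poly cnj b = X * map_poly cnj f - map_poly cnj g"
      by (simp_all add: a_def b_def map_poly_cnj_diff map_poly_cnj_mult rX)
    define C D where "C = [:complex_of_real (n - p):]" and "D = [:complex_of_real p:]"
    have W: "weight_poly $ 1 $ 1 = C + D * X * X" "weight_poly $ 1 $ 2 = - (C + D) * X"
      "weight_poly $ 2 $ 1 = - (C + D) * X" "weight_poly $ 2 $ 2 = D + C * X * X"
      by (simp_all add: weight_poly_entries X_def C_def D_def)
    have "(P ** weight_poly ** adj P) $ i $ i = C * (a * map_poly cnj a) + D * (b * map_poly cnj b)"
      by (simp add: matrix_matrix_mult_def sum_2 adj_def W ca f_def[symmetric] g_def[symmetric])
        (simp add: a_def b_def algebra_simps)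
    moreover have "L ((P ** weight_poly ** adj P) $ i $ i) = 0"
      using assms by (simp add: form_def vec_eq_iff)
    ultimately have eq: "of_real (n - p) * L (a * map_poly cnj a) + of_real p * L (b * map_poly cnj b) = 0"
      by (simp add: functional_linear C_def D_def)
    obtain s where s: "L (a * map_poly cnj a) = of_real s" "s \<ge> 0" using functional_norm_nonneg[OF n_pos] by blast
    obtain t where t: "L (b * map_poly cnj b) = of_real t" "t \<ge> 0" using functional_norm_nonneg[OF n_pos] by blast
    have "(n - p) * s + p * t = 0"
      using eq unfolding s(1) t(1) by (simp flip: of_real_mult of_real_add of_real_diff)
    moreover have "n - p > 0" using p_pos p_less by simp
    ultimately have "s = 0" "t = 0"
      using s(2) t(2) p_pos by (smt (verit) mult_nonneg_nonneg mult_pos_pos)+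
    then have "a = 0" "b = 0" using s t functional_norm[OF n_pos] by simp_all
    then have "f = X * g" "X * f = g" by (simp_all add: a_def b_def)
    then have "[:-1, 0, 1:] * g = 0" by (simp add: X_def)
    then have "g = 0" by (simp only: mult_eq_0_iff) simp
    then show ?thesis using \<open>f = X * g\<close> by (simp add: f_def g_def)
  qed
  then show ?thesis by (simp add: mat2_simps)
qed

text \<open>If x is in the kernel of the transposed Gram matrix, the matrix A with all rows equal to
  x satisfies A (Q, Q) = 0. So A Q has norm zero and vanishes, and its leading coefficient is
  A.\<close>

lemma form_monic_invertible:
  assumes "monic_of_degree w Q"
  shows "\<exists>B. form Q Q ** B = mat 1"
proof -
  have "x = 0" if "transpose (form Q Q) *v x = 0" for x
  proof -
    define A :: mat2 where "A = (\<chi> i. x)"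
    have A: "A ** form Q Q = 0"
      using that by (simp add: A_def mat2_simps matrix_vector_mult_def transpose_def mult.commute)
    have "form (mpoly_const A ** Q) (mpoly_const A ** Q) = 0"
      by (simp add: form_const_left form_const_right matrix_mul_assoc A)
    then have "mpoly_const A ** Q = 0" by (rule form_definite)
    then have "mpoly_coeff (mpoly_const A ** Q) w = 0" by simp
    then have "A = 0" using assms by (simp add: monic_of_degree_def)
    then show "x = 0" by (simp add: A_def vec_eq_iff)
  qed
  then obtain B where "B ** transpose (form Q Q) = mat 1"
    using matrix_left_invertible_ker[of "transpose (form Q Q)"] by blast
  then have "transpose (B ** transpose (form Q Q)) = transpose (mat 1)" by simp
  then have "form Q Q ** transpose B = mat 1"
    by (simp add: matrix_transpose_mul)
  then show ?thesis ..
qed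

text \<open>Gram-Schmidt with matrix coefficients, which multiply from the left: the correction
  along \<open>Q j\<close> has the coefficient (x^w, Q j) times the inverse of (Q j, Q j). The
  invariant of the induction is orthogonality to every polynomial of lower degree.\<close>

lemma monic_orthogonal_exists: "\<exists>Q. monic_orthogonal (weight p n) Q"
proof -
  have "\<exists>Q. monic_of_degree w Q \<and> (\<forall>P. deg_less w P \<longrightarrow> form Q P = 0)" for w
  proof (induction w rule: less_induct)
    case (less w)
    then obtain Q where Q: "\<And>j. j < w \<Longrightarrow> monic_of_degree j (Q j)"
      and orth: "\<And>j P. j < w \<Longrightarrow> deg_less j P \<Longrightarrow> form (Q j) P = 0"
      by metis
    from Q have "\<forall>j. \<exists>B. j < w \<longrightarrow> form (Q j) (Q j) ** B = mat 1"
      using form_monic_invertible by blast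
    then obtain G where G: "\<And>j. j < w \<Longrightarrow> form (Q j) (Q j) ** G j = mat 1" by metis
    have G': "G j ** form (Q j) (Q j) = mat 1" if "j < w" for j
      using G[OF that] by (simp add: matrix_left_right_inverse)
    have orth': "form (Q j) (Q k) = 0" if "j < w" "k < w" "j \<noteq> k" for j k
    proof (cases "k < j")
      case True
      then show ?thesis
        by (intro orth[OF that(1)] deg_less_mono[OF monic_deg_less[OF Q[OF that(2)]]]) simp
    next
      case False
      then have "form (Q k) (Q j) = 0"
        using that(3)
        by (intro orth[OF that(2)] deg_less_mono[OF monic_deg_less[OF Q[OF that(1)]]]) simp
      then show ?thesis using form_hermitian[of "Q j" "Q k"] by simp
    qed
    let ?X = "mat (monom 1 w) :: mpoly2"
    define R where "R = ?X - (\<Sum>j<w. mpoly_const (form ?X (Q j) ** G j) ** Q j)"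
    have "form R (Q k) = 0" if "k < w" for k
    proof -
      have "form R (Q k) = form ?X (Q k) - (\<Sum>j<w. (form ?X (Q j) ** G j) ** form (Q j) (Q k))"
        unfolding R_def form_diff_left form_sum_left form_const_left ..
      also have "(\<Sum>j<w. (form ?X (Q j) ** G j) ** form (Q j) (Q k))
          = (\<Sum>j\<in>{k}. (form ?X (Q j) ** G j) ** form (Q j) (Q k))"
        by (rule sum.mono_neutral_right) (use that orth' in auto)
      also have "\<dots> = form ?X (Q k)" using G'[OF that] by (simp flip: matrix_mul_assoc)
      finally show ?thesis by simp
    qed
    then have "form R P = 0" if "deg_less w P" for P
      using deg_less_expand[OF Q that] by (auto simp: form_sum_right form_const_right)
    moreover have "deg_less w (\<Sum>j<w. mpoly_const (form ?X (Q j) ** G j) ** Q j)"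
      by (intro deg_less_sum deg_less_const_mult deg_less_mono[OF monic_deg_less[OF Q]]) auto
    then have "monic_of_degree w R"
      using monic_xpow[of w] by (auto simp: R_def monic_of_degree_def deg_less_def)
    ultimately show ?case by blast
  qed
  then obtain Q where Q: "\<And>w. monic_of_degree w (Q w)" "\<And>w P. deg_less w P \<Longrightarrow> form (Q w) P = 0"
    by metis
  have "form (Q w) (Q v) = 0" if "w \<noteq> v" for w v
  proof (cases "v < w")
    case True
    then show ?thesis by (intro Q(2) deg_less_mono[OF monic_deg_less[OF Q(1)]]) simp
  next
    case False
    then have "form (Q v) (Q w) = 0"
      using that by (intro Q(2) deg_less_mono[OF monic_deg_less[OF Q(1)]]) simp
    then show ?thesis using form_hermitian[of "Q w" "Q v"] by simp
  qed
  then show ?thesis using Q(1) unfolding monic_orthogonal_def matrix_form_weight by blast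
qed

lemma monic_orthogonal_lower:
  assumes "monic_orthogonal (weight p n) Q" "deg_less w P"
  shows "form (Q w) P = 0"
proof -
  have "\<And>j. monic_of_degree j (Q j)" and "\<And>j. j \<noteq> w \<Longrightarrow> form (Q w) (Q j) = 0"
    using assms(1) by (auto simp: monic_orthogonal_def matrix_form_weight)
  then show ?thesis
    using deg_less_expand[of w Q P] assms(2) by (auto simp: form_sum_right form_const_right)
qed

abbreviation Q where "Q \<equiv> monic_orthogonal_seq (weight p n)"

text \<open>The definite description needs uniqueness: the difference of two candidates in degree w
  has lower degree and is therefore orthogonal to itself.\<close>

lemma monic_orthogonal_Q: "monic_orthogonal (weight p n) Q"
proof -
  have "P = R" if P: "monic_orthogonal (weight p n) P" and R: "monic_orthogonal (weight p n) R" for P R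
  proof
    fix w
    have "monic_of_degree w (P w)" "monic_of_degree w (R w)"
      using P R by (auto simp: monic_orthogonal_def)
    then have D: "deg_less w (P w - R w)"
      by (auto simp: monic_of_degree_def deg_less_def le_less)
    have "form (P w - R w) (P w - R w) = 0"
      using monic_orthogonal_lower[OF P D] monic_orthogonal_lower[OF R D] by (simp add: form_diff_left)
    then have "P w - R w = 0" by (rule form_definite)
    then show "P w = R w" by simp
  qed
  with monic_orthogonal_exists have "\<exists>!Q. monic_orthogonal (weight p n) Q"
    by (rule ex_ex1I)
  then show ?thesis
    unfolding monic_orthogonal_seq_def by (rule theI'[of "monic_orthogonal (weight p n)"])
qed

lemma monic_Q: "monic_of_degree w (Q w)"
  using monic_orthogonal_Q by (simp add: monic_orthogonal_def)

lemmas Q_lower = monic_orthogonal_lower[OF monic_orthogonal_Q]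

text \<open>D(Q w) minus its leading coefficient times Q w has lower degree, and it is orthogonal to
  lower degrees because the adjoint preserves them; so it is orthogonal to itself. The scalars
  \<open>c\<close> and \<open>d\<close> admit operators that are adjoint only up to factors, as
  \<open>D3\<close> and \<open>D4\<close> are.\<close>

lemma adjoint_eigen:
  assumes D: "\<And>P. deg_less w P \<Longrightarrow> deg_less w (E P)"
    and adjoint: "\<And>P R. mat d ** form (D P) R = mat c ** form P (E R)" and "d \<noteq> 0"
    and deg: "deg_less (Suc w) (D (Q w))"
  shows "D (Q w) = mpoly_const (mpoly_coeff (D (Q w)) w) ** Q w"
proof -
  define R where "R = D (Q w) - mpoly_const (mpoly_coeff (D (Q w)) w) ** Q w"
  have R: "deg_less w R"
    unfolding R_def using deg monic_Q by (rule deg_less_minus_leading)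
  have "mat d ** form (D (Q w)) R = 0"
    using Q_lower[OF D[OF R]] adjoint[of "Q w" R] by simp
  then have "form (D (Q w)) R = 0"
    using \<open>d \<noteq> 0\<close> by (auto simp: vec_eq_iff)
  then have "form R R = 0"
    using Q_lower[OF R] by (subst R_def) (simp add: form_diff_left form_const_left)
  then have "R = 0" by (rule form_definite)
  then show ?thesis by (simp add: R_def)
qed

end


section \<open>Differential operators\<close>

lemma mult_mat_entry [simp]: "((A :: 'a::comm_ring_1 ^ 'n ^ 'm) ** mat c) $ i $ j = A $ i $ j * c"
  by (simp add: matrix_matrix_mult_def mat_def if_distrib[of "\<lambda>x. _ * x"] cong: if_cong)

lemma mat_mult_commute: "A ** mat c = mat c ** (A :: 'a::comm_ring_1 ^ 'n ^ 'n)"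
  by (simp add: vec_eq_iff mult.commute)

lemma mat_mult_assoc_left: "(mat c ** A) ** B = mat c ** (A ** (B :: 'a::comm_ring_1 ^ 'n ^ 'm))"
  by (simp add: matrix_mul_assoc)

lemma mult_mat_assoc:
  fixes A B :: "'a::comm_ring_1 ^ 'n ^ 'n"
  shows "A ** (mat c ** B) = mat c ** (A ** B)"
  unfolding matrix_mul_assoc mat_mult_commute[of A] ..

lemma mpoly_coeff_mat_const [simp]: "mpoly_coeff (mat [:c:] ** P) k = mat c ** mpoly_coeff P k"
  by (simp add: mpoly_coeff_def vec_eq_iff)

lemma mpoly_const_mat: "mpoly_const (mat c) = mat [:c:]"
  by (simp add: mpoly_const_def mat_def vec_eq_iff)

lemma mpoly_deriv_simps [simp]:
  "mpoly_deriv 0 = 0" "mpoly_deriv (P + R) = mpoly_deriv P + mpoly_deriv R"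
  "mpoly_deriv (P - R) = mpoly_deriv P - mpoly_deriv R"
  "mpoly_deriv (mpoly_const A ** P) = mpoly_const A ** mpoly_deriv P"
  by (simp_all add: mpoly_deriv_def mpoly_const_def mat2_simps pderiv_add pderiv_diff pderiv_smult pderiv_minus)

lemma mpoly_deriv_mult: "mpoly_deriv (P ** R) = mpoly_deriv P ** R + P ** mpoly_deriv R"
  by (simp add: mpoly_deriv_def mat2_simps pderiv_add pderiv_mult mult.commute)

lemma mpoly_deriv_const [simp]: "mpoly_deriv (mpoly_const A) = 0"
  by (simp add: mpoly_deriv_def mpoly_const_def vec_eq_iff pderiv_pCons)

lemma mpoly_deriv_mat: "mpoly_deriv (mat f) = mat (pderiv f)"
  by (simp add: mpoly_deriv_def mat_def vec_eq_iff)

lemma mpoly_deriv_sum: "mpoly_deriv (\<Sum>i\<in>I. f i) = (\<Sum>i\<in>I. mpoly_deriv (f i))"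
  by (induction I rule: infinite_finite_induct) auto

lemma mpoly_deriv_iter_add: "(mpoly_deriv ^^ i) (P + R) = (mpoly_deriv ^^ i) P + (mpoly_deriv ^^ i) R"
  by (induction i) auto

lemma mpoly_deriv_iter_const_mult: "(mpoly_deriv ^^ i) (mpoly_const A ** P) = mpoly_const A ** (mpoly_deriv ^^ i) P"
  by (induction i) auto

lemma mpoly_deriv_iter_entry: "(mpoly_deriv ^^ m) P $ i $ j = (pderiv ^^ m) (P $ i $ j)"
  by (induction m) (auto simp: mpoly_deriv_def)

lemma diff_op_add: "diff_op s F (P + R) = diff_op s F P + diff_op s F R"
  by (simp add: diff_op_def mpoly_deriv_iter_add matrix_add_rdistrib sum.distrib)

lemma diff_op_const_mult: "diff_op s F (mpoly_const A ** P) = mpoly_const A ** diff_op s F P"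
  by (simp add: diff_op_def mpoly_deriv_iter_const_mult matrix_mult_sum_right matrix_mul_assoc)

lemma diff_op_zero: "diff_op s F 0 = 0"
  using diff_op_const_mult[of s F 0 0] by simp

lemma diff_op_sum: "diff_op s F (\<Sum>i\<in>I. f i) = (\<Sum>i\<in>I. diff_op s F (f i))"
  by (induction I rule: infinite_finite_induct) (auto simp: diff_op_add diff_op_zero)

section \<open>The filtration of differential operators by order\<close>

definition diff_ops :: "nat \<Rightarrow> mat_op set" where
  "diff_ops s = {D. \<exists>F. D = diff_op s F}"

lemma diff_ops_mono:
  assumes "D \<in> diff_ops s" "s \<le> s'"
  shows "D \<in> diff_ops s'"
proof -
  obtain F where D: "D = diff_op s F" using assms(1) by (auto simp: diff_ops_def)
  have "D = diff_op s' (\<lambda>i. if i \<le> s then F i else 0)"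
    unfolding D diff_op_def
    by (intro ext sum.mono_neutral_cong_left) (use assms(2) in auto)
  then show ?thesis by (auto simp: diff_ops_def)
qed

lemma diff_ops_zero: "(\<lambda>P. 0) \<in> diff_ops s"
proof -
  have "(\<lambda>P. 0) = diff_op s (\<lambda>i. 0)" by (simp add: diff_op_def)
  then show ?thesis by (auto simp: diff_ops_def)
qed

lemma diff_ops_add:
  assumes "D \<in> diff_ops s" "E \<in> diff_ops s"
  shows "(\<lambda>P. D P + E P) \<in> diff_ops s"
proof -
  obtain F G where "D = diff_op s F" "E = diff_op s G" using assms by (auto simp: diff_ops_def)
  then have "(\<lambda>P. D P + E P) = diff_op s (\<lambda>i. F i + G i)"
    by (simp add: diff_op_def matrix_add_ldistrib sum.distrib)
  then show ?thesis by (auto simp: diff_ops_def)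
qed

lemma diff_ops_mult_right:
  assumes "D \<in> diff_ops s"
  shows "(\<lambda>P. D P ** G) \<in> diff_ops s"
proof -
  obtain F where "D = diff_op s F" using assms by (auto simp: diff_ops_def)
  then have "(\<lambda>P. D P ** G) = diff_op s (\<lambda>i. F i ** G)"
    by (simp add: diff_op_def matrix_mult_sum_left matrix_mul_assoc)
  then show ?thesis by (auto simp: diff_ops_def)
qed

lemma diff_ops_scalar:
  assumes "D \<in> diff_ops s"
  shows "(\<lambda>P. mat f ** D P) \<in> diff_ops s"
proof -
  have "(\<lambda>P. mat f ** D P) = (\<lambda>P. D P ** mat f)" by (simp add: mat_mult_commute)
  then show ?thesis using diff_ops_mult_right[OF assms] by simp
qed

lemma diff_ops_sum:
  assumes "\<And>i. i \<in> I \<Longrightarrow> D i \<in> diff_ops s"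
  shows "(\<lambda>P. \<Sum>i\<in>I. D i P) \<in> diff_ops s"
  using assms
  by (induction I rule: infinite_finite_induct) (auto intro: diff_ops_add diff_ops_zero)

lemma diff_ops_deriv:
  assumes "D \<in> diff_ops s"
  shows "(\<lambda>P. mpoly_deriv (D P)) \<in> diff_ops (Suc s)"
proof -
  obtain F where D: "D = diff_op s F" using assms by (auto simp: diff_ops_def)
  have "(\<lambda>P. mpoly_deriv (D P)) = (\<lambda>P. diff_op s (\<lambda>i. mpoly_deriv (F i)) P
      + diff_op (Suc s) (\<lambda>i. if i = 0 then 0 else F (i - 1)) P)"
    by (simp add: D diff_op_def mpoly_deriv_sum mpoly_deriv_mult sum.distrib sum.atMost_Suc_shift
      add.commute del: sum.atMost_Suc)
  also have "\<dots> \<in> diff_ops (Suc s)"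
    by (rule diff_ops_add, rule diff_ops_mono[of _ s]) (auto simp: diff_ops_def)
  finally show ?thesis .
qed

lemma diff_ops_iter_deriv:
  assumes "D \<in> diff_ops s"
  shows "(\<lambda>P. (mpoly_deriv ^^ i) (D P)) \<in> diff_ops (s + i)"
  by (induction i) (use assms diff_ops_deriv in auto)

lemma diff_ops_comp:
  assumes "D \<in> diff_ops r" "E \<in> diff_ops s"
  shows "E \<circ> D \<in> diff_ops (r + s)"
proof -
  obtain G where "E = diff_op s G" using assms by (auto simp: diff_ops_def)
  then have "E \<circ> D = (\<lambda>P. \<Sum>i\<le>s. (mpoly_deriv ^^ i) (D P) ** G i)"
    by (auto simp: diff_op_def)
  moreover have "(\<lambda>P. (mpoly_deriv ^^ i) (D P) ** G i) \<in> diff_ops (r + s)" if "i \<le> s" for i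
    using diff_ops_mult_right[OF diff_ops_mono[OF diff_ops_iter_deriv[OF assms(1)]], of i "r + s"] that
    by simp
  ultimately show ?thesis using diff_ops_sum[of "{..s}"] by simp
qed

lemma diff_ops_id: "id \<in> diff_ops 0"
proof -
  have "id = diff_op 0 (\<lambda>_. mat 1)" by (auto simp: diff_op_def)
  then show ?thesis by (auto simp: diff_ops_def)
qed

text \<open>Testing on x^k isolates the k-th coefficient: terms of order above k vanish, those below
  are gone by induction, and the k-th derivative contributes k!. This justifies comparing
  coefficients of operators.\<close>

lemma diff_op_eq_zero_imp:
  assumes "\<And>P. diff_op s F P = 0" "k \<le> s"
  shows "F k = 0"
  using assms(2)
proof (induction k rule: less_induct)
  case (less k)
  have d: "(mpoly_deriv ^^ i) (mat f) = mat ((pderiv ^^ i) f)" for i f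
    by (induction i) (auto simp: mpoly_deriv_mat)
  have z: "(pderiv ^^ i) (monom 1 k) = (0 :: complex poly)" if "k < i" for i
    by (rule poly_eqI) (use that in \<open>auto simp: coeff_higher_pderiv\<close>)
  have "diff_op s F (mat (monom 1 k)) = (\<Sum>i\<in>{k}. (mpoly_deriv ^^ i) (mat (monom 1 k)) ** F i)"
    unfolding diff_op_def
  proof (rule sum.mono_neutral_right)
    show "\<forall>i\<in>{..s} - {k}. (mpoly_deriv ^^ i) (mat (monom 1 k)) ** F i = 0"
    proof
      fix i assume "i \<in> {..s} - {k}"
      then consider "i < k" "i \<le> s" | "k < i" by fastforce
      then show "(mpoly_deriv ^^ i) (mat (monom 1 k)) ** F i = 0"
        using less.IH[of i] z[of i] by cases (auto simp: d)
    qed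
  qed (use less.prems in auto)
  also have "\<dots> = mat [:fact k:] ** F k"
  proof -
    have "(pderiv ^^ k) (monom 1 k) = [:fact k :: complex:]"
      by (rule poly_eqI) (auto simp: coeff_higher_pderiv coeff_pCons pochhammer_fact split: nat.splits)
    then show ?thesis by (simp add: d)
  qed
  finally have "mat [:fact k:] ** F k = 0" using assms(1) by simp
  then show ?case by (simp add: vec_eq_iff)
qed

text \<open>The falling factorial w (w - 1) ... (w - i + 1) as a polynomial in w. It is the factor
  that the i-th derivative puts on x^w, and it makes eigenvalues polynomial in w.\<close>

definition ffact_poly :: "nat \<Rightarrow> complex poly" where
  "ffact_poly i = (\<Prod>j<i. [:- of_nat j, 1:])"

lemma ffact_poly_simps: "ffact_poly 0 = 1" "ffact_poly (Suc i) = ffact_poly i * [:- of_nat i, 1:]"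
  by (simp_all add: ffact_poly_def mult.commute)

lemma degree_ffact_poly: "degree (ffact_poly i) = i" and lead_ffact_poly: "coeff (ffact_poly i) i = 1"
proof -
  have "ffact_poly i \<noteq> 0 \<and> degree (ffact_poly i) = i \<and> lead_coeff (ffact_poly i) = 1"
  proof (induction i)
    case (Suc i)
    then show ?case
      unfolding ffact_poly_simps lead_coeff_mult by (subst degree_mult_eq) (auto simp del: mult_pCons_right)
  qed (simp add: ffact_poly_simps)
  then show "degree (ffact_poly i) = i" "coeff (ffact_poly i) i = 1" by auto
qed

lemma ffact_poly_eq_0: "w < i \<Longrightarrow> poly (ffact_poly i) (of_nat w) = 0"
  by (auto simp: ffact_poly_def poly_prod prod_zero_iff)

lemma pochhammer_ffact: "pochhammer (of_nat (Suc k)) i = poly (ffact_poly i) (of_nat (k + i) :: complex)"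
proof (induction i arbitrary: k)
  case (Suc i)
  have "pochhammer (of_nat (Suc k)) (Suc i) = of_nat (Suc k) * pochhammer (of_nat (Suc (Suc k))) i"
    by (simp add: pochhammer_rec add_ac)
  also have "\<dots> = poly (ffact_poly i) (of_nat (k + Suc i)) * (of_nat (k + Suc i) - of_nat i)"
    unfolding Suc by simp
  finally show ?case by (simp add: ffact_poly_simps algebra_simps)
qed (simp add: ffact_poly_simps)

lemma coeff_deriv_iter:
  "mpoly_coeff ((mpoly_deriv ^^ i) P) k = mat (poly (ffact_poly i) (of_nat (k + i))) ** mpoly_coeff P (k + i)"
  by (simp add: mpoly_coeff_def vec_eq_iff mpoly_deriv_iter_entry coeff_higher_pderiv pochhammer_ffact
    del: of_nat_add of_nat_Suc)

lemma deg_less_deriv_iter: "deg_less (Suc w) P \<Longrightarrow> deg_less (Suc (w - i)) ((mpoly_deriv ^^ i) P)"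
  by (auto simp: deg_less_def coeff_deriv_iter)

lemma deriv_iter_eq_0:
  assumes "deg_less w P" "w \<le> i"
  shows "(mpoly_deriv ^^ i) P = 0"
  using assms by (intro mpoly_eqI) (auto simp: coeff_deriv_iter deg_less_def)

lemma deg_less_mult_aux:
  assumes "deg_less (Suc a) P" "deg_less (Suc b) R" "a + b \<le> k"
  shows "mpoly_coeff (P ** R) k = (if k = a + b then mpoly_coeff P a ** mpoly_coeff R b else 0)"
proof -
  have d: "degree (P $ i $ j) \<le> a" "degree (R $ i $ j) \<le> b" for i j
    using assms(1,2) by (auto intro!: degree_le simp: deg_less_def mpoly_coeff_def vec_eq_iff)
  have "coeff (P $ i $ j * R $ j $ l) k = (if k = a + b then coeff (P $ i $ j) a * coeff (R $ j $ l) b else 0)" for i j l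
  proof (cases "k = a + b")
    case True
    have "coeff (P $ i $ j * R $ j $ l) (a + b) = (\<Sum>m\<in>{a}. coeff (P $ i $ j) m * coeff (R $ j $ l) (a + b - m))"
      unfolding coeff_mult
    proof (rule sum.mono_neutral_right)
      show "\<forall>m\<in>{..a + b} - {a}. coeff (P $ i $ j) m * coeff (R $ j $ l) (a + b - m) = 0"
      proof
        fix m assume "m \<in> {..a + b} - {a}"
        then have "m > a \<or> a + b - m > b" by auto
        then show "coeff (P $ i $ j) m * coeff (R $ j $ l) (a + b - m) = 0"
          using d(1)[of i j] d(2)[of j l] by (auto simp: coeff_eq_0)
      qed
    qed auto
    then show ?thesis using True by simp
  next
    case False
    then have "degree (P $ i $ j * R $ j $ l) < k"
      using degree_mult_le[of "P $ i $ j" "R $ j $ l"] d(1)[of i j] d(2)[of j l] assms(3) by linarith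
    then show ?thesis using False by (simp add: coeff_eq_0)
  qed
  then show ?thesis by (auto simp: mpoly_coeff_def mat2_simps)
qed

lemma deg_less_mult: "deg_less (Suc a) P \<Longrightarrow> deg_less (Suc b) R \<Longrightarrow> deg_less (Suc (a + b)) (P ** R)"
  unfolding deg_less_def[of "Suc (a + b)"] by (auto simp: deg_less_mult_aux)

lemma diff_op_term_degree:
  assumes "deg_less (Suc w) P" "deg_less (Suc i) (F i)"
  shows "deg_less (Suc w) ((mpoly_deriv ^^ i) P ** F i)"
proof (cases "i \<le> w")
  case True
  then show ?thesis using deg_less_mult[OF deg_less_deriv_iter[OF assms(1), of i] assms(2)] by simp
next
  case False
  then show ?thesis using deriv_iter_eq_0[OF assms(1), of i] by simp
qed

lemma diff_op_degree:
  assumes "\<And>i. i \<le> s \<Longrightarrow> deg_less (Suc i) (F i)" "deg_less w P"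
  shows "deg_less w (diff_op s F P)"
proof (cases w)
  case (Suc v)
  then show ?thesis using assms unfolding diff_op_def
    by (auto intro!: deg_less_sum diff_op_term_degree)
qed (use assms in \<open>simp add: diff_op_zero\<close>)

text \<open>The i-th derivative lowers the degree by i and F_i raises it by at most i, so only the
  coefficient of x^i in F_i reaches x^w. For w < i the derivative and the falling factorial both
  vanish.\<close>

lemma diff_op_leading:
  assumes "\<And>i. i \<le> s \<Longrightarrow> deg_less (Suc i) (F i)" "deg_less (Suc w) P"
  shows "mpoly_coeff (diff_op s F P) w
    = (\<Sum>i\<le>s. mat (poly (ffact_poly i) (of_nat w)) ** (mpoly_coeff P w ** mpoly_coeff (F i) i))"
proof -
  have "mpoly_coeff ((mpoly_deriv ^^ i) P ** F i) w
      = mat (poly (ffact_poly i) (of_nat w)) ** (mpoly_coeff P w ** mpoly_coeff (F i) i)" if "i \<le> s" for i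
  proof (cases "i \<le> w")
    case True
    then show ?thesis
      using deg_less_mult_aux[OF deg_less_deriv_iter[OF assms(2), of i] assms(1)[OF that], of w]
      by (simp add: coeff_deriv_iter matrix_mul_assoc)
  next
    case False
    then show ?thesis using deriv_iter_eq_0[OF assms(2), of i] by (simp add: ffact_poly_eq_0)
  qed
  then show ?thesis by (simp add: diff_op_def)
qed


section \<open>The eigenvalue map\<close>

context gegenbauer_weight
begin

abbreviation W_ops :: "mat_op set" where "W_ops \<equiv> weight_ops (weight p n)"

definition eigenvalue :: "mat_op \<Rightarrow> nat \<Rightarrow> mat2" where
  "eigenvalue D w = mpoly_coeff (D (Q w)) w"

lemma W_ops_diff_ops: "D \<in> W_ops \<Longrightarrow> \<exists>s. D \<in> diff_ops s"
  by (auto simp: weight_ops_def diff_ops_def)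

lemma W_ops_eigen:
  assumes "D \<in> W_ops"
  shows "D (Q w) = mpoly_const (eigenvalue D w) ** Q w"
proof -
  obtain \<Lambda> where "D (Q w) = mpoly_const \<Lambda> ** Q w" using assms by (auto simp: weight_ops_def)
  moreover from this have "eigenvalue D w = \<Lambda>"
    using monic_Q[of w] by (simp add: eigenvalue_def monic_of_degree_def)
  ultimately show ?thesis by simp
qed

lemma W_opsI:
  assumes "D \<in> diff_ops s" "\<And>w. D (Q w) = mpoly_const (\<Lambda> w) ** Q w"
  shows "D \<in> W_ops" "eigenvalue D w = \<Lambda> w"
  using assms monic_Q[of w] unfolding weight_ops_def eigenvalue_def diff_ops_def monic_of_degree_def
  by auto

lemma diff_ops_const_mult: "D \<in> diff_ops s \<Longrightarrow> D (mpoly_const A ** P) = mpoly_const A ** D P"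
  by (auto simp: diff_ops_def diff_op_const_mult)

lemma diff_ops_sum_arg: "D \<in> diff_ops s \<Longrightarrow> D (\<Sum>i\<in>I. f i) = (\<Sum>i\<in>I. D (f i))"
  by (auto simp: diff_ops_def diff_op_sum)

text \<open>Operators commute with constant matrices on the left, and the left combinations of the Q
  w are all polynomials. Identities between operators can thus be checked on eigenvalues.\<close>

lemma W_ops_inj:
  assumes "D \<in> W_ops" "E \<in> W_ops" "\<And>w. eigenvalue D w = eigenvalue E w"
  shows "D = E"
proof
  fix P
  obtain w where "deg_less w P" using deg_less_exists by blast
  then obtain A where A: "P = (\<Sum>j<w. mpoly_const (A j) ** Q j)"
    using deg_less_expand[of w Q] monic_Q by blast
  obtain s t where s: "D \<in> diff_ops s" and t: "E \<in> diff_ops t" using assms W_ops_diff_ops by blast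
  show "D P = E P"
    unfolding A diff_ops_sum_arg[OF s] diff_ops_sum_arg[OF t]
    by (simp add: diff_ops_const_mult[OF s] diff_ops_const_mult[OF t] assms(3) W_ops_eigen[OF assms(1)] W_ops_eigen[OF assms(2)])
qed

lemma W_ops_add:
  assumes "D \<in> W_ops" "E \<in> W_ops"
  shows "(\<lambda>P. D P + E P) \<in> W_ops" "eigenvalue (\<lambda>P. D P + E P) w = eigenvalue D w + eigenvalue E w"
proof -
  obtain s t where s: "D \<in> diff_ops s" and t: "E \<in> diff_ops t" using assms W_ops_diff_ops by blast
  have "(\<lambda>P. D P + E P) \<in> diff_ops (max s t)"
    using diff_ops_add[OF diff_ops_mono[OF s] diff_ops_mono[OF t]] by simp
  from W_opsI[OF this, of "\<lambda>w. eigenvalue D w + eigenvalue E w"]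
  show "(\<lambda>P. D P + E P) \<in> W_ops" "eigenvalue (\<lambda>P. D P + E P) w = eigenvalue D w + eigenvalue E w"
    by (simp_all add: W_ops_eigen[OF assms(1)] W_ops_eigen[OF assms(2)] matrix_add_rdistrib)
qed

text \<open>With the action on the right, E \<circ> D is the product D E, and the eigenvalues
  multiply in that order: the eigenvalue map is a homomorphism.\<close>

lemma W_ops_comp:
  assumes "D \<in> W_ops" "E \<in> W_ops"
  shows "E \<circ> D \<in> W_ops" "eigenvalue (E \<circ> D) w = eigenvalue D w ** eigenvalue E w"
proof -
  obtain s t where s: "D \<in> diff_ops s" and t: "E \<in> diff_ops t" using assms W_ops_diff_ops by blast
  have "E \<circ> D \<in> diff_ops (s + t)" using diff_ops_comp[OF s t] .
  from W_opsI[OF this, of "\<lambda>w. eigenvalue D w ** eigenvalue E w"]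
  show "E \<circ> D \<in> W_ops" "eigenvalue (E \<circ> D) w = eigenvalue D w ** eigenvalue E w"
    by (simp_all add: W_ops_eigen[OF assms(1)] W_ops_eigen[OF assms(2)] diff_ops_const_mult[OF t] matrix_mul_assoc)
qed

lemma W_ops_scalar:
  assumes "D \<in> W_ops"
  shows "(\<lambda>P. mat [:c:] ** D P) \<in> W_ops" "eigenvalue (\<lambda>P. mat [:c:] ** D P) w = mat c ** eigenvalue D w"
proof -
  obtain s where "D \<in> diff_ops s" using assms W_ops_diff_ops by blast
  then have "(\<lambda>P. mat [:c:] ** D P) \<in> diff_ops s" by (rule diff_ops_scalar)
  from W_opsI[OF this, of "\<lambda>w. mat c ** eigenvalue D w"]
  show "(\<lambda>P. mat [:c:] ** D P) \<in> W_ops" "eigenvalue (\<lambda>P. mat [:c:] ** D P) w = mat c ** eigenvalue D w"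
    by (simp_all add: W_ops_eigen[OF assms] mpoly_const_mat[symmetric] matrix_mul_assoc)
qed

lemma W_ops_zero: "(\<lambda>P. 0) \<in> W_ops" "eigenvalue (\<lambda>P. 0) w = 0"
  using W_opsI[OF diff_ops_zero, of "\<lambda>w. 0"] by simp_all

lemma W_ops_id: "id \<in> W_ops" "eigenvalue id w = mat 1"
  using W_opsI[OF diff_ops_id, of "\<lambda>w. mat 1"] by simp_all

lemma ring_op_algebra: "Ring.ring (op_algebra (weight p n))"
proof (rule ringI)
  show "abelian_group (op_algebra (weight p n))"
  proof (rule abelian_groupI)
    fix D assume D: "D \<in> carrier (op_algebra (weight p n))"
    then have D': "D \<in> W_ops" by (simp add: op_algebra_def)
    have "(\<lambda>P. mat [:-1:] ** D P + D P) = (\<lambda>P. 0)"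
      by (simp add: fun_eq_iff vec_eq_iff)
    with W_ops_scalar(1)[OF D', of "-1"]
    show "\<exists>E\<in>carrier (op_algebra (weight p n)). E \<oplus>\<^bsub>op_algebra (weight p n)\<^esub> D = \<zero>\<^bsub>op_algebra (weight p n)\<^esub>"
      by (intro bexI[of _ "\<lambda>P. mat [:-1:] ** D P"]) (auto simp: op_algebra_def)
  qed (auto simp: op_algebra_def W_ops_add W_ops_zero add_ac)
  show "Group.monoid (op_algebra (weight p n))"
    by (rule monoidI) (auto simp: op_algebra_def W_ops_comp(1) W_ops_id(1) o_assoc)
next
  fix D E F assume "D \<in> carrier (op_algebra (weight p n))" "E \<in> carrier (op_algebra (weight p n))"
    "F \<in> carrier (op_algebra (weight p n))"
  then obtain s where "F \<in> diff_ops s" using W_ops_diff_ops by (auto simp: op_algebra_def)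
  then show "(D \<oplus>\<^bsub>op_algebra (weight p n)\<^esub> E) \<otimes>\<^bsub>op_algebra (weight p n)\<^esub> F
      = D \<otimes>\<^bsub>op_algebra (weight p n)\<^esub> F \<oplus>\<^bsub>op_algebra (weight p n)\<^esub> E \<otimes>\<^bsub>op_algebra (weight p n)\<^esub> F"
    by (auto simp: op_algebra_def fun_eq_iff diff_ops_def diff_op_add)
qed (auto simp: op_algebra_def fun_eq_iff)

section \<open>The second order operators\<close>

abbreviation (input) cx :: "real \<Rightarrow> complex" where "cx \<equiv> complex_of_real"

definition op2 :: "mpoly2 \<Rightarrow> mpoly2 \<Rightarrow> mpoly2 \<Rightarrow> mat_op" where
  "op2 F2 F1 F0 = diff_op 2 (\<lambda>i. if i = 0 then F0 else if i = 1 then F1 else F2)"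

lemma op2_apply: "op2 F2 F1 F0 P = mpoly_deriv (mpoly_deriv P) ** F2 + mpoly_deriv P ** F1 + P ** F0"
  by (simp add: op2_def diff_op_def numeral_2_eq_2 add_ac)

text \<open>The operators of order at most two in the algebra are spanned by the identity and \<open>D1\<close>, \<open>D2\<close>, \<open>D3\<close>, \<open>D4\<close>.
  This basis is chosen such that each eigenvalue has a single nonzero entry.\<close>

definition D1 :: mat_op where
  "D1 = op2 (vector [vector [[:0, 0, 1:], [:0, 1:]], vector [[:0, -1:], [:-1:]]])
    (vector [vector [[:0, cx (n + 2):], [:cx (n - p + 2):]], vector [[:- cx p:], 0]])
    (vector [vector [[:cx (p * (n - p + 1)):], 0], vector [0, 0]])"

definition D2 :: mat_op where
  "D2 = op2 (vector [vector [[:-1:], [:0, -1:]], vector [[:0, 1:], [:0, 0, 1:]]])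
    (vector [vector [0, [:- cx (n - p):]], vector [[:cx (p + 2):], [:0, cx (n + 2):]]])
    (vector [vector [0, 0], vector [0, [:cx ((p + 1) * (n - p)):]]])"

definition D3 :: mat_op where
  "D3 = op2 (vector [vector [[:0, -1:], [:-1:]], vector [[:0, 0, 1:], [:0, 1:]]])
    (vector [vector [[:- cx p:], 0], vector [[:0, cx (2 * (p + 1)):], [:cx (p + 2):]]])
    (vector [vector [0, 0], vector [[:cx (p * (p + 1)):], 0]])"

definition D4 :: mat_op where
  "D4 = op2 (vector [vector [[:0, 1:], [:0, 0, 1:]], vector [[:-1:], [:0, -1:]]])
    (vector [vector [[:cx (n - p + 2):], [:0, cx (2 * (n - p + 1)):]], vector [0, [:- cx (n - p):]]])
    (vector [vector [0, [:cx ((n - p) * (n - p + 1)):]], vector [0, 0]])"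

lemma op2_degree:
  assumes "deg_less 3 F2" "deg_less 2 F1" "deg_less 1 F0" "deg_less w P"
  shows "deg_less w (op2 F2 F1 F0 P)"
  unfolding op2_def using assms
  by (intro diff_op_degree) (auto simp: numeral_2_eq_2 numeral_3_eq_3 le_Suc_eq)

lemma op2_leading:
  assumes "deg_less 3 F2" "deg_less 2 F1" "deg_less 1 F0"
  shows "eigenvalue (op2 F2 F1 F0) w = mat (of_nat w * (of_nat w - 1)) ** mpoly_coeff F2 2
    + mat (of_nat w) ** mpoly_coeff F1 1 + mpoly_coeff F0 0"
proof -
  have "mpoly_coeff (Q w) w = mat 1" using monic_Q[of w] by (simp add: monic_of_degree_def)
  moreover have "deg_less (Suc w) (Q w)" by (rule monic_deg_less[OF monic_Q])
  moreover have "deg_less (Suc i) (if i = 0 then F0 else if i = 1 then F1 else F2)" if "i \<le> 2" for i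
    using that assms by (auto simp: numeral_2_eq_2 numeral_3_eq_3 le_Suc_eq)
  ultimately show ?thesis
    using diff_op_leading[of 2 "\<lambda>i. if i = 0 then F0 else if i = 1 then F1 else F2" w "Q w"]
    unfolding op2_def eigenvalue_def
    by (auto simp: numeral_2_eq_2 numeral_3_eq_3 le_Suc_eq ffact_poly_simps add_ac mult.commute)
qed

lemma deg_lessI:
  assumes "degree (P $ 1 $ 1) < w" "degree (P $ 1 $ 2) < w" "degree (P $ 2 $ 1) < w" "degree (P $ 2 $ 2) < w"
  shows "deg_less w P"
  unfolding deg_less_def mpoly_coeff_def using assms
  by (auto simp: mat2_simps intro!: coeff_eq_0 intro: less_le_trans)

lemma D_degree:
  assumes "deg_less w P"
  shows "deg_less w (D1 P)" "deg_less w (D2 P)" "deg_less w (D3 P)" "deg_less w (D4 P)"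
  unfolding atomize_conj D1_def D2_def D3_def D4_def
  by (intro conjI op2_degree[OF _ _ _ assms] deg_lessI; simp)

definition matrix_unit :: "2 \<Rightarrow> 2 \<Rightarrow> complex \<Rightarrow> mat2" where
  "matrix_unit i j c = (\<chi> k l. if k = i \<and> l = j then c else 0)"

lemma D_leading:
  "eigenvalue D1 w = matrix_unit 1 1 ((of_nat w + cx p) * (of_nat w + cx (n - p) + 1))"
  "eigenvalue D2 w = matrix_unit 2 2 ((of_nat w + cx p + 1) * (of_nat w + cx (n - p)))"
  "eigenvalue D3 w = matrix_unit 2 1 ((of_nat w + cx p) * (of_nat w + cx p + 1))"
  "eigenvalue D4 w = matrix_unit 1 2 ((of_nat w + cx (n - p)) * (of_nat w + cx (n - p) + 1))"
  unfolding atomize_conj D1_def D2_def D3_def D4_def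
  by (intro conjI; subst op2_leading; (rule deg_lessI; simp)?)
    (simp_all add: vec_eq_iff forall_2 matrix_unit_def mpoly_coeff_def coeff_pCons numeral_2_eq_2 algebra_simps)

text \<open>Polynomials of the form (1 - x^2) f' - n x f integrate to zero against the Gegenbauer
  weight, so adjointness becomes a polynomial identity with the concomitant f as witness.\<close>

lemma form_entry_eqI:
  assumes "\<And>i j. \<exists>f. [:d:] * (P ** weight_poly ** adj R) $ i $ j - [:c:] * (P' ** weight_poly ** adj R') $ i $ j
      = [:1, 0, -1:] * pderiv f - [:0, of_real n:] * f"
  shows "mat d ** form P R = mat c ** form P' R'"
proof -
  have "L ([:d:] * (P ** weight_poly ** adj R) $ i $ j - [:c:] * (P' ** weight_poly ** adj R') $ i $ j) = 0" for i j
    using assms[of i j] functional_deriv[OF n_pos] by metis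
  then show ?thesis by (simp add: vec_eq_iff form_def functional_linear)
qed

lemma map_poly_cnj_pderiv: "map_poly cnj (pderiv f) = pderiv (map_poly cnj f)"
  by (auto intro!: poly_eqI simp: coeff_map_poly coeff_pderiv)

lemma map_poly_cnj_minus: "map_poly cnj (- f) = - map_poly cnj f"
  by (auto intro!: poly_eqI simp: coeff_map_poly)

text \<open>Below, the integrands of the two sides differ by the derivative of a bilinear concomitant. For
  an operator with leading coefficient \<open>F2\<close> it is \<open>P' K R\<^sup>* - P K (R')\<^sup>* + P C R\<^sup>*\<close>, where
  \<open>F2 W = (1 - x\<^sup>2) K\<close> and \<open>F1 W + n x K - (1 - x\<^sup>2) K' = (1 - x\<^sup>2) C\<close>.\<close>

definition X :: "complex poly" where "X = [:0, 1:]"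
definition A :: "complex poly" where "A = [:cx p:]"
definition B :: "complex poly" where "B = [:cx (n - p):]"

lemma pderiv_XAB: "pderiv X = 1" "pderiv A = 0" "pderiv B = 0"
  by (simp_all add: X_def A_def B_def pderiv_pCons)

lemma cnj_XAB: "map_poly cnj X = X" "map_poly cnj A = A" "map_poly cnj B = B"
  "map_poly cnj 1 = (1 :: complex poly)" "map_poly cnj 2 = (2 :: complex poly)" "map_poly cnj 0 = (0 :: complex poly)"
  by (simp_all add: X_def A_def B_def map_poly_pCons numeral_poly)

lemma weight_XAB: "weight_poly $ 1 $ 1 = B + A * X * X" "weight_poly $ 1 $ 2 = - (A + B) * X"
  "weight_poly $ 2 $ 1 = - (A + B) * X" "weight_poly $ 2 $ 2 = A + B * X * X"
  by (simp_all add: weight_poly_entries X_def A_def B_def)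

lemma concomitant_XAB: "[:1, 0, -1:] = 1 - X * X" "[:0, of_real n:] = (A + B) * X"
  by (simp_all add: X_def A_def B_def one_pCons)

lemma D_entries:
  "D1 P $ i $ 1 = pderiv (pderiv (P $ i $ 1)) * X * X - pderiv (pderiv (P $ i $ 2)) * X
    + pderiv (P $ i $ 1) * (A + B + 2) * X - pderiv (P $ i $ 2) * A + P $ i $ 1 * A * (B + 1)"
  "D1 P $ i $ 2 = pderiv (pderiv (P $ i $ 1)) * X - pderiv (pderiv (P $ i $ 2))
    + pderiv (P $ i $ 1) * (B + 2)"
  "D2 P $ i $ 1 = - pderiv (pderiv (P $ i $ 1)) + pderiv (pderiv (P $ i $ 2)) * X
    + pderiv (P $ i $ 2) * (A + 2)"
  "D2 P $ i $ 2 = - pderiv (pderiv (P $ i $ 1)) * X + pderiv (pderiv (P $ i $ 2)) * X * X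
    - pderiv (P $ i $ 1) * B + pderiv (P $ i $ 2) * (A + B + 2) * X + P $ i $ 2 * (A + 1) * B"
  "D3 P $ i $ 1 = - pderiv (pderiv (P $ i $ 1)) * X + pderiv (pderiv (P $ i $ 2)) * X * X
    - pderiv (P $ i $ 1) * A + pderiv (P $ i $ 2) * 2 * (A + 1) * X + P $ i $ 2 * A * (A + 1)"
  "D3 P $ i $ 2 = - pderiv (pderiv (P $ i $ 1)) + pderiv (pderiv (P $ i $ 2)) * X
    + pderiv (P $ i $ 2) * (A + 2)"
  "D4 P $ i $ 1 = pderiv (pderiv (P $ i $ 1)) * X - pderiv (pderiv (P $ i $ 2))
    + pderiv (P $ i $ 1) * (B + 2)"
  "D4 P $ i $ 2 = pderiv (pderiv (P $ i $ 1)) * X * X - pderiv (pderiv (P $ i $ 2)) * X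
    + pderiv (P $ i $ 1) * 2 * (B + 1) * X - pderiv (P $ i $ 2) * B + P $ i $ 1 * B * (B + 1)"
  by (simp_all add: D1_def D2_def D3_def D4_def op2_apply mpoly_deriv_def matrix_matrix_mult_def sum_2
    X_def A_def B_def numeral_poly one_pCons algebra_simps)
    (simp_all flip: smult_add_left)

lemmas concomitant_simps = matrix_matrix_mult_def sum_2 adj_def weight_XAB D_entries
  map_poly_cnj_add map_poly_cnj_mult map_poly_cnj_diff map_poly_cnj_minus map_poly_cnj_pderiv cnj_XAB
  pderiv_mult pderiv_add pderiv_diff pderiv_minus pderiv_XAB

lemma adjoint_D1: "mat 1 ** form (D1 P) R = mat 1 ** form P (D1 R)"
proof (rule form_entry_eqI, rule exI)
  fix i j
  define f1 f2 where "f1 = P $ i $ 1" and "f2 = P $ i $ 2"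
  define g1 g2 where "g1 = map_poly cnj (R $ j $ 1)" and "g2 = map_poly cnj (R $ j $ 2)"
  note fg = f1_def[symmetric] f2_def[symmetric] g1_def[symmetric] g2_def[symmetric]
  \<comment> \<open>Here K = - p b b^T with b = (x, -1), and C is p (n - p + 1) times the matrix
    with rows (0, 1) and (-1, 0).\<close>
  let ?f = "A * ((- X * X * pderiv f1 * g1 + X * pderiv f1 * g2 + X * pderiv f2 * g1 - pderiv f2 * g2)
      - (- X * X * f1 * pderiv g1 + X * f1 * pderiv g2 + X * f2 * pderiv g1 - f2 * pderiv g2)
      + (B + 1) * (f1 * g2 - f2 * g1))"
  show "[:1:] * (D1 P ** weight_poly ** adj R) $ i $ j - [:1:] * (P ** weight_poly ** adj (D1 R)) $ i $ j
    = [:1, 0, -1:] * pderiv ?f - [:0, of_real n:] * ?f"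
    unfolding concomitant_XAB
    by (simp add: concomitant_simps fg del: mult_pCons_left mult_pCons_right) (simp add: algebra_simps)
qed

lemma adjoint_D2: "mat 1 ** form (D2 P) R = mat 1 ** form P (D2 R)"
proof (rule form_entry_eqI, rule exI)
  fix i j
  define f1 f2 where "f1 = P $ i $ 1" and "f2 = P $ i $ 2"
  define g1 g2 where "g1 = map_poly cnj (R $ j $ 1)" and "g2 = map_poly cnj (R $ j $ 2)"
  note fg = f1_def[symmetric] f2_def[symmetric] g1_def[symmetric] g2_def[symmetric]
  \<comment> \<open>Here K = - (n - p) a a^T with a = (1, -x), and C is - (n - p) (p + 1) times the
    matrix with rows (0, 1) and (-1, 0).\<close>
  let ?f = "B * ((- pderiv f1 * g1 + X * pderiv f1 * g2 + X * pderiv f2 * g1 - X * X * pderiv f2 * g2)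
      - (- f1 * pderiv g1 + X * f1 * pderiv g2 + X * f2 * pderiv g1 - X * X * f2 * pderiv g2)
      - (A + 1) * (f1 * g2 - f2 * g1))"
  show "[:1:] * (D2 P ** weight_poly ** adj R) $ i $ j - [:1:] * (P ** weight_poly ** adj (D2 R)) $ i $ j
    = [:1, 0, -1:] * pderiv ?f - [:0, of_real n:] * ?f"
    unfolding concomitant_XAB
    by (simp add: concomitant_simps fg del: mult_pCons_left mult_pCons_right) (simp add: algebra_simps)
qed

text \<open>The matrix K of \<open>D3\<close> is p a b^T and that of \<open>D4\<close> is (n - p) b
  a^T. They become transposes of each other after scaling by n - p and p, which explains the two
  factors.\<close>

lemma adjoint_D3: "mat (cx (n - p)) ** form (D3 P) R = mat (cx p) ** form P (D4 R)"
proof (rule form_entry_eqI, rule exI)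
  fix i j
  define f1 f2 where "f1 = P $ i $ 1" and "f2 = P $ i $ 2"
  define g1 g2 where "g1 = map_poly cnj (R $ j $ 1)" and "g2 = map_poly cnj (R $ j $ 2)"
  note fg = f1_def[symmetric] f2_def[symmetric] g1_def[symmetric] g2_def[symmetric]
  let ?f = "A * B * ((X * pderiv f1 * g1 - pderiv f1 * g2 - X * X * pderiv f2 * g1 + X * pderiv f2 * g2)
      - (X * f1 * pderiv g1 - f1 * pderiv g2 - X * X * f2 * pderiv g1 + X * f2 * pderiv g2)
      - (B + 1) * f1 * g1 + (B - A) * X * f2 * g1 + (A + 1) * f2 * g2)"
  show "[:cx (n - p):] * (D3 P ** weight_poly ** adj R) $ i $ j
      - [:cx p:] * (P ** weight_poly ** adj (D4 R)) $ i $ j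
    = [:1, 0, -1:] * pderiv ?f - [:0, of_real n:] * ?f"
    unfolding concomitant_XAB A_def[symmetric] B_def[symmetric]
    by (simp add: concomitant_simps fg del: mult_pCons_left mult_pCons_right) (simp add: algebra_simps)
qed

text \<open>The Hermitian symmetry of the form exchanges the arguments in the identity for
  \<open>D3\<close>, and the factors are real.\<close>

lemma adjoint_D4: "mat (cx p) ** form (D4 P) R = mat (cx (n - p)) ** form P (D3 R)"
proof -
  have h: "form P' R' $ i $ j = cnj (form R' P' $ j $ i)" for P' R' i j
    by (subst form_hermitian) (simp add: conj_transpose_def)
  have "cx p * form (D4 P) R $ i $ j = cx (n - p) * form P (D3 R) $ i $ j" for i j
  proof -
    have "cx (n - p) * form (D3 R) P $ j $ i = cx p * form R (D4 P) $ j $ i"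
      using adjoint_D3[of R P] by (simp only: vec_eq_iff mat_mult_entry)
    then have "cnj (cx (n - p) * form (D3 R) P $ j $ i) = cnj (cx p * form R (D4 P) $ j $ i)" by (simp only:)
    then show ?thesis
      unfolding complex_cnj_mult complex_cnj_complex_of_real h[symmetric] by (rule sym)
  qed
  then show ?thesis by (simp only: vec_eq_iff mat_mult_entry) blast
qed

lemma D_in_diff_ops: "D1 \<in> diff_ops 2" "D2 \<in> diff_ops 2" "D3 \<in> diff_ops 2" "D4 \<in> diff_ops 2"
  by (auto simp: D1_def D2_def D3_def D4_def op2_def diff_ops_def)

lemma D_in_W_ops: "D1 \<in> W_ops" "D2 \<in> W_ops" "D3 \<in> W_ops" "D4 \<in> W_ops"
proof -
  note deg = D_degree[OF monic_deg_less[OF monic_Q]]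
  show "D1 \<in> W_ops"
    by (rule W_opsI[OF D_in_diff_ops(1)], rule adjoint_eigen[OF D_degree(1) adjoint_D1 _ deg(1)]) simp_all
  show "D2 \<in> W_ops"
    by (rule W_opsI[OF D_in_diff_ops(2)], rule adjoint_eigen[OF D_degree(2) adjoint_D2 _ deg(2)]) simp_all
  show "D3 \<in> W_ops"
    by (rule W_opsI[OF D_in_diff_ops(3)], rule adjoint_eigen[OF D_degree(4) adjoint_D3 _ deg(3)])
      (use p_less p_pos in simp_all)
  show "D4 \<in> W_ops"
    by (rule W_opsI[OF D_in_diff_ops(4)], rule adjoint_eigen[OF D_degree(3) adjoint_D4 _ deg(4)])
      (use p_pos in simp_all)
qed

end


lemma poly_eq_on_inj:
  fixes x :: "nat \<Rightarrow> complex"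
  assumes "inj x" "\<And>w. poly f (x w) = poly g (x w)"
  shows "f = g"
proof -
  have "range x \<subseteq> {z. poly (f - g) z = 0}" using assms(2) by auto
  moreover have "infinite (range x)" by (rule range_inj_infinite) (rule assms(1))
  ultimately have "f - g = 0" using poly_roots_finite finite_subset by blast
  then show ?thesis by simp
qed

lemmas poly_eq_on_nat = poly_eq_on_inj[of "of_nat", OF inj_of_nat]

section \<open>The symbol equation\<close>

text \<open>A nonzero solution has degree \<open>s\<close>, by its leading coefficients, and vanishes at \<open>1\<close> to the
  order \<open>s / 2 + j\<close>.\<close>

lemma symbol_ode_zero:
  fixes u :: "complex poly"
  assumes ode: "[:-1, 0, 1:] * pderiv u = [:2 * of_int j, of_nat s:] * u"
    and "odd s \<or> coeff u s = 0"
  shows "u = 0"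
proof (rule ccontr)
  assume u: "u \<noteq> 0"
  let ?d = "degree u"
  have "coeff ([:-1, 0, 1:] * pderiv u) (Suc ?d) = of_nat ?d * coeff u ?d"
    by (cases ?d) (simp_all add: coeff_pderiv coeff_eq_0)
  moreover have "coeff ([:2 * of_int j, of_nat s:] * u) (Suc ?d) = of_nat s * coeff u ?d"
    by (simp add: coeff_eq_0)
  ultimately have "of_nat ?d * coeff u ?d = of_nat s * coeff u ?d" unfolding ode by (simp only:)
  then have "s = ?d" using u by simp
  then have odd: "odd s" using assms(2) u by auto
  obtain v where v: "u = [:-1, 1:] ^ Polynomial.order 1 u * v" "\<not> [:-1, 1:] dvd v"
    using order_decomp[OF u, of 1] by auto
  define k where "k = Polynomial.order 1 u"
  define l :: "complex poly" where "l = [:-1, 1:]"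
  have dl: "pderiv l = 1" by (simp add: l_def pderiv_pCons)
  have lk: "l * pderiv (l ^ k) = of_nat k * l ^ k"
    by (cases k) (simp_all add: pderiv_power_Suc dl of_nat_poly del: of_nat_Suc power_Suc, simp)
  define m r :: "complex poly" where "m = [:1, 1:]" and "r = [:2 * of_int j, of_nat s:]"
  have q: "[:-1, 0, 1:] = m * l" by (simp add: l_def m_def)
  have u': "u = l ^ k * v" using v(1) by (simp add: l_def k_def)
  have "[:-1, 0, 1:] * pderiv u = m * (l * pderiv (l ^ k) * v + l * l ^ k * pderiv v)"
    unfolding q u' pderiv_mult by (simp add: algebra_simps)
  also have "\<dots> = l ^ k * (m * (of_nat k * v + l * pderiv v))"
    unfolding lk by (simp add: algebra_simps)
  finally have "l ^ k * (m * (of_nat k * v + l * pderiv v)) = r * u"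
    unfolding ode r_def ..
  then have "l ^ k * (m * (of_nat k * v + l * pderiv v)) = l ^ k * (r * v)"
    unfolding u' by (simp only: mult.left_commute)
  moreover have "l ^ k \<noteq> 0" by (simp add: l_def)
  ultimately have "m * (of_nat k * v + l * pderiv v) = r * v" by (simp only: mult_cancel_left) simp
  then have "poly (m * (of_nat k * v + l * pderiv v)) 1 = poly (r * v) 1" by simp
  then have "complex_of_int (2 * int k) * poly v 1 = of_int (2 * j + int s) * poly v 1"
    by (simp add: l_def m_def r_def algebra_simps)
  moreover have "poly v 1 \<noteq> 0" using v(2) by (simp add: poly_eq_0_iff_dvd)
  ultimately have "complex_of_int (2 * int k) = of_int (2 * j + int s)"
    by (simp only: mult_cancel_right) simp
  then have "2 * int k = 2 * j + int s" by (simp only: of_int_eq_iff)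
  then show False using odd by presburger
qed

text \<open>The constant part of the first order coefficient of \<open>D0\<close>. Its commutator
  with F is the only term of the symbol equation that mixes the entries of F.\<close>

definition swap :: mat2 where "swap = vector [vector [0, 2], vector [2, 0]]"

lemma mpoly_const_swap:
  "(mpoly_const swap ** F) $ 1 $ j = 2 * F $ 2 $ j" "(mpoly_const swap ** F) $ 2 $ j = 2 * F $ 1 $ j"
  "(F ** mpoly_const swap) $ i $ 1 = 2 * F $ i $ 2" "(F ** mpoly_const swap) $ i $ 2 = 2 * F $ i $ 1"
  by (simp_all add: swap_def mpoly_const_def matrix_matrix_mult_def sum_2 numeral_poly)

text \<open>For F with rows (a, b) and (c, d), the combinations a + d, b + c, (a - d) + (b - c) and
  (a - d) - (b - c) diagonalize the commutator with \<open>swap\<close>. The system splits into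
  scalar equations with j = 0, 0, -1, 1.\<close>

lemma symbol_eq_zero:
  assumes eq: "mat (2 * [:0, of_nat s:]) ** F + mpoly_const swap ** F - F ** mpoly_const swap
      - mat (2 * [:-1, 0, 1:]) ** mpoly_deriv F = 0"
    and "odd s \<or> mpoly_coeff F s = 0"
  shows "F = 0"
proof -
  define a b c d where "a = F $ 1 $ 1" and "b = F $ 1 $ 2" and "c = F $ 2 $ 1" and "d = F $ 2 $ 2"
  note abcd = a_def b_def c_def d_def
  define q x :: "complex poly" where "q = [:-1, 0, 1:]" and "x = [:0, of_nat s:]"
  have two: "2 * f = 0 \<longleftrightarrow> f = 0" for f :: "complex poly" by simp
  have "2 * (x * a + (c - b) - q * pderiv a) = 0" "2 * (x * b + (d - a) - q * pderiv b) = 0"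
    "2 * (x * c + (a - d) - q * pderiv c) = 0" "2 * (x * d + (b - c) - q * pderiv d) = 0"
    using eq unfolding q_def[symmetric] x_def[symmetric]
    by (simp_all only: vec_eq_iff forall_2 vector_add_component vector_minus_component mat_mult_entry
      mpoly_const_swap abcd mpoly_deriv_def vec_lambda_beta zero_index)
      (simp_all add: algebra_simps)
  then have e: "x * a + (c - b) - q * pderiv a = 0" "x * b + (d - a) - q * pderiv b = 0"
    "x * c + (a - d) - q * pderiv c = 0" "x * d + (b - c) - q * pderiv d = 0"
    unfolding two by blast+
  have f: "[:2 * of_int j, of_nat s:] = x + of_int (2 * j)" for j
    by (simp add: x_def of_int_poly)
  have co: "odd s \<or> coeff a s = 0" "odd s \<or> coeff b s = 0" "odd s \<or> coeff c s = 0" "odd s \<or> coeff d s = 0"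
    using assms(2) by (auto simp: mpoly_coeff_def mat2_simps abcd)
  have e': "q * pderiv a = x * a + (c - b)" "q * pderiv b = x * b + (d - a)"
    "q * pderiv c = x * c + (a - d)" "q * pderiv d = x * d + (b - c)"
    using e by simp_all
  have "[:-1, 0, 1:] * pderiv (a + d) = [:2 * of_int 0, of_nat s:] * (a + d)"
    "[:-1, 0, 1:] * pderiv (b + c) = [:2 * of_int 0, of_nat s:] * (b + c)"
    "[:-1, 0, 1:] * pderiv ((a - d) + (b - c)) = [:2 * of_int (-1), of_nat s:] * ((a - d) + (b - c))"
    "[:-1, 0, 1:] * pderiv ((a - d) - (b - c)) = [:2 * of_int 1, of_nat s:] * ((a - d) - (b - c))"
    unfolding f q_def[symmetric] pderiv_add pderiv_diff distrib_left right_diff_distrib e'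
    by (simp_all add: algebra_simps)
  moreover have "odd s \<or> coeff (a + d) s = 0" "odd s \<or> coeff (b + c) s = 0"
    "odd s \<or> coeff ((a - d) + (b - c)) s = 0" "odd s \<or> coeff ((a - d) - (b - c)) s = 0"
    using co by auto
  ultimately have "a + d = 0" "b + c = 0" "(a - d) + (b - c) = 0" "(a - d) - (b - c) = 0"
    by (blast intro: symbol_ode_zero)+
  then have "a = - d" "b = - c" "b - c = - (a - d)" "a - d = b - c"
    by (simp_all add: eq_neg_iff_add_eq_0 add.commute)
  then have "2 * (a - d) = 0" by simp
  then have "a - d = 0" unfolding two .
  then have "b - c = 0" using \<open>a - d = b - c\<close> by simp
  have "2 * d = 0" "2 * c = 0"
    using \<open>a = - d\<close> \<open>b = - c\<close> \<open>a - d = 0\<close> \<open>b - c = 0\<close> by simp_all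
  then have "d = 0" "c = 0" unfolding two by blast+
  then have "a = 0 \<and> b = 0 \<and> c = 0 \<and> d = 0"
    using \<open>a = - d\<close> \<open>b = - c\<close> by simp
  then show ?thesis by (simp add: mat2_simps abcd)
qed

section \<open>The commutator with the operator of scalar leading coefficient\<close>

context gegenbauer_weight
begin

definition D0 :: mat_op where "D0 = (\<lambda>P. D1 P + D2 P)"

definition \<alpha>1 :: complex where "\<alpha>1 = cx (p * (n - p + 1))"
definition \<alpha>2 :: complex where "\<alpha>2 = cx ((p + 1) * (n - p))"

lemma D0_apply:
  "D0 P = mat [:-1, 0, 1:] ** mpoly_deriv (mpoly_deriv P) + mat [:0, cx (n + 2):] ** mpoly_deriv P
    + mpoly_deriv P ** mpoly_const swap + P ** mpoly_const (matrix_unit 1 1 \<alpha>1 + matrix_unit 2 2 \<alpha>2)"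
proof -
  have C: "(P ** mpoly_const (matrix_unit 1 1 \<alpha>1 + matrix_unit 2 2 \<alpha>2)) $ i $ 1 = A * (B + 1) * P $ i $ 1"
    "(P ** mpoly_const (matrix_unit 1 1 \<alpha>1 + matrix_unit 2 2 \<alpha>2)) $ i $ 2 = (A + 1) * B * P $ i $ 2" for i
    by (simp_all add: matrix_matrix_mult_def sum_2 mpoly_const_def matrix_unit_def \<alpha>1_def \<alpha>2_def A_def B_def
      one_pCons mult.commute)
  have X: "[:-1, 0, 1:] = X * X - 1" "[:0, cx (n + 2):] = (A + B + 2) * X"
    by (simp_all add: X_def A_def B_def one_pCons numeral_poly)
  show ?thesis
    unfolding X
    by (simp only: vec_eq_iff forall_2 vector_add_component mat_mult_entry mpoly_const_swap C D0_def D_entries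
      mpoly_deriv_def vec_lambda_beta)
      (simp add: algebra_simps)
qed

text \<open>By the Leibniz rule x^2 - 1 contributes 2 i x and i (i - 1), and (n + 2) x contributes i
  (n + 2).\<close>

lemma D0_iter:
  "(mpoly_deriv ^^ i) (D0 P) = mat [:-1, 0, 1:] ** (mpoly_deriv ^^ (i + 2)) P
    + mat [:0, of_nat (2 * i) + cx (n + 2):] ** (mpoly_deriv ^^ (i + 1)) P
    + mat [:of_nat i * (of_nat i - 1) + of_nat i * cx (n + 2):] ** (mpoly_deriv ^^ i) P
    + (mpoly_deriv ^^ (i + 1)) P ** mpoly_const swap
    + (mpoly_deriv ^^ i) P ** mpoly_const (matrix_unit 1 1 \<alpha>1 + matrix_unit 2 2 \<alpha>2)"
proof (induction i)
  case 0
  then show ?case by (simp add: D0_apply numeral_2_eq_2) 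
next
  case (Suc i)
  have "(mpoly_deriv ^^ Suc i) (D0 P) = mpoly_deriv ((mpoly_deriv ^^ i) (D0 P))" by simp
  also note Suc
  finally show ?case
    by (simp add: mpoly_deriv_mult mpoly_deriv_mat pderiv_pCons del: mpoly_const_simps)
      (simp add: vec_eq_iff fun_eq_iff algebra_simps flip: poly_eq_poly_eq_iff)
qed

text \<open>The equation for the coefficient of order \<open>s + 1\<close> of a commutator with \<open>D0\<close> that has order at
  most \<open>s\<close>; the coefficient of order \<open>s + 2\<close> vanishes since that of \<open>D0\<close> is scalar.\<close>

lemma commutator_symbol:
  assumes comm: "\<And>P. diff_op s F (D0 P) = D0 (diff_op s F P) + mat [:c:] ** diff_op s F P"
  shows "mat (2 * [:0, of_nat s:]) ** F s + mpoly_const swap ** F s - F s ** mpoly_const swap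
      - mat (2 * [:-1, 0, 1:]) ** mpoly_deriv (F s) = 0"
proof -
  let ?C = "mpoly_const (matrix_unit 1 1 \<alpha>1 + matrix_unit 2 2 \<alpha>2)"
  \<comment> \<open>For a single term P^(i) F_i the two sides of \<open>comm\<close> differ by
    P^(i+1) U_i + P^(i) V_i, so in the sum over i \<le> s the coefficient of order s + 1 is U_s
    alone.\<close>
  define U where "U i = mat (2 * [:0, of_nat i:]) ** F i + mpoly_const swap ** F i - F i ** mpoly_const swap
      - mat (2 * [:-1, 0, 1:]) ** mpoly_deriv (F i)" for i
  define V where "V i = mat [:of_nat i * (of_nat i - 1) + of_nat i * cx (n + 2):] ** F i + ?C ** F i
      - mat [:-1, 0, 1:] ** mpoly_deriv (mpoly_deriv (F i)) - mat [:0, cx (n + 2):] ** mpoly_deriv (F i)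
      - mpoly_deriv (F i) ** mpoly_const swap - F i ** ?C - mat [:c:] ** F i" for i
  have D0_sum: "D0 (\<Sum>i\<in>I. f i) = (\<Sum>i\<in>I. D0 (f i))" for I :: "nat set" and f
    unfolding D0_def by (rule diff_ops_sum_arg[OF diff_ops_add[OF D_in_diff_ops(1,2)]])
  have "diff_op (Suc s) (\<lambda>i. (if i = 0 then 0 else U (i - 1)) + (if i \<le> s then V i else 0)) P = 0" for P
  proof -
    have step: "(mpoly_deriv ^^ i) (D0 P) ** F i - D0 ((mpoly_deriv ^^ i) P ** F i) - mat [:c:] ** ((mpoly_deriv ^^ i) P ** F i)
      = (mpoly_deriv ^^ (i + 1)) P ** U i + (mpoly_deriv ^^ i) P ** V i" for i
    proof -
      define R R' R'' where "R = (mpoly_deriv ^^ i) P" and "R' = (mpoly_deriv ^^ (i + 1)) P" and "R'' = (mpoly_deriv ^^ (i + 2)) P"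
      define G G' G'' where "G = F i" and "G' = mpoly_deriv G" and "G'' = mpoly_deriv G'"
      define S K where "S = mpoly_const swap" and "K = ?C"
      have d: "mpoly_deriv R = R'" "mpoly_deriv R' = R''" by (simp_all add: R_def R'_def R''_def)
      show ?thesis
        unfolding D0_iter
        unfolding R_def[symmetric] R'_def[symmetric] R''_def[symmetric] D0_apply U_def V_def
          G_def[symmetric] S_def[symmetric] K_def[symmetric] mpoly_deriv_mult mpoly_deriv_simps d
          G'_def[symmetric] G''_def[symmetric]
        by (simp only: matrix_add_ldistrib matrix_add_rdistrib matrix_diff_ldistrib matrix_diff_rdistrib
          mat_mult_assoc_left mult_mat_assoc matrix_mul_assoc[symmetric])
          (simp add: vec_eq_iff fun_eq_iff algebra_simps flip: poly_eq_poly_eq_iff)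
    qed
    have "0 = diff_op s F (D0 P) - D0 (diff_op s F P) - mat [:c:] ** diff_op s F P"
      using comm[of P] by simp
    also have "\<dots> = (\<Sum>i\<le>s. (mpoly_deriv ^^ i) (D0 P) ** F i - D0 ((mpoly_deriv ^^ i) P ** F i)
        - mat [:c:] ** ((mpoly_deriv ^^ i) P ** F i))"
      by (simp add: diff_op_def D0_sum sum_subtractf matrix_mult_sum_right)
    also have "\<dots> = (\<Sum>i\<le>s. (mpoly_deriv ^^ Suc i) P ** U i) + (\<Sum>i\<le>s. (mpoly_deriv ^^ i) P ** V i)"
      unfolding step by (simp add: sum.distrib)
    also have "(\<Sum>i\<le>s. (mpoly_deriv ^^ Suc i) P ** U i) = (\<Sum>i\<le>Suc s. (mpoly_deriv ^^ i) P ** (if i = 0 then 0 else U (i - 1)))"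
      by (subst sum.atMost_Suc_shift) simp
    also have "(\<Sum>i\<le>s. (mpoly_deriv ^^ i) P ** V i) = (\<Sum>i\<le>Suc s. (mpoly_deriv ^^ i) P ** (if i \<le> s then V i else 0))"
      by simp
    finally show ?thesis
      by (simp only: diff_op_def matrix_add_ldistrib sum.distrib)
  qed
  from diff_op_eq_zero_imp[OF this, of "Suc s"] have "U s = 0" by simp
  then show ?thesis by (simp only: U_def)
qed


section \<open>The eigenvalues of the algebra\<close>

lemma eigenvalue_D0: "eigenvalue D0 w = eigenvalue D1 w + eigenvalue D2 w"
  and D0_in: "D0 \<in> W_ops" "D0 \<in> diff_ops 2"
  unfolding D0_def using W_ops_add[OF D_in_W_ops(1,2)] diff_ops_add[OF D_in_diff_ops(1,2)] by auto

text \<open>Applied to Q_i, the terms of order above i vanish and those below have degree at most i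
  by induction, while the i-th derivative of Q_i is the constant i!. The eigenvalue equation then
  bounds the degree of F_i.\<close>

lemma W_ops_coeffs:
  assumes D: "diff_op s F \<in> W_ops"
  shows "i \<le> s \<Longrightarrow> deg_less (Suc i) (F i)"
    and "eigenvalue (diff_op s F) w = (\<Sum>i\<le>s. mat (poly (ffact_poly i) (of_nat w)) ** mpoly_coeff (F i) i)"
proof -
  show deg: "deg_less (Suc i) (F i)" if "i \<le> s" for i
    using that
  proof (induction i rule: less_induct)
    case (less i)
    let ?T = "\<lambda>j. (mpoly_deriv ^^ j) (Q i) ** F j"
    have Q: "deg_less (Suc i) (Q i)" by (rule monic_deg_less[OF monic_Q])
    have low: "deg_less (Suc i) (\<Sum>j<i. ?T j)"
      using less by (intro deg_less_sum diff_op_term_degree Q) auto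
    have "diff_op s F (Q i) = (\<Sum>j\<le>i. ?T j)"
      unfolding diff_op_def
    proof (rule sum.mono_neutral_right)
      show "\<forall>j\<in>{..s} - {..i}. ?T j = 0"
        using deriv_iter_eq_0[OF Q] by auto
    qed (use less.prems in auto)
    also have "\<dots> = ?T i + (\<Sum>j<i. ?T j)"
      by (simp add: lessThan_Suc_atMost[symmetric] add.commute)
    finally have "?T i = mpoly_const (eigenvalue (diff_op s F) i) ** Q i - (\<Sum>j<i. ?T j)"
      using W_ops_eigen[OF D, of i] by simp
    then have T: "deg_less (Suc i) (?T i)"
      using deg_less_diff[OF deg_less_const_mult[OF Q] low] by simp
    have "(mpoly_deriv ^^ i) (Q i) = mat [:fact i:]"
    proof (rule mpoly_eqI)
      fix k
      have "poly (ffact_poly i) (of_nat i) = (fact i :: complex)"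
        using pochhammer_ffact[of 0 i] by (simp add: pochhammer_fact)
      moreover have "mpoly_coeff (mat [:c:]) k = (if k = 0 then mat c else 0)" for c
        by (cases k) (auto simp: mpoly_coeff_def mat_def vec_eq_iff)
      ultimately show "mpoly_coeff ((mpoly_deriv ^^ i) (Q i)) k = mpoly_coeff (mat [:fact i:]) k"
        using monic_Q[of i] unfolding coeff_deriv_iter monic_of_degree_def by auto
    qed
    then have "mpoly_coeff (?T i) k = mat (fact i) ** mpoly_coeff (F i) k" for k by simp
    then show ?case using T by (auto simp: deg_less_def vec_eq_iff)
  qed
  have "mpoly_coeff (Q w) w = mat 1" using monic_Q[of w] by (simp add: monic_of_degree_def)
  then show "eigenvalue (diff_op s F) w = (\<Sum>i\<le>s. mat (poly (ffact_poly i) (of_nat w)) ** mpoly_coeff (F i) i)"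
    unfolding eigenvalue_def using diff_op_leading[of s F w "Q w"] deg monic_deg_less[OF monic_Q, of w] by simp
qed

text \<open>The bridge from eigenvalues to leading coefficients: \<open>ffact_poly i\<close> is
  monic of degree i, so only F_s contributes to w^s.\<close>

lemma W_ops_eigenvalue_poly:
  assumes D: "diff_op s F \<in> W_ops"
  obtains e where "\<And>k l w. eigenvalue (diff_op s F) w $ k $ l = poly (e k l) (of_nat w)"
    "\<And>k l. degree (e k l) \<le> s" "\<And>k l. coeff (e k l) s = mpoly_coeff (F s) s $ k $ l"
proof
  let ?e = "\<lambda>k l. \<Sum>i\<le>s. Polynomial.smult (mpoly_coeff (F i) i $ k $ l) (ffact_poly i)"
  show "eigenvalue (diff_op s F) w $ k $ l = poly (?e k l) (of_nat w)" for k l w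
    by (simp add: W_ops_coeffs(2)[OF D] poly_sum mult.commute)
  show "degree (?e k l) \<le> s" for k l
    by (rule degree_sum_le) (auto intro: order_trans[OF degree_smult_le] simp: degree_ffact_poly)
  have "coeff (?e k l) s = (\<Sum>i\<in>{s}. coeff (Polynomial.smult (mpoly_coeff (F i) i $ k $ l) (ffact_poly i)) s)" for k l
    unfolding coeff_sum
    by (rule sum.mono_neutral_right) (auto simp: coeff_eq_0 degree_ffact_poly)
  then show "coeff (?e k l) s = mpoly_coeff (F s) s $ k $ l" for k l
    by (simp add: lead_ffact_poly)
qed

text \<open>The relation \<open>comm\<close> lifts from eigenvalues to operators by injectivity and
  yields the symbol equation for the coefficient of order s + 1. If s + 1 is odd there is no nonzero
  solution; if it is even, an eigenvalue of degree below s + 1 in w forces the coefficient of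
  x^(s+1) to vanish, and this determines the solution.\<close>

lemma order_lower:
  assumes D: "D \<in> W_ops" "D \<in> diff_ops (Suc s)"
    and comm: "\<And>w. eigenvalue D0 w ** eigenvalue D w = eigenvalue D w ** eigenvalue D0 w + mat c ** eigenvalue D w"
    and top: "odd (Suc s) \<or> (\<forall>k l. \<exists>f. degree f < Suc s \<and> (\<forall>w. eigenvalue D w $ k $ l = poly f (of_nat w)))"
  shows "D \<in> diff_ops s"
proof -
  obtain F where F: "D = diff_op (Suc s) F" using D(2) by (auto simp: diff_ops_def)
  have DF: "diff_op (Suc s) F \<in> W_ops" using D(1) by (simp add: F)
  have "D \<circ> D0 = (\<lambda>P. (D0 \<circ> D) P + mat [:c:] ** D P)"
    by (rule W_ops_inj)
      (simp_all only: W_ops_comp[OF D0_in(1) D(1)] W_ops_comp[OF D(1) D0_in(1)] W_ops_scalar[OF D(1)]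
        W_ops_add[OF W_ops_comp(1)[OF D(1) D0_in(1)] W_ops_scalar(1)[OF D(1)]] comm)
  then have "diff_op (Suc s) F (D0 P) = D0 (diff_op (Suc s) F P) + mat [:c:] ** diff_op (Suc s) F P" for P
    unfolding F by (simp add: fun_eq_iff)
  note symb = commutator_symbol[OF this]
  obtain e where e: "\<And>k l w. eigenvalue (diff_op (Suc s) F) w $ k $ l = poly (e k l) (of_nat w)"
    "\<And>k l. coeff (e k l) (Suc s) = mpoly_coeff (F (Suc s)) (Suc s) $ k $ l"
    using W_ops_eigenvalue_poly[OF DF] by metis
  have "mpoly_coeff (F (Suc s)) (Suc s) = 0" if even: "even (Suc s)"
  proof -
    have "coeff (e k l) (Suc s) = 0" for k l
    proof -
      obtain f where f: "degree f < Suc s" "\<And>w. eigenvalue D w $ k $ l = poly f (of_nat w)"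
        using top even by blast
      then have "e k l = f" using e(1) unfolding F by (intro poly_eq_on_nat) metis
      then show ?thesis using f(1) by (simp add: coeff_eq_0)
    qed
    then show ?thesis using e(2) by (simp add: vec_eq_iff)
  qed
  then have "F (Suc s) = 0" using symbol_eq_zero[OF symb] by blast
  then have "D = diff_op s F" by (simp add: F diff_op_def)
  then show ?thesis by (auto simp: diff_ops_def)
qed

section \<open>Eigenvalue sequences produced by the four operators\<close>

definition t_val :: "nat \<Rightarrow> complex" where "t_val w = of_nat w * (of_nat w + cx n + 1)"
definition f3 :: "nat \<Rightarrow> complex" where "f3 w = (of_nat w + cx p) * (of_nat w + cx p + 1)"
definition f4 :: "nat \<Rightarrow> complex" where "f4 w = (of_nat w + cx (n - p)) * (of_nat w + cx (n - p) + 1)"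

lemma D_eigenvalues:
  "eigenvalue D1 w = matrix_unit 1 1 (t_val w + \<alpha>1)" "eigenvalue D2 w = matrix_unit 2 2 (t_val w + \<alpha>2)"
  "eigenvalue D3 w = matrix_unit 2 1 (f3 w)" "eigenvalue D4 w = matrix_unit 1 2 (f4 w)"
  unfolding D_leading by (simp_all add: t_val_def \<alpha>1_def \<alpha>2_def f3_def f4_def algebra_simps)

lemma f34: "f3 w * f4 w = (t_val w + \<alpha>1) * (t_val w + \<alpha>2)"
  by (simp add: t_val_def \<alpha>1_def \<alpha>2_def f3_def f4_def algebra_simps)

lemma f3_nonzero: "f3 w \<noteq> 0"
proof -
  have "f3 w = cx ((real w + p) * (real w + p + 1))" by (simp add: f3_def)
  moreover have "(real w + p) * (real w + p + 1) > 0" using p_pos by (intro mult_pos_pos) auto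
  ultimately show ?thesis by (simp only: of_real_eq_0_iff)
qed

text \<open>The nodes are -\<alpha>1 and -\<alpha>2; they would coincide for p = n/2.\<close>

lemma alpha_diff: "\<alpha>1 - \<alpha>2 = cx (2 * p - n)" "\<alpha>1 \<noteq> \<alpha>2"
proof -
  show *: "\<alpha>1 - \<alpha>2 = cx (2 * p - n)" by (simp add: \<alpha>1_def \<alpha>2_def algebra_simps)
  have "2 * p - n \<noteq> 0" using p_less by simp
  with * show "\<alpha>1 \<noteq> \<alpha>2" by (metis of_real_eq_0_iff right_minus_eq)
qed

text \<open>These turn out to be exactly the eigenvalue sequences of the algebra.\<close>

definition model :: "(nat \<Rightarrow> mat2) set" where
  "model = {\<Lambda>. \<exists>c h11 h12 h21 h22. \<forall>w. \<Lambda> w = vector [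
     vector [c + (t_val w + \<alpha>1) * poly h11 (t_val w), f4 w * poly h12 (t_val w)],
     vector [f3 w * poly h21 (t_val w), c + (t_val w + \<alpha>2) * poly h22 (t_val w)]]}"

lemma modelI:
  assumes "\<And>w. \<Lambda> w = vector [
     vector [c + (t_val w + \<alpha>1) * poly h11 (t_val w), f4 w * poly h12 (t_val w)],
     vector [f3 w * poly h21 (t_val w), c + (t_val w + \<alpha>2) * poly h22 (t_val w)]]"
  shows "\<Lambda> \<in> model"
  using assms unfolding model_def by blast

lemma model_add:
  assumes "\<Lambda> \<in> model" "\<Lambda>' \<in> model"
  shows "(\<lambda>w. \<Lambda> w + \<Lambda>' w) \<in> model"
proof -
  obtain c h11 h12 h21 h22 where 1: "\<And>w. \<Lambda> w = vector [
     vector [c + (t_val w + \<alpha>1) * poly h11 (t_val w), f4 w * poly h12 (t_val w)],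
     vector [f3 w * poly h21 (t_val w), c + (t_val w + \<alpha>2) * poly h22 (t_val w)]]"
    using assms(1) unfolding model_def by blast
  obtain d g11 g12 g21 g22 where 2: "\<And>w. \<Lambda>' w = vector [
     vector [d + (t_val w + \<alpha>1) * poly g11 (t_val w), f4 w * poly g12 (t_val w)],
     vector [f3 w * poly g21 (t_val w), d + (t_val w + \<alpha>2) * poly g22 (t_val w)]]"
    using assms(2) unfolding model_def by blast
  show ?thesis
    by (rule modelI[of _ "c + d" "h11 + g11" "h12 + g12" "h21 + g21" "h22 + g22"])
      (simp add: 1 2 vec_eq_iff forall_2 algebra_simps)
qed


lemma matrix_unit_mult: "matrix_unit i j a ** matrix_unit j l b = matrix_unit i l (a * b)"
  using exhaust_2[of j] by (auto simp: matrix_unit_def mat2_simps)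

lemma power_op:
  assumes V: "V \<in> W_ops" "V \<in> diff_ops 2" "\<And>w. eigenvalue V w = matrix_unit j j (a w)"
    and U: "U \<in> W_ops" "U \<in> diff_ops 2" "\<And>w. eigenvalue U w = matrix_unit i j (b w)"
  shows "\<exists>E\<in>W_ops \<inter> diff_ops (2 + 2 * m). \<forall>w. eigenvalue E w = matrix_unit i j (b w * a w ^ m)"
proof (induction m)
  case (Suc m)
  then obtain E where E: "E \<in> W_ops" "E \<in> diff_ops (2 + 2 * m)"
    "\<And>w. eigenvalue E w = matrix_unit i j (b w * a w ^ m)" by auto
  have "eigenvalue (V \<circ> E) w = matrix_unit i j (b w * a w ^ Suc m)" for w
    by (simp add: W_ops_comp(2)[OF E(1) V(1)] E V matrix_unit_mult mult_ac)
  moreover have "V \<circ> E \<in> W_ops \<inter> diff_ops (2 + 2 * Suc m)"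
    using W_ops_comp(1)[OF E(1) V(1)] diff_ops_comp[OF E(2) V(2)] by (simp add: add.commute)
  ultimately show ?case by blast
qed (use U in auto)

text \<open>At every positive even order the matrix of leading coefficients of the eigenvalue can be
  prescribed. Subtracting such an operator from a given one makes the order drop. Powers of
  \<open>D1\<close> multiply \<open>D1\<close> and \<open>D3\<close> on the right, powers of
  \<open>D2\<close> multiply \<open>D2\<close> and \<open>D4\<close>.\<close>

lemma model_op:
  "\<exists>E\<in>W_ops \<inter> diff_ops (2 + 2 * m). \<forall>w. eigenvalue E w = vector [
     vector [c11 * (t_val w + \<alpha>1) ^ Suc m, c12 * (f4 w * (t_val w + \<alpha>2) ^ m)],
     vector [c21 * (f3 w * (t_val w + \<alpha>1) ^ m), c22 * (t_val w + \<alpha>2) ^ Suc m]]"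
proof -
  let ?S = "W_ops \<inter> diff_ops (2 + 2 * m)"
  have scalar: "(\<lambda>P. mat [:c:] ** E P) \<in> ?S" if "E \<in> ?S" for c E
    using that W_ops_scalar(1) diff_ops_scalar by blast
  have add: "(\<lambda>P. E P + E' P) \<in> ?S" if "E \<in> ?S" "E' \<in> ?S" for E E'
    using that W_ops_add(1) diff_ops_add by blast
  note pw = power_op[OF D_in_W_ops(1) D_in_diff_ops(1) D_eigenvalues(1) D_in_W_ops(1) D_in_diff_ops(1) D_eigenvalues(1), of m]
    power_op[OF D_in_W_ops(2) D_in_diff_ops(2) D_eigenvalues(2) D_in_W_ops(4) D_in_diff_ops(4) D_eigenvalues(4), of m]
    power_op[OF D_in_W_ops(1) D_in_diff_ops(1) D_eigenvalues(1) D_in_W_ops(3) D_in_diff_ops(3) D_eigenvalues(3), of m]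
    power_op[OF D_in_W_ops(2) D_in_diff_ops(2) D_eigenvalues(2) D_in_W_ops(2) D_in_diff_ops(2) D_eigenvalues(2), of m]
  obtain E1 where E1: "E1 \<in> ?S" "\<And>w. eigenvalue E1 w = matrix_unit 1 1 ((t_val w + \<alpha>1) * (t_val w + \<alpha>1) ^ m)"
    using pw(1) by blast
  obtain E2 where E2: "E2 \<in> ?S" "\<And>w. eigenvalue E2 w = matrix_unit 1 2 (f4 w * (t_val w + \<alpha>2) ^ m)"
    using pw(2) by blast
  obtain E3 where E3: "E3 \<in> ?S" "\<And>w. eigenvalue E3 w = matrix_unit 2 1 (f3 w * (t_val w + \<alpha>1) ^ m)"
    using pw(3) by blast
  obtain E4 where E4: "E4 \<in> ?S" "\<And>w. eigenvalue E4 w = matrix_unit 2 2 ((t_val w + \<alpha>2) * (t_val w + \<alpha>2) ^ m)"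
    using pw(4) by blast
  define G1 G2 G3 G4 where "G1 = (\<lambda>P. mat [:c11:] ** E1 P)" and "G2 = (\<lambda>P. mat [:c12:] ** E2 P)"
    and "G3 = (\<lambda>P. mat [:c21:] ** E3 P)" and "G4 = (\<lambda>P. mat [:c22:] ** E4 P)"
  have G: "G1 \<in> ?S" "G2 \<in> ?S" "G3 \<in> ?S" "G4 \<in> ?S"
    using E1(1) E2(1) E3(1) E4(1) scalar by (auto simp: G1_def G2_def G3_def G4_def)
  have GV: "eigenvalue G1 w = mat c11 ** eigenvalue E1 w" "eigenvalue G2 w = mat c12 ** eigenvalue E2 w"
    "eigenvalue G3 w = mat c21 ** eigenvalue E3 w" "eigenvalue G4 w = mat c22 ** eigenvalue E4 w" for w
    using E1(1) E2(1) E3(1) E4(1) by (simp_all add: G1_def G2_def G3_def G4_def W_ops_scalar(2))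
  define H1 H2 where "H1 = (\<lambda>P. G1 P + G2 P)" and "H2 = (\<lambda>P. G3 P + G4 P)"
  have H: "H1 \<in> ?S" "H2 \<in> ?S" using G add by (auto simp: H1_def H2_def)
  have "eigenvalue (\<lambda>P. H1 P + H2 P) w = (eigenvalue G1 w + eigenvalue G2 w) + (eigenvalue G3 w + eigenvalue G4 w)" for w
    using G H by (simp add: W_ops_add(2) H1_def H2_def)
  then show ?thesis
    using add[OF H] by (intro bexI[of _ "\<lambda>P. H1 P + H2 P"])
      (auto simp: GV E1(2) E2(2) E3(2) E4(2) vec_eq_iff forall_2 matrix_unit_def)
qed

lemma monic_quadratic:
  fixes f g :: "complex poly"
  assumes "degree f = 2" "coeff f 2 = 1" "degree g = 2" "coeff g 2 = 1"
  shows "degree (g * f ^ m) = 2 + 2 * m" "coeff (g * f ^ m) (2 + 2 * m) = 1"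
proof -
  have nz: "f \<noteq> 0" "g \<noteq> 0" using assms by auto
  then show d: "degree (g * f ^ m) = 2 + 2 * m"
    using assms by (simp add: degree_mult_eq degree_power_eq)
  have "lead_coeff (g * f ^ m) = 1"
    using assms by (simp add: lead_coeff_mult lead_coeff_power)
  then show "coeff (g * f ^ m) (2 + 2 * m) = 1" by (simp only: d)
qed

text \<open>As t + \<alpha>1, t + \<alpha>2, f3 and f4 are monic quadratic polynomials in w, the
  entries before scaling are monic of degree 2 + 2 m, and C is the matrix of top
  coefficients.\<close>

lemma model_op_polys:
  "\<exists>e. \<forall>k l. degree (e k l) \<le> 2 + 2 * m \<and> coeff (e k l) (2 + 2 * m) = C $ k $ l \<and>
    (\<forall>w. (vector [
     vector [C$1$1 * (t_val w + \<alpha>1) ^ Suc m, C$1$2 * (f4 w * (t_val w + \<alpha>2) ^ m)],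
     vector [C$2$1 * (f3 w * (t_val w + \<alpha>1) ^ m), C$2$2 * (t_val w + \<alpha>2) ^ Suc m]] :: mat2) $ k $ l
     = poly (e k l) (of_nat w))"
proof -
  define a1 a2 g3 g4 :: "complex poly" where "a1 = [:\<alpha>1, cx n + 1, 1:]" and "a2 = [:\<alpha>2, cx n + 1, 1:]"
    and "g3 = [:cx p, 1:] * [:cx p + 1, 1:]" and "g4 = [:cx (n - p), 1:] * [:cx (n - p) + 1, 1:]"
  have ev: "poly a1 (of_nat w) = t_val w + \<alpha>1" "poly a2 (of_nat w) = t_val w + \<alpha>2"
    "poly g3 (of_nat w) = f3 w" "poly g4 (of_nat w) = f4 w" for w
    by (simp_all add: a1_def a2_def g3_def g4_def t_val_def f3_def f4_def algebra_simps)
  have dg: "degree a1 = 2" "coeff a1 2 = 1" "degree a2 = 2" "coeff a2 2 = 1" "degree g3 = 2" "coeff g3 2 = 1"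
    "degree g4 = 2" "coeff g4 2 = 1"
    by (simp_all add: a1_def a2_def g3_def g4_def numeral_2_eq_2)
  note mq = monic_quadratic[OF dg(1,2,1,2), of m] monic_quadratic[OF dg(3,4,3,4), of m]
    monic_quadratic[OF dg(1,2,5,6), of m] monic_quadratic[OF dg(3,4,7,8), of m]
  define e where "e = (\<lambda>(k::2) (l::2). if k = 1 then (if l = 1 then Polynomial.smult (C$1$1) (a1 * a1 ^ m) else Polynomial.smult (C$1$2) (g4 * a2 ^ m))
    else (if l = 1 then Polynomial.smult (C$2$1) (g3 * a1 ^ m) else Polynomial.smult (C$2$2) (a2 * a2 ^ m)))"
  define N where "N = 2 + 2 * m"
  show ?thesis
    unfolding N_def[symmetric]
    by (rule exI[of _ e]) (simp add: forall_2 e_def ev mq[folded N_def] degree_smult_eq)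
qed

text \<open>\<open>J\<close> lists the positions where eigenvalues may be nonzero, and
  \<open>c\<close> is the eigenvalue of the commutator with \<open>D0\<close> there. In the
  induction on the order, odd orders drop at once, even ones after subtracting an operator from
  \<open>model_op\<close> with the same top coefficients, which keeps the zeros outside
  \<open>J\<close>.\<close>

lemma pure_type_model:
  fixes J :: "(2 \<times> 2) set"
  assumes J: "\<And>k l. (k, l) \<in> J \<Longrightarrow> (if k = 1 then \<alpha>1 else \<alpha>2) - (if l = 1 then \<alpha>1 else \<alpha>2) = c"
    and J': "(1, 2) \<notin> J \<or> (2, 1) \<notin> J"
    and "D \<in> W_ops" "D \<in> diff_ops s" "\<And>w k l. (k, l) \<notin> J \<Longrightarrow> eigenvalue D w $ k $ l = 0"
  shows "eigenvalue D \<in> model"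
  using assms(3-)
proof (induction s arbitrary: D)
  have comm: "eigenvalue D0 w ** eigenvalue D w = eigenvalue D w ** eigenvalue D0 w + mat c ** eigenvalue D w"
    if D: "D \<in> W_ops" "\<And>w k l. (k, l) \<notin> J \<Longrightarrow> eigenvalue D w $ k $ l = 0" for D w
  proof -
    have "((if k = 1 then \<alpha>1 else \<alpha>2) - (if l = 1 then \<alpha>1 else \<alpha>2)) * eigenvalue D w $ k $ l = c * eigenvalue D w $ k $ l" for k l
      using D(2)[of k l w] J[of k l] by (cases "(k, l) \<in> J") auto
    from this[of 1 1] this[of 1 2] this[of 2 1] this[of 2 2] show ?thesis
      by (simp add: eigenvalue_D0 D_eigenvalues mat2_simps matrix_unit_def mat_def algebra_simps)
  qed
  {
    case 0
    then obtain F where F: "D = diff_op 0 F" by (auto simp: diff_ops_def)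
    have DF: "diff_op 0 F \<in> W_ops" using 0 F by simp
    define K where "K = mpoly_coeff (F 0) 0"
    have K: "eigenvalue D w = K" for w
      using W_ops_coeffs(2)[OF DF] unfolding F K_def by (simp add: ffact_poly_simps)
    have F0: "F 0 = mpoly_const K"
    proof (rule mpoly_eqI)
      fix k show "mpoly_coeff (F 0) k = mpoly_coeff (mpoly_const K) k"
        using W_ops_coeffs(1)[OF DF, of 0]
        by (cases k) (auto simp: deg_less_def K_def mpoly_const_def mpoly_coeff_def vec_eq_iff)
    qed
    have comm0: "eigenvalue D0 w ** eigenvalue D w = eigenvalue D w ** eigenvalue D0 w + mat c ** eigenvalue D w" for w
      by (rule comm[OF 0(1)]) (rule 0(3))
    have "D \<circ> D0 = (\<lambda>P. (D0 \<circ> D) P + mat [:c:] ** D P)"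
      by (rule W_ops_inj)
        (simp_all only: W_ops_comp[OF D0_in(1) 0(1)] W_ops_comp[OF 0(1) D0_in(1)] W_ops_scalar[OF 0(1)]
          W_ops_add[OF W_ops_comp(1)[OF 0(1) D0_in(1)] W_ops_scalar(1)[OF 0(1)]] comm0)
    then have "diff_op 0 F (D0 P) = D0 (diff_op 0 F P) + mat [:c:] ** diff_op 0 F P" for P
      unfolding F by (simp add: fun_eq_iff)
    \<comment> \<open>At order zero the symbol equation says that K commutes with
      \<open>swap\<close>, so K has rows (a, b) and (b, a). By \<open>J'\<close> one off-diagonal
      entry vanishes, hence both do, and K is scalar.\<close>
    from commutator_symbol[OF this] have "mpoly_const swap ** mpoly_const K - mpoly_const K ** mpoly_const swap = 0"
      by (simp add: F0 vec_eq_iff del: mpoly_const_simps)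
    then have "mpoly_coeff (mpoly_const swap ** mpoly_const K - mpoly_const K ** mpoly_const swap) 0 = 0"
      by (simp only: mpoly_coeff_simps)
    moreover have "mpoly_coeff (mpoly_const M) 0 = M" for M
      by (simp add: mpoly_coeff_def mpoly_const_def vec_eq_iff)
    ultimately have "swap ** K - K ** swap = 0"
      by (simp only: mpoly_coeff_simps)
    then have "(swap ** K - K ** swap) $ 1 $ 1 = 0" "(swap ** K - K ** swap) $ 1 $ 2 = 0"
      by (simp_all only: zero_index)
    then have k: "K $ 2 $ 1 = K $ 1 $ 2" "K $ 2 $ 2 = K $ 1 $ 1"
      by (simp_all add: swap_def matrix_matrix_mult_def sum_2)
    have K0: "K $ i $ j = 0" if "(i, j) \<notin> J" for i j
      using 0(3)[OF that] by (simp only: K)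
    from J' have "K $ 1 $ 2 = 0"
      by (elim disjE) (use K0[of 1 2] K0[of 2 1] k(1) in simp_all)
    with k show ?case
      by (intro modelI[of _ "K$1$1" 0 0 0 0]) (simp add: K vec_eq_iff forall_2)
  next
    case (Suc s)
    show ?case
    proof (cases "odd (Suc s)")
      case True
      then show ?thesis
        using order_lower[OF Suc.prems(1,2) comm[OF Suc.prems(1,3)]] Suc.IH Suc.prems by blast
    next
      case False
      then obtain m where m: "Suc s = 2 + 2 * m" by (auto elim!: evenE oddE)
      obtain F where F: "D = diff_op (Suc s) F" using Suc.prems(2) by (auto simp: diff_ops_def)
      obtain e where e: "\<And>k l w. eigenvalue D w $ k $ l = poly (e k l) (of_nat w)"
        "\<And>k l. degree (e k l) \<le> Suc s"
        using W_ops_eigenvalue_poly[of "Suc s" F] Suc.prems(1) unfolding F by metis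
      define C :: mat2 where "C = (\<chi> k l. coeff (e k l) (Suc s))"
      have C0: "C $ k $ l = 0" if "(k, l) \<notin> J" for k l
      proof -
        have "e k l = 0" using Suc.prems(3)[OF that] e(1)[of _ k l] by (intro poly_eq_on_nat) simp
        then show ?thesis by (simp add: C_def)
      qed
      define EV :: "nat \<Rightarrow> mat2" where "EV w = vector [
        vector [C$1$1 * (t_val w + \<alpha>1) ^ Suc m, C$1$2 * (f4 w * (t_val w + \<alpha>2) ^ m)],
        vector [C$2$1 * (f3 w * (t_val w + \<alpha>1) ^ m), C$2$2 * (t_val w + \<alpha>2) ^ Suc m]]" for w
      obtain E where E: "E \<in> W_ops" "E \<in> diff_ops (Suc s)" "\<And>w. eigenvalue E w = EV w"
        using model_op[of m "C$1$1" "C$1$2" "C$2$1" "C$2$2"] unfolding m EV_def by blast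
      obtain e' where e': "\<And>k l. degree (e' k l) \<le> Suc s" "\<And>k l. coeff (e' k l) (Suc s) = C $ k $ l"
        "\<And>k l w. EV w $ k $ l = poly (e' k l) (of_nat w)"
        using model_op_polys[of m C] unfolding m EV_def by blast
      define D' where "D' = (\<lambda>P. D P + mat [:-1:] ** E P)"
      have D': "D' \<in> W_ops" "D' \<in> diff_ops (Suc s)"
        unfolding D'_def by (intro W_ops_add W_ops_scalar Suc.prems E diff_ops_add diff_ops_scalar)+
      have ev: "eigenvalue D' w = eigenvalue D w - EV w" for w
        unfolding D'_def W_ops_add(2)[OF Suc.prems(1) W_ops_scalar(1)[OF E(1)]] W_ops_scalar(2)[OF E(1)] E(3)
        by (simp add: vec_eq_iff)
      have EV0: "EV w $ k $ l = 0" if "(k, l) \<notin> J" for w k l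
        using C0[OF that] exhaust_2[of k] exhaust_2[of l] by (auto simp: EV_def)
      have ev0: "eigenvalue D' w $ k $ l = 0" if "(k, l) \<notin> J" for w k l
        using that EV0 Suc.prems(3) by (simp add: ev)
      have "D' \<in> diff_ops s"
      proof (rule order_lower[OF D' comm[OF D'(1) ev0]], assumption, rule disjI2, intro allI)
        fix k l
        let ?f = "e k l - e' k l"
        have "degree ?f \<le> Suc s" using e(2) e'(1) by (intro degree_diff_le)
        moreover have "coeff ?f (Suc s) = 0" by (simp add: e'(2) C_def)
        ultimately have "degree ?f < Suc s"
          by (metis degree_0 leading_coeff_0_iff le_neq_implies_less zero_less_Suc)
        then show "\<exists>f. degree f < Suc s \<and> (\<forall>w. eigenvalue D' w $ k $ l = poly f (of_nat w))"
          by (intro exI[of _ ?f]) (simp add: ev e(1) e'(3))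
      qed
      then have "eigenvalue D' \<in> model" using Suc.IH[OF D'(1) _ ev0] by blast
      moreover have "EV \<in> model"
        by (rule modelI[of _ 0 "Polynomial.smult (C$1$1) ([:\<alpha>1, 1:] ^ m)" "Polynomial.smult (C$1$2) ([:\<alpha>2, 1:] ^ m)"
            "Polynomial.smult (C$2$1) ([:\<alpha>1, 1:] ^ m)" "Polynomial.smult (C$2$2) ([:\<alpha>2, 1:] ^ m)"])
          (simp add: EV_def poly_power add.commute mult_ac)
      ultimately have "(\<lambda>w. eigenvalue D' w + EV w) \<in> model" by (rule model_add)
      then show ?thesis by (simp add: ev)
    qed
  }
qed


section \<open>Identification of all eigenvalue sequences\<close>

definition spec :: "(nat \<Rightarrow> mat2) set" where "spec = eigenvalue ` W_ops"

lemma specI: "D \<in> W_ops \<Longrightarrow> (\<And>w. eigenvalue D w = \<Lambda> w) \<Longrightarrow> \<Lambda> \<in> spec"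
  unfolding spec_def by (rule image_eqI[of _ _ D]) auto

lemma spec_add: "\<Lambda> \<in> spec \<Longrightarrow> \<Lambda>' \<in> spec \<Longrightarrow> (\<lambda>w. \<Lambda> w + \<Lambda>' w) \<in> spec"
  unfolding spec_def by (elim imageE) (simp only:, rule specI[OF W_ops_add(1), unfolded spec_def], assumption, assumption, rule W_ops_add(2))

lemma spec_mult: "\<Lambda> \<in> spec \<Longrightarrow> \<Lambda>' \<in> spec \<Longrightarrow> (\<lambda>w. \<Lambda> w ** \<Lambda>' w) \<in> spec"
  unfolding spec_def by (elim imageE) (simp only:, rule specI[OF W_ops_comp(1), unfolded spec_def], assumption, assumption, rule W_ops_comp(2))

lemma spec_scalar: "\<Lambda> \<in> spec \<Longrightarrow> (\<lambda>w. mat c ** \<Lambda> w) \<in> spec"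
  unfolding spec_def by (elim imageE) (simp only:, rule specI[OF W_ops_scalar(1), unfolded spec_def], assumption, rule W_ops_scalar(2))

lemma spec_cong: "\<Lambda> \<in> spec \<Longrightarrow> (\<And>w. \<Lambda>' w = \<Lambda> w) \<Longrightarrow> \<Lambda>' \<in> spec"
proof -
  assume "\<Lambda> \<in> spec" "\<And>w. \<Lambda>' w = \<Lambda> w"
  moreover from this(2) have "\<Lambda>' = \<Lambda>" by (rule ext)
  ultimately show ?thesis by simp
qed

lemma spec_D: "eigenvalue D0 \<in> spec" "eigenvalue D1 \<in> spec" "eigenvalue D2 \<in> spec" "eigenvalue D3 \<in> spec"
  "eigenvalue D4 \<in> spec" "eigenvalue id \<in> spec"
  using D0_in D_in_W_ops W_ops_id(1) by (auto simp: spec_def)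

lemma pure_spec_model:
  assumes "\<Lambda> \<in> spec"
    and "\<And>k l. (k, l) \<in> J \<Longrightarrow> (if k = 1 then \<alpha>1 else \<alpha>2) - (if l = 1 then \<alpha>1 else \<alpha>2) = c"
    and "(1, 2) \<notin> J \<or> (2, 1) \<notin> J"
    and "\<And>w k l. (k, l) \<notin> J \<Longrightarrow> \<Lambda> w $ k $ l = 0"
  shows "\<Lambda> \<in> model"
proof -
  obtain D where D: "D \<in> W_ops" "\<Lambda> = eigenvalue D" using assms(1) by (auto simp: spec_def)
  obtain s where "D \<in> diff_ops s" using W_ops_diff_ops[OF D(1)] by blast
  from pure_type_model[OF assms(2,3) D(1) this] assms(4) show ?thesis unfolding D(2) by blast
qed

text \<open>The commutator with \<open>D0\<close> has eigenvalues \<open>0\<close> and \<open>\<plusminus> (\<alpha>1 - \<alpha>2)\<close> on the algebra and separates the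
  diagonal part and the two off-diagonal parts of an operator.\<close>

lemma spec_subset_model:
  assumes \<Lambda>: "\<Lambda> \<in> spec"
  shows "\<Lambda> \<in> model"
proof -
  define a where "a = \<alpha>1 - \<alpha>2"
  have a: "a \<noteq> 0" using alpha_diff(2) by (simp add: a_def)
  define ad where "ad M w = eigenvalue D0 w ** M w + mat (-1) ** (M w ** eigenvalue D0 w)" for M :: "nat \<Rightarrow> mat2" and w
  have ad: "ad M \<in> spec" if "M \<in> spec" for M
    unfolding ad_def using spec_add[OF spec_mult[OF spec_D(1) that] spec_scalar[OF spec_mult[OF that spec_D(1)], of "-1"]] .
  have ad_val: "ad M w = vector [vector [0, a * M w $ 1 $ 2], vector [- a * M w $ 2 $ 1, 0]]" for M w
    by (simp add: ad_def eigenvalue_D0 D_eigenvalues mat2_simps matrix_unit_def mat_def a_def algebra_simps)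
  \<comment> \<open>The map \<open>ad\<close> is multiplication by a on the (1,2) entry, by -a on
    the (2,1) entry and by 0 on the diagonal. Hence (ad^2 / a^2 + ad / a) / 2 projects to the (1,2)
    entry, and the opposite sign gives the (2,1) entry.\<close>
  have 12: "(\<lambda>w. matrix_unit 1 2 (\<Lambda> w $ 1 $ 2)) \<in> spec"
    by (rule spec_cong[OF spec_add[OF spec_scalar[OF ad[OF ad[OF \<Lambda>]], of "1 / (2 * a\<^sup>2)"] spec_scalar[OF ad[OF \<Lambda>], of "1 / (2 * a)"]]])
      (use a in \<open>simp add: ad_val vec_eq_iff forall_2 matrix_unit_def power2_eq_square field_simps\<close>)
  have 21: "(\<lambda>w. matrix_unit 2 1 (\<Lambda> w $ 2 $ 1)) \<in> spec"
    by (rule spec_cong[OF spec_add[OF spec_scalar[OF ad[OF ad[OF \<Lambda>]], of "1 / (2 * a\<^sup>2)"] spec_scalar[OF ad[OF \<Lambda>], of "- 1 / (2 * a)"]]])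
      (use a in \<open>simp add: ad_val vec_eq_iff forall_2 matrix_unit_def power2_eq_square field_simps\<close>)
  have d: "(\<lambda>w. matrix_unit 1 1 (\<Lambda> w $ 1 $ 1) + matrix_unit 2 2 (\<Lambda> w $ 2 $ 2)) \<in> spec"
    by (rule spec_cong[OF spec_add[OF \<Lambda> spec_scalar[OF spec_add[OF 12 21], of "-1"]]])
      (simp add: vec_eq_iff forall_2 matrix_unit_def)
  have m12: "(\<lambda>w. matrix_unit 1 2 (\<Lambda> w $ 1 $ 2)) \<in> model"
    by (rule pure_spec_model[OF 12, of "{(1, 2)}" a]) (auto simp: a_def matrix_unit_def)
  have m21: "(\<lambda>w. matrix_unit 2 1 (\<Lambda> w $ 2 $ 1)) \<in> model"
    by (rule pure_spec_model[OF 21, of "{(2, 1)}" "- a"]) (auto simp: a_def matrix_unit_def)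
  have md: "(\<lambda>w. matrix_unit 1 1 (\<Lambda> w $ 1 $ 1) + matrix_unit 2 2 (\<Lambda> w $ 2 $ 2)) \<in> model"
    by (rule pure_spec_model[OF d, of "{(1, 1), (2, 2)}" 0]) (auto simp: matrix_unit_def)
  have "(\<lambda>w. matrix_unit 1 2 (\<Lambda> w $ 1 $ 2) + matrix_unit 2 1 (\<Lambda> w $ 2 $ 1)
      + (matrix_unit 1 1 (\<Lambda> w $ 1 $ 1) + matrix_unit 2 2 (\<Lambda> w $ 2 $ 2))) \<in> model"
    by (rule model_add[OF model_add[OF m12 m21] md])
  also have "(\<lambda>w. matrix_unit 1 2 (\<Lambda> w $ 1 $ 2) + matrix_unit 2 1 (\<Lambda> w $ 2 $ 1)
      + (matrix_unit 1 1 (\<Lambda> w $ 1 $ 1) + matrix_unit 2 2 (\<Lambda> w $ 2 $ 2))) = \<Lambda>"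
    by (simp add: fun_eq_iff vec_eq_iff forall_2 matrix_unit_def)
  finally show ?thesis .
qed

text \<open>Horner scheme: a factor t arises from multiplying on the right by the unit with t +
  \<alpha> and subtracting \<alpha> times the previous stage.\<close>

lemma spec_poly_multiple:
  assumes U: "(\<lambda>w. matrix_unit i j (b w)) \<in> spec" and V: "(\<lambda>w. matrix_unit j j (t_val w + \<alpha>)) \<in> spec"
  shows "(\<lambda>w. matrix_unit i j (b w * poly h (t_val w))) \<in> spec"
proof (induction h)
  case 0
  show ?case
    by (rule spec_cong[OF spec_scalar[OF U, of 0]]) (simp add: vec_eq_iff matrix_unit_def)
next
  case (pCons a h)
  show ?case
    by (rule spec_cong[OF spec_add[OF spec_scalar[OF U, of a]
        spec_add[OF spec_mult[OF pCons.IH V] spec_scalar[OF pCons.IH, of "- \<alpha>"]]]])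
      (simp add: matrix_unit_mult, simp add: vec_eq_iff matrix_unit_def algebra_simps)
qed

lemma model_subset_spec:
  assumes "\<Lambda> \<in> model"
  shows "\<Lambda> \<in> spec"
proof -
  obtain c h11 h12 h21 h22 where \<Lambda>: "\<And>w. \<Lambda> w = vector [
     vector [c + (t_val w + \<alpha>1) * poly h11 (t_val w), f4 w * poly h12 (t_val w)],
     vector [f3 w * poly h21 (t_val w), c + (t_val w + \<alpha>2) * poly h22 (t_val w)]]"
    using assms unfolding model_def by blast
  have s: "(\<lambda>w. matrix_unit 1 1 (t_val w + \<alpha>1)) \<in> spec" "(\<lambda>w. matrix_unit 2 2 (t_val w + \<alpha>2)) \<in> spec"
    "(\<lambda>w. matrix_unit 2 1 (f3 w)) \<in> spec" "(\<lambda>w. matrix_unit 1 2 (f4 w)) \<in> spec"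
    by (rule spec_cong[OF spec_D(2)] spec_cong[OF spec_D(3)] spec_cong[OF spec_D(4)] spec_cong[OF spec_D(5)],
      simp add: D_eigenvalues)+
  show ?thesis
    by (rule spec_cong[OF spec_add[OF spec_scalar[OF spec_D(6), of c]
        spec_add[OF spec_add[OF spec_poly_multiple[OF s(1,1), of h11] spec_poly_multiple[OF s(2,2), of h22]]
          spec_add[OF spec_poly_multiple[OF s(3,1), of h21] spec_poly_multiple[OF s(4,2), of h12]]]]])
      (simp add: \<Lambda> W_ops_id(2) vec_eq_iff forall_2 matrix_unit_def, simp add: mat_def)
qed

section \<open>The algebra as an order over the nodal curve\<close>

text \<open>A polynomial in t is determined by its values on an infinite set of points, so
  injectivity makes \<open>entry\<close> well defined.\<close>

lemma inj_t_val: "inj t_val"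
proof (rule injI)
  fix v w assume "t_val v = t_val w"
  moreover have "t_val w = cx (real w * (real w + n + 1))" for w by (simp add: t_val_def)
  ultimately have eq: "real v * (real v + n + 1) = real w * (real w + n + 1)"
    by (simp only: of_real_eq_iff)
  then have "(real v - real w) * (real v + real w + n + 1) = 0" by (simp add: algebra_simps)
  moreover have "real v + real w + n + 1 > 0" using n_pos by simp
  ultimately show "v = w" by simp
qed

text \<open>Conjugation by \<open>diag (f3, 1)\<close> turns the off-diagonal entries of the eigenvalues into polynomials
  in \<open>t_val w\<close>, because \<open>f3 f4 = (t + \<alpha>1) (t + \<alpha>2)\<close>.\<close>

definition entry :: "(nat \<Rightarrow> complex) \<Rightarrow> complex poly" where
  "entry g = (THE a. \<forall>w. g w = poly a (t_val w))"

lemma entry_eqI: "(\<And>w. g w = poly a (t_val w)) \<Longrightarrow> entry g = a"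
  unfolding entry_def by (rule the_equality) (auto intro: poly_eq_on_inj[OF inj_t_val])

definition E11 where "E11 D = entry (\<lambda>w. eigenvalue D w $ 1 $ 1)"
definition E12 where "E12 D = entry (\<lambda>w. f3 w * eigenvalue D w $ 1 $ 2)"
definition E21 where "E21 D = entry (\<lambda>w. eigenvalue D w $ 2 $ 1 / f3 w)"
definition E22 where "E22 D = entry (\<lambda>w. eigenvalue D w $ 2 $ 2)"

lemma entries_model:
  assumes \<Lambda>: "\<And>w. eigenvalue D w = vector [
     vector [c + (t_val w + \<alpha>1) * poly h11 (t_val w), f4 w * poly h12 (t_val w)],
     vector [f3 w * poly h21 (t_val w), c + (t_val w + \<alpha>2) * poly h22 (t_val w)]]"
  shows "E11 D = [:c:] + [:\<alpha>1, 1:] * h11" "E12 D = [:\<alpha>1, 1:] * ([:\<alpha>2, 1:] * h12)" "E21 D = h21"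
    "E22 D = [:c:] + [:\<alpha>2, 1:] * h22"
proof -
  show "E11 D = [:c:] + [:\<alpha>1, 1:] * h11" "E22 D = [:c:] + [:\<alpha>2, 1:] * h22"
    unfolding E11_def E22_def by (rule entry_eqI; simp add: \<Lambda> algebra_simps)+
  show "E21 D = h21"
    unfolding E21_def by (rule entry_eqI) (simp add: \<Lambda> f3_nonzero)
  have "f3 w * eigenvalue D w $ 1 $ 2 = poly ([:\<alpha>1, 1:] * ([:\<alpha>2, 1:] * h12)) (t_val w)" for w
  proof -
    have "f3 w * eigenvalue D w $ 1 $ 2 = (f3 w * f4 w) * poly h12 (t_val w)" by (simp add: \<Lambda>)
    then show ?thesis by (simp only: f34) (simp add: algebra_simps)
  qed
  then show "E12 D = [:\<alpha>1, 1:] * ([:\<alpha>2, 1:] * h12)"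
    unfolding E12_def by (rule entry_eqI)
qed

lemma W_ops_entries:
  assumes "D \<in> W_ops"
  shows "eigenvalue D w $ 1 $ 1 = poly (E11 D) (t_val w)" "f3 w * eigenvalue D w $ 1 $ 2 = poly (E12 D) (t_val w)"
    "eigenvalue D w $ 2 $ 1 = f3 w * poly (E21 D) (t_val w)" "eigenvalue D w $ 2 $ 2 = poly (E22 D) (t_val w)"
    and "poly (E12 D) (- \<alpha>1) = 0" "poly (E12 D) (- \<alpha>2) = 0" "poly (E11 D) (- \<alpha>1) = poly (E22 D) (- \<alpha>2)"
proof -
  have "eigenvalue D \<in> model" using assms spec_subset_model by (auto simp: spec_def)
  then obtain c h11 h12 h21 h22 where \<Lambda>: "\<And>w. eigenvalue D w = vector [
     vector [c + (t_val w + \<alpha>1) * poly h11 (t_val w), f4 w * poly h12 (t_val w)],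
     vector [f3 w * poly h21 (t_val w), c + (t_val w + \<alpha>2) * poly h22 (t_val w)]]"
    unfolding model_def by blast
  note E = entries_model[OF \<Lambda>]
  show "eigenvalue D w $ 1 $ 1 = poly (E11 D) (t_val w)" "eigenvalue D w $ 2 $ 2 = poly (E22 D) (t_val w)"
    "eigenvalue D w $ 2 $ 1 = f3 w * poly (E21 D) (t_val w)"
    by (simp_all add: \<Lambda> E algebra_simps)
  have "f3 w * eigenvalue D w $ 1 $ 2 = (f3 w * f4 w) * poly h12 (t_val w)" by (simp add: \<Lambda>)
  then show "f3 w * eigenvalue D w $ 1 $ 2 = poly (E12 D) (t_val w)"
    unfolding f34 E(2) poly_mult by (simp add: add.commute)
  show "poly (E12 D) (- \<alpha>1) = 0" "poly (E12 D) (- \<alpha>2) = 0" "poly (E11 D) (- \<alpha>1) = poly (E22 D) (- \<alpha>2)"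
    unfolding E poly_mult poly_add by simp_all
qed

text \<open>The conditions are divisibilities: a - k by t + \<alpha>1, d - k by t + \<alpha>2, and b
  by their product because the nodes differ. The quotients are the parameters of a sequence in
  \<open>model\<close>.\<close>

lemma W_ops_surj:
  assumes b: "poly b (- \<alpha>1) = 0" "poly b (- \<alpha>2) = 0" and ad: "poly a (- \<alpha>1) = poly d (- \<alpha>2)"
  shows "\<exists>D\<in>W_ops. E11 D = a \<and> E12 D = b \<and> E21 D = c \<and> E22 D = d"
proof -
  define k where "k = poly a (- \<alpha>1)"
  have "[:\<alpha>1, 1:] dvd a - [:k:]" "[:\<alpha>2, 1:] dvd d - [:k:]" "[:\<alpha>1, 1:] dvd b"
    using b(1) ad poly_eq_0_iff_dvd[of "a - [:k:]" "- \<alpha>1"] poly_eq_0_iff_dvd[of "d - [:k:]" "- \<alpha>2"]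
      poly_eq_0_iff_dvd[of b "- \<alpha>1"] by (simp_all add: k_def)
  then obtain h11 h22 b' where h: "a - [:k:] = [:\<alpha>1, 1:] * h11" "d - [:k:] = [:\<alpha>2, 1:] * h22" "b = [:\<alpha>1, 1:] * b'"
    by (elim dvdE)
  have "(\<alpha>1 - \<alpha>2) * poly b' (- \<alpha>2) = 0"
    using b(2) unfolding h(3) poly_mult by simp
  then have "poly b' (- \<alpha>2) = 0" using alpha_diff(2) by simp
  then have "[:\<alpha>2, 1:] dvd b'" using poly_eq_0_iff_dvd[of b' "- \<alpha>2"] by simp
  then obtain h12 where h12: "b' = [:\<alpha>2, 1:] * h12" by (elim dvdE)
  define \<Lambda> :: "nat \<Rightarrow> mat2" where "\<Lambda> w = vector [
     vector [k + (t_val w + \<alpha>1) * poly h11 (t_val w), f4 w * poly h12 (t_val w)],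
     vector [f3 w * poly c (t_val w), k + (t_val w + \<alpha>2) * poly h22 (t_val w)]]" for w
  have "\<Lambda> \<in> spec" by (rule model_subset_spec, rule modelI, rule \<Lambda>_def)
  then obtain D where D: "D \<in> W_ops" "\<And>w. eigenvalue D w = \<Lambda> w" by (auto simp: spec_def)
  note E = entries_model[OF D(2)[unfolded \<Lambda>_def]]
  have "a = [:k:] + [:\<alpha>1, 1:] * h11" "d = [:k:] + [:\<alpha>2, 1:] * h22"
    using h(1,2) by (metis add.commute diff_add_cancel)+
  with E h(3) h12 D(1) show ?thesis by (intro bexI[of _ D] conjI) (simp_all only:)
qed

text \<open>In a product the factors f3 and 1 / f3 of the off-diagonal entries cancel, so the
  entries multiply as matrices over C[t]. They determine the operator because f3 has no zeros on the
  sequence and eigenvalues determine operators.\<close>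

lemma nodal_order_op_algebra: "nodal_order (op_algebra (weight p n)) E11 E12 E21 E22 (- \<alpha>1) (- \<alpha>2)"
proof (rule nodal_order.intro)
  show "Ring.ring (op_algebra (weight p n))" by (rule ring_op_algebra)
  show "- \<alpha>1 \<noteq> - \<alpha>2" using alpha_diff(2) by simp
next
  fix D assume "D \<in> carrier (op_algebra (weight p n))"
  then have "D \<in> W_ops" by (simp add: op_algebra_def)
  then show "poly (E12 D) (- \<alpha>1) = 0 \<and> poly (E12 D) (- \<alpha>2) = 0 \<and> poly (E11 D) (- \<alpha>1) = poly (E22 D) (- \<alpha>2)"
    using W_ops_entries by blast
next
  fix a b c d assume "poly b (- \<alpha>1) = 0" "poly b (- \<alpha>2) = 0" "poly a (- \<alpha>1) = poly d (- \<alpha>2)"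
  then show "\<exists>D\<in>carrier (op_algebra (weight p n)). E11 D = a \<and> E12 D = b \<and> E21 D = c \<and> E22 D = d"
    using W_ops_surj by (simp add: op_algebra_def)
next
  fix D E assume "D \<in> carrier (op_algebra (weight p n))" "E \<in> carrier (op_algebra (weight p n))"
  then have DE: "D \<in> W_ops" "E \<in> W_ops" by (simp_all add: op_algebra_def)
  note ED = W_ops_entries[OF DE(1)] and EE = W_ops_entries[OF DE(2)]
  {
    assume "E11 D = E11 E" "E12 D = E12 E" "E21 D = E21 E" "E22 D = E22 E"
    then have "f3 w * eigenvalue D w $ 1 $ 2 = f3 w * eigenvalue E w $ 1 $ 2" for w
      using ED(2) EE(2) by simp
    then have "eigenvalue D w $ 1 $ 2 = eigenvalue E w $ 1 $ 2" for w
      using f3_nonzero by simp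
    then show "D = E"
      using ED(1,3,4) EE(1,3,4) \<open>E11 D = E11 E\<close> \<open>E21 D = E21 E\<close> \<open>E22 D = E22 E\<close>
      by (intro W_ops_inj[OF DE]) (simp add: mat2_simps)
  }
  show "E11 (D \<oplus>\<^bsub>op_algebra (weight p n)\<^esub> E) = E11 D + E11 E \<and> E12 (D \<oplus>\<^bsub>op_algebra (weight p n)\<^esub> E) = E12 D + E12 E \<and>
      E21 (D \<oplus>\<^bsub>op_algebra (weight p n)\<^esub> E) = E21 D + E21 E \<and> E22 (D \<oplus>\<^bsub>op_algebra (weight p n)\<^esub> E) = E22 D + E22 E"
    unfolding E11_def[of "_ \<oplus>\<^bsub>_\<^esub> _"] E12_def[of "_ \<oplus>\<^bsub>_\<^esub> _"] E21_def[of "_ \<oplus>\<^bsub>_\<^esub> _"] E22_def[of "_ \<oplus>\<^bsub>_\<^esub> _"]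
    by (intro conjI entry_eqI)
      (simp_all add: op_algebra_def W_ops_add(2)[OF DE] distrib_left ED EE f3_nonzero add_divide_distrib)
  have e: "eigenvalue (D \<otimes>\<^bsub>op_algebra (weight p n)\<^esub> E) w = eigenvalue D w ** eigenvalue E w" for w
    using W_ops_comp(2)[OF DE] by (simp add: op_algebra_def)
  have *: "eigenvalue D w $ 1 $ 2 = poly (E12 D) (t_val w) / f3 w"
    "eigenvalue E w $ 1 $ 2 = poly (E12 E) (t_val w) / f3 w" for w
    using ED(2)[of w] EE(2)[of w] f3_nonzero[of w] by (simp_all add: field_simps)
  show "E11 (D \<otimes>\<^bsub>op_algebra (weight p n)\<^esub> E) = E11 D * E11 E + E12 D * E21 E \<and>
      E12 (D \<otimes>\<^bsub>op_algebra (weight p n)\<^esub> E) = E11 D * E12 E + E12 D * E22 E \<and>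
      E21 (D \<otimes>\<^bsub>op_algebra (weight p n)\<^esub> E) = E21 D * E11 E + E22 D * E21 E \<and>
      E22 (D \<otimes>\<^bsub>op_algebra (weight p n)\<^esub> E) = E21 D * E12 E + E22 D * E22 E"
    unfolding E11_def[of "_ \<otimes>\<^bsub>_\<^esub> _"] E12_def[of "_ \<otimes>\<^bsub>_\<^esub> _"] E21_def[of "_ \<otimes>\<^bsub>_\<^esub> _"] E22_def[of "_ \<otimes>\<^bsub>_\<^esub> _"]
    by (intro conjI entry_eqI; unfold e)
      (simp_all add: matrix_matrix_mult_def sum_2 ED(1,3,4) EE(1,3,4) * f3_nonzero field_simps)
qed

end

theorem theorem6p3:
  fixes n p :: real
  assumes "0 < p" and "p < n / 2"
  defines "DW \<equiv> op_algebra (weight p n)"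
  shows "Ring.ring DW
    \<and> Module.module (center DW) (center_module DW)
    \<and> finitely_generated_module (center DW) (center_module DW)
    \<and> torsion_free_module (center DW) (center_module DW)
    \<and> \<not> flat_module TYPE(mat_op) (center DW) (center_module DW)
    \<and> \<not> projective_module TYPE(mat_op \<Rightarrow> mat_op) TYPE(mat_op) (center DW) (center_module DW)"
proof -
  interpret gegenbauer_weight n p by unfold_locales (rule assms)+
  interpret nodal_order DW E11 E12 E21 E22 "- \<alpha>1" "- \<alpha>2"
    unfolding DW_def by (rule nodal_order_op_algebra)
  show ?thesis
    using ring_R module_center_module[OF ring_R] finitely_generated torsion_free not_flat not_projective
    by blast
qed

end
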